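(* Assume objective regularity, i.e. $\nabla f,\nabla g$ are jointly Lipschitz in $(x,y)$ with constants $\ell_{f,1},\ell_{g,1}$; for every $x$, $g(x,\cdot)$ is $\rho_g$-strongly convex for some $\rho_g>0$; $f,g\in C^2$ with $\nabla^2f,\nabla^2g$ jointly Lipschitz in $(x,y)$ with constants $\ell_{f,2},\ell_{g,2}$; and for all $(x,y)$, $\|\nabla_xf(x,y)\|_2\le\ell_{f,0}$, $\|\nabla_yf(x,y)\|_2\le\ell_{f,0}$ and $\|\nabla_xg(x,y)\|_2\le\ell_{g,0}$. Assume also $\inf_{x\in\mathbb R^{d_x}}F_\mu(x)>-\infty$. Let $T\ge1$ be a fixed integer, let $c_\xi>0$ be a sufficiently small absolute numerical constant, and let the local Dikin constants be fixed as described in the context. Let the iterates be generated by the barrier-metric first-order algorithm with initial warm starts $z_0\in T_{\eta,\mu}(x_0)$, $y_0\in T^{\lambda_0}_{\eta,\mu}(x_0)$, and with a barrier-aware schedule of the form $$\alpha_k=\frac{\alpha_0}{(k+k_0)^{1/3}},\qquad \gamma_k=\gamma_0,\qquad \lambda_k=\lambda_0\Bigl(\frac{k+k_0}{k_0}\Bigr)^{1/3},\qquad \delta_k=\lambda_{k+1}-\lambda_k,$$ where the constants $\alpha_0,\gamma_0,\lambda_0,k_0,\xi,T$ are such that the barrier-aware schedule conditions of the context hold. Then the exact and proxy target neighborhoods are forward invariant (for every $k$, $z_k^{(t)}\in T_{\eta,\mu}(x_k)$ and $y_k^{(t)}\in T^{\lambda_k}_{\eta,\mu}(x_k)$ for $0\le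 t\le T$, and $z_{k+1}\in T_{\eta,\mu}(x_{k+1})$, $y_{k+1}\in T^{\lambda_{k+1}}_{\eta,\mu}(x_{k+1})$), and $$\min_{0\le k\le K-1}\|\nabla F_\mu(x_k)\|_2^2=\widetilde O(K^{-2/3}).$$ Equivalently, the algorithm reaches a point $x$ with $\|\nabla F_\mu(x)\|_2^2\le\epsilon$ within $\widetilde O(\epsilon^{-3/2})$ outer iterations.
   Context: $\widetilde O$ hides logarithmic factors and constants independent of $K$ (resp. $\epsilon$). Problem. $Y=\{y\in\mathbb R^{d_y}:Ay\le b\}$ is a compact full-dimensional polytope with nonempty interior, $a_i^\top$ ($i=1,\dots,m$) the rows of $A$; $X=\mathbb R^{d_x}$; $f,g:\mathbb R^{d_x}\times\mathbb R^{d_y}\to\mathbb R$. With $y^\star(x)=\arg\min_{y\in Y}g(x,y)$ one assumes $\inf_xf(x,y^\star(x))>-\infty$. Objective regularity: (A1) $\nabla f,\nabla g$ jointly Lipschitz with constants $\ell_{f,1},\ell_{g,1}$; (A2) $g(x,\cdot)$ is $\rho_g$-strongly convex for every $x$, $\rho_g>0$; (A3) $f,g\in C^2$ with $\nabla^2f,\nabla^2g$ jointly Lipschitz with constants $\ell_{f,2},\ell_{g,2}$; (A4) for all $(x,y)$, $\|\nabla_xf\|_2,\|\nabla_yf\|_2\le\ell_{f,0}$ and $\|\nabla_xg\|_2\le\ell_{g,0}$. Barrier objects ($\mu>0$ fixed). $\phi(y)=-\sum_i\log(b_i-a_i^\top y)$; $\psi_\mu(x,y)=g(x,y)+\mu\phi(y)$;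 $y_\mu^\star(x)=\arg\min_{y\in\operatorname{int}(Y)}\psi_\mu(x,y)$; $\psi_\mu^\star(x)=\min_{\operatorname{int}(Y)}\psi_\mu(x,\cdot)$; $F_\mu(x)=f(x,y_\mu^\star(x))$; $L_{\lambda,\mu}(x,y)=f(x,y)+\lambda(\psi_\mu(x,y)-\psi_\mu^\star(x))$; $y^\star_{\lambda,\mu}(x)\in\arg\min_{y\in\operatorname{int}(Y)}L_{\lambda,\mu}(x,y)$. Dikin geometry. For $c\in\operatorname{int}(Y)$: $H_c=\nabla^2\phi(c)$, $\|u\|_c^2=\langle H_cu,u\rangle$, $\|w\|_{c,*}^2=\langle H_c^{-1}w,w\rangle$, $\|M\|_{2\to c,*}=\sup_{\|u\|_2=1}\|Mu\|_{c,*}$, $\|M\|_{c\to c,*}=\sup_{\|u\|_c=1}\|Mu\|_{c,*}$, $\|M\|_{2\to c}=\sup_{\|u\|_2=1}\|Mu\|_c$. For $r>0$: $T_{r,\mu}(x)=\{y\in\operatorname{int}(Y):\|y-y_\mu^\star(x)\|_{y_\mu^\star(x)}\le r\}$ and $T^\lambda_{r,\mu}(x)=\{y\in\operatorname{int}(Y):\|y-y^\star_{\lambda,\mu}(x)\|_{y^\star_{\lambda,\mu}(x)}\le r\}$. A radius $\eta\in(0,1/2)$ is fixed. $\nabla^2_{xy}h\in\mathbb R^{d_y\times d_x}$ is the $x$-derivative of $\nabla_yh$. Local Dikin constants. $\rho_\psi^\eta>0$, $\ell_{\psi,1}^\eta,\ell_{\psi,2}^\eta,\ell_{f,0}^\eta,\ell_{f,1}^\eta,\ell_{f,2}^\eta$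 and a threshold $\lambda_\eta<\infty$ are finite constants, depending on $\eta,\mu,Y$ and the regularity constants only, such that for all $x$, and for both choices $(c,\mathcal T)=(y_\mu^\star(x),T_{2\eta,\mu}(x))$ and $(c,\mathcal T)=(y^\star_{\lambda,\mu}(x),T^\lambda_{2\eta,\mu}(x))$ with any $\lambda\ge\lambda_\eta$, and all $y,y_1,y_2\in\mathcal T$: $\rho_\psi^\eta H_c\preceq\nabla^2_{yy}\psi_\mu(x,y)\preceq\ell_{\psi,1}^\eta H_c$; $\|\nabla^2_{xy}\psi_\mu(x,y)\|_{2\to c,*}\le\ell_{\psi,1}^\eta$; $\|\nabla^2_{yy}\psi_\mu(x,y_1)-\nabla^2_{yy}\psi_\mu(x,y_2)\|_{c\to c,*}$ and $\|\nabla^2_{xy}\psi_\mu(x,y_1)-\nabla^2_{xy}\psi_\mu(x,y_2)\|_{2\to c,*}$ are $\le\ell_{\psi,2}^\eta\|y_1-y_2\|_c$; $\|\nabla_yf(x,y)\|_{c,*}\le\ell_{f,0}^\eta$; $\|\nabla^2_{xy}f(x,y)\|_{2\to c,*}\le\ell_{f,1}^\eta$; $\|\nabla^2_{yy}f(x,y)\|_{c\to c,*}\le\ell_{f,1}^\eta$; and the differences of $\nabla^2_{xy}f,\nabla^2_{yy}f$ satisfy the analogous Lipschitz bounds with $\ell_{f,2}^\eta$. Further $\ell_{*,0}^\eta\ge1$, $\ell_{\lambda,0}^\eta$, $L_F^\eta$, $\ell_{\lambda,1}^\eta$, $\ell_{*,1}^\eta\ge\max\{1,\ell_{\lambda,1}^\eta\}$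 are finite constants such that for all $x_1,x_2$ and $\lambda,\lambda_1,\lambda_2\ge\lambda_0$: $\|y_\mu^\star(x_2)-y_\mu^\star(x_1)\|_{y_\mu^\star(x_1)}\le\ell_{*,0}^\eta\|x_2-x_1\|_2$; $\|y^\star_{\lambda_2,\mu}(x_2)-y^\star_{\lambda_1,\mu}(x_1)\|_{y^\star_{\lambda_1,\mu}(x_1)}\le\frac{2\ell_{f,0}^\eta}{\rho_\psi^\eta}|\frac1{\lambda_2}-\frac1{\lambda_1}|+\ell_{\lambda,0}^\eta\|x_2-x_1\|_2$; $\|\nabla F_\mu(x_2)-\nabla F_\mu(x_1)\|_2\le L_F^\eta\|x_2-x_1\|_2$; and the Jacobians satisfy $\|\nabla y_\mu^\star(x_2)-\nabla y_\mu^\star(x_1)\|_{2\to y_\mu^\star(x_1)}\le\ell_{*,1}^\eta\|x_2-x_1\|_2$ and $\|\nabla y^\star_{\lambda,\mu}(x_2)-\nabla y^\star_{\lambda,\mu}(x_1)\|_{2\to y^\star_{\lambda,\mu}(x_1)}\le\ell_{\lambda,1}^\eta\|x_2-x_1\|_2$. Conventions on $\eta$ and constants. With $\theta_\eta=(1-\eta)^{-2}-1$, $\eta$ is small enough that $\theta_\eta L\le m/4$ for the curvature pairs $(m,L)=(\rho_\psi^\eta,\ell_{\psi,1}^\eta)$ and $(m,L)=(\lambda\rho_\psi^\eta/2,\lambda\ell_{\psi,1}^\eta+\ell_{f,1}^\eta)$, $\lambda\ge\lambda_0$. The local Dikin constants are understood after absorbing fixed $\eta$-dependent factors coming from comparing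 the frozen metrics $\nabla^2\phi(z_k),\nabla^2\phi(y_k)$ with the center metrics ($\rho_\psi^\eta$ decreased, the other constants increased). The initial multiplier satisfies $\lambda_0\ge\lambda_\eta$. Algorithm (inner length $T$, ratio $\xi>0$, $x_0\in\mathbb R^{d_x}$, $y_0,z_0\in\operatorname{int}(Y)$). For $k=0,1,\dots$: $z_k^{(0)}=z_k$, $y_k^{(0)}=y_k$; for $t=0,\dots,T-1$, $z_k^{(t+1)}=z_k^{(t)}-\gamma_k\nabla^2\phi(z_k)^{-1}\nabla_y\psi_\mu(x_k,z_k^{(t)})$ and $y_k^{(t+1)}=y_k^{(t)}-\alpha_k\nabla^2\phi(y_k)^{-1}\bigl(\nabla_yf(x_k,y_k^{(t)})+\lambda_k\nabla_y\psi_\mu(x_k,y_k^{(t)})\bigr)$; then $z_{k+1}=z_k^{(T)}$, $y_{k+1}=y_k^{(T)}$, $q_k^x=\nabla_xf(x_k,y_{k+1})+\lambda_k(\nabla_xg(x_k,y_{k+1})-\nabla_xg(x_k,z_{k+1}))$, $x_{k+1}=x_k-\xi\alpha_kq_k^x$, $\lambda_{k+1}=\lambda_k+\delta_k$. Barrier-aware schedule. With $\beta_k=\alpha_k\lambda_k$, for all $k$: (S1) $\lambda_0\ge\max\{2\ell_{f,1}^\eta/\rho_\psi^\eta,\ 8\ell_{f,0}^\eta/(\eta\rho_\psi^\eta)\}$, $\beta_k\le\gamma_k\le\min\{1/(4\ell_{\psi,1}^\eta),\ 1/(4T\rho_\psi^\eta)\}$, $\alpha_k\le1/(2\xi L_F^\eta)$;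 (S2) $\delta_k/\lambda_k\le T\rho_\psi^\eta\beta_k/16$, $\delta_k=\lambda_{k+1}-\lambda_k\ge0$; (S3) with $D=\ell_{f,0}/\lambda_0+2\ell_{g,0}$, $$\frac\xi T\le\min\Bigl\{\frac{\eta\rho_\psi^\eta}{16\ell_{*,0}^\eta D},\ \frac{\eta\rho_\psi^\eta}{64\ell_{\lambda,0}^\eta D},\ \frac{c_\xi\rho_\psi^\eta}{\max\{\ell_{\psi,1}^\eta(\ell_{*,0}^\eta)^2,\ \ell_{*,1}^\eta\sqrt{\max(\ell_{g,0}^2,\ell_{f,0}^2)}\}}\Bigr\}.$$ *)

theory Defs
  imports "HOL-Analysis.Analysis" "HOL-Library.Landau_Symbols"
begin

section \<open>Gradients, Hessians and regularity of the objectives\<close>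

definition gradient :: "('a::real_inner \<Rightarrow> real) \<Rightarrow> 'a \<Rightarrow> 'a" where
  "gradient h z = (THE D. GDERIV h z :> D)"

definition hessian :: "('a::real_inner \<Rightarrow> real) \<Rightarrow> 'a \<Rightarrow> 'a \<Rightarrow>\<^sub>L 'a" where
  "hessian h z = Blinfun (frechet_derivative (gradient h) (at z))"

definition twice_cont_differentiable :: "('a::real_inner \<Rightarrow> real) \<Rightarrow> bool" where
  "twice_cont_differentiable h \<longleftrightarrow>
     (\<forall>z. h differentiable (at z)) \<and> (\<forall>z. gradient h differentiable (at z)) \<and>
     continuous_on UNIV (hessian h)"

definition strongly_convex :: "real \<Rightarrow> ('a::real_normed_vector \<Rightarrow> real) \<Rightarrow> bool" where
  "strongly_convex \<rho> h \<longleftrightarrow>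
     (\<forall>u v. \<forall>t\<in>{0..1}. h ((1 - t) *\<^sub>R u + t *\<^sub>R v)
        \<le> (1 - t) * h u + t * h v - \<rho> / 2 * t * (1 - t) * (norm (u - v))\<^sup>2)"

definition grad_x :: "(real^'n \<Rightarrow> real^'p \<Rightarrow> real) \<Rightarrow> real^'n \<Rightarrow> real^'p \<Rightarrow> real^'n" where
  "grad_x h x y = gradient (\<lambda>x'. h x' y) x"

definition grad_y :: "(real^'n \<Rightarrow> real^'p \<Rightarrow> real) \<Rightarrow> real^'n \<Rightarrow> real^'p \<Rightarrow> real^'p" where
  "grad_y h x y = gradient (h x) y"

definition hess_yy :: "(real^'n \<Rightarrow> real^'p \<Rightarrow> real) \<Rightarrow> real^'n \<Rightarrow> real^'p \<Rightarrow> real^'p^'p" where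
  "hess_yy h x y = jacobian (grad_y h x) (at y)"

definition hess_xy :: "(real^'n \<Rightarrow> real^'p \<Rightarrow> real) \<Rightarrow> real^'n \<Rightarrow> real^'p \<Rightarrow> real^'n^'p" where
  "hess_xy h x y = jacobian (\<lambda>x'. grad_y h x' y) (at x)"

definition objective_regularity ::
  "(real^'n \<Rightarrow> real^'p \<Rightarrow> real) \<Rightarrow> (real^'n \<Rightarrow> real^'p \<Rightarrow> real)
     \<Rightarrow> real \<Rightarrow> real \<Rightarrow> real \<Rightarrow> real \<Rightarrow> real \<Rightarrow> real \<Rightarrow> real \<Rightarrow> bool" where
  "objective_regularity f g lf0 lf1 lf2 lg0 lg1 lg2 \<rho>g \<longleftrightarrow>
     twice_cont_differentiable (case_prod f) \<and> twice_cont_differentiable (case_prod g) \<and>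
     lf1-lipschitz_on UNIV (gradient (case_prod f)) \<and>
     lg1-lipschitz_on UNIV (gradient (case_prod g)) \<and>
     0 < \<rho>g \<and> (\<forall>x. strongly_convex \<rho>g (g x)) \<and>
     lf2-lipschitz_on UNIV (hessian (case_prod f)) \<and>
     lg2-lipschitz_on UNIV (hessian (case_prod g)) \<and>
     (\<forall>x y. norm (grad_x f x y) \<le> lf0 \<and> norm (grad_y f x y) \<le> lf0 \<and> norm (grad_x g x y) \<le> lg0)"


section \<open>Polytope, barrier and the penalised problems\<close>

definition polyhedron_Y :: "real^'p^'m \<Rightarrow> real^'m \<Rightarrow> (real^'p) set" where
  "polyhedron_Y A b = {y. A *v y \<le> b}"

definition barrier :: "real^'p^'m \<Rightarrow> real^'m \<Rightarrow> real^'p \<Rightarrow> real" where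
  "barrier A b y = - (\<Sum>i\<in>UNIV. ln (b $ i - row i A \<bullet> y))"

definition psi :: "real^'p^'m \<Rightarrow> real^'m \<Rightarrow> real \<Rightarrow> (real^'n \<Rightarrow> real^'p \<Rightarrow> real)
    \<Rightarrow> real^'n \<Rightarrow> real^'p \<Rightarrow> real" where
  "psi A b \<mu> g x y = g x y + \<mu> * barrier A b y"

definition y_star :: "real^'p^'m \<Rightarrow> real^'m \<Rightarrow> real \<Rightarrow> (real^'n \<Rightarrow> real^'p \<Rightarrow> real)
    \<Rightarrow> real^'n \<Rightarrow> real^'p" where
  "y_star A b \<mu> g x = arg_min_on (psi A b \<mu> g x) (interior (polyhedron_Y A b))"

definition psi_star :: "real^'p^'m \<Rightarrow> real^'m \<Rightarrow> real \<Rightarrow> (real^'n \<Rightarrow> real^'p \<Rightarrow> real)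
    \<Rightarrow> real^'n \<Rightarrow> real" where
  "psi_star A b \<mu> g x = (INF y\<in>interior (polyhedron_Y A b). psi A b \<mu> g x y)"

definition F_barrier :: "real^'p^'m \<Rightarrow> real^'m \<Rightarrow> real \<Rightarrow> (real^'n \<Rightarrow> real^'p \<Rightarrow> real)
    \<Rightarrow> (real^'n \<Rightarrow> real^'p \<Rightarrow> real) \<Rightarrow> real^'n \<Rightarrow> real" where
  "F_barrier A b \<mu> f g x = f x (y_star A b \<mu> g x)"

definition penalty_L :: "real^'p^'m \<Rightarrow> real^'m \<Rightarrow> real \<Rightarrow> (real^'n \<Rightarrow> real^'p \<Rightarrow> real)
    \<Rightarrow> (real^'n \<Rightarrow> real^'p \<Rightarrow> real) \<Rightarrow> real \<Rightarrow> real^'n \<Rightarrow> real^'p \<Rightarrow> real" where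
  "penalty_L A b \<mu> f g lam x y = f x y + lam * (psi A b \<mu> g x y - psi_star A b \<mu> g x)"

text \<open>
  The penalised problem need not have a unique minimiser, so \<open>yl lam x\<close> is an arbitrary selection.
\<close>

definition is_proxy_selection :: "real^'p^'m \<Rightarrow> real^'m \<Rightarrow> real \<Rightarrow> (real^'n \<Rightarrow> real^'p \<Rightarrow> real)
    \<Rightarrow> (real^'n \<Rightarrow> real^'p \<Rightarrow> real) \<Rightarrow> (real \<Rightarrow> real^'n \<Rightarrow> real^'p) \<Rightarrow> bool" where
  "is_proxy_selection A b \<mu> f g yl \<longleftrightarrow>
     (\<forall>lam>0. \<forall>x. is_arg_min (penalty_L A b \<mu> f g lam x)
        (\<lambda>y. y \<in> interior (polyhedron_Y A b)) (yl lam x))"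


section \<open>Dikin geometry\<close>

definition barrier_hess :: "real^'p^'m \<Rightarrow> real^'m \<Rightarrow> real^'p \<Rightarrow> real^'p^'p" where
  "barrier_hess A b c = jacobian (gradient (barrier A b)) (at c)"

definition dikin_norm :: "real^'p^'m \<Rightarrow> real^'m \<Rightarrow> real^'p \<Rightarrow> real^'p \<Rightarrow> real" where
  "dikin_norm A b c u = sqrt ((barrier_hess A b c *v u) \<bullet> u)"

definition dikin_dual_norm :: "real^'p^'m \<Rightarrow> real^'m \<Rightarrow> real^'p \<Rightarrow> real^'p \<Rightarrow> real" where
  "dikin_dual_norm A b c w = sqrt ((matrix_inv (barrier_hess A b c) *v w) \<bullet> w)"

definition op_norm_2_dual :: "real^'p^'m \<Rightarrow> real^'m \<Rightarrow> real^'p \<Rightarrow> real^'n^'p \<Rightarrow> real" where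
  "op_norm_2_dual A b c M = (SUP u\<in>{u. norm u = 1}. dikin_dual_norm A b c (M *v u))"

definition op_norm_c_dual :: "real^'p^'m \<Rightarrow> real^'m \<Rightarrow> real^'p \<Rightarrow> real^'p^'p \<Rightarrow> real" where
  "op_norm_c_dual A b c M = (SUP u\<in>{u. dikin_norm A b c u = 1}. dikin_dual_norm A b c (M *v u))"

definition op_norm_2_c :: "real^'p^'m \<Rightarrow> real^'m \<Rightarrow> real^'p \<Rightarrow> real^'n^'p \<Rightarrow> real" where
  "op_norm_2_c A b c M = (SUP u\<in>{u. norm u = 1}. dikin_norm A b c (M *v u))"

definition loewner_le :: "real^'p^'p \<Rightarrow> real^'p^'p \<Rightarrow> bool" (infix "\<preceq>\<^sub>L" 50) where
  "M \<preceq>\<^sub>L N \<longleftrightarrow> (\<forall>u. (M *v u) \<bullet> u \<le> (N *v u) \<bullet> u)"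

definition dikin_nbhd :: "real^'p^'m \<Rightarrow> real^'m \<Rightarrow> real \<Rightarrow> real^'p \<Rightarrow> (real^'p) set" where
  "dikin_nbhd A b r c = {y \<in> interior (polyhedron_Y A b). dikin_norm A b c (y - c) \<le> r}"


section \<open>Local Dikin constants\<close>

record dikin_consts =
  rho_psi :: real
  l_psi1 :: real
  l_psi2 :: real
  l_f0 :: real
  l_f1 :: real
  l_f2 :: real
  l_star0 :: real
  l_star1 :: real
  l_lam0 :: real
  l_lam1 :: real
  L_F :: real

definition local_bounds_at :: "real^'p^'m \<Rightarrow> real^'m \<Rightarrow> real \<Rightarrow> (real^'n \<Rightarrow> real^'p \<Rightarrow> real)
    \<Rightarrow> (real^'n \<Rightarrow> real^'p \<Rightarrow> real) \<Rightarrow> dikin_consts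
    \<Rightarrow> real^'n \<Rightarrow> real^'p \<Rightarrow> (real^'p) set \<Rightarrow> bool" where
  "local_bounds_at A b \<mu> f g C x c N \<longleftrightarrow>
     (\<forall>y\<in>N.
        rho_psi C *\<^sub>R barrier_hess A b c \<preceq>\<^sub>L hess_yy (psi A b \<mu> g) x y \<and>
        hess_yy (psi A b \<mu> g) x y \<preceq>\<^sub>L l_psi1 C *\<^sub>R barrier_hess A b c \<and>
        op_norm_2_dual A b c (hess_xy (psi A b \<mu> g) x y) \<le> l_psi1 C \<and>
        dikin_dual_norm A b c (grad_y f x y) \<le> l_f0 C \<and>
        op_norm_2_dual A b c (hess_xy f x y) \<le> l_f1 C \<and>
        op_norm_c_dual A b c (hess_yy f x y) \<le> l_f1 C) \<and>
     (\<forall>y1\<in>N. \<forall>y2\<in>N.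
        op_norm_c_dual A b c (hess_yy (psi A b \<mu> g) x y1 - hess_yy (psi A b \<mu> g) x y2)
          \<le> l_psi2 C * dikin_norm A b c (y1 - y2) \<and>
        op_norm_2_dual A b c (hess_xy (psi A b \<mu> g) x y1 - hess_xy (psi A b \<mu> g) x y2)
          \<le> l_psi2 C * dikin_norm A b c (y1 - y2) \<and>
        op_norm_2_dual A b c (hess_xy f x y1 - hess_xy f x y2)
          \<le> l_f2 C * dikin_norm A b c (y1 - y2) \<and>
        op_norm_c_dual A b c (hess_yy f x y1 - hess_yy f x y2)
          \<le> l_f2 C * dikin_norm A b c (y1 - y2))"

text \<open>
  Nothing forces the threshold \<open>lam_\<eta>\<close> to be positive; the restriction \<open>0 < lam\<close> keeps to
  multipliers for which the penalised minimiser exists.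
\<close>

definition local_dikin_constants :: "real^'p^'m \<Rightarrow> real^'m \<Rightarrow> real
    \<Rightarrow> (real^'n \<Rightarrow> real^'p \<Rightarrow> real) \<Rightarrow> (real^'n \<Rightarrow> real^'p \<Rightarrow> real)
    \<Rightarrow> (real \<Rightarrow> real^'n \<Rightarrow> real^'p) \<Rightarrow> real \<Rightarrow> real \<Rightarrow> real \<Rightarrow> dikin_consts \<Rightarrow> bool" where
  "local_dikin_constants A b \<mu> f g yl \<eta> lam_\<eta> lam0 C \<longleftrightarrow>
     0 < rho_psi C \<and> 1 \<le> l_star0 C \<and> max 1 (l_lam1 C) \<le> l_star1 C \<and>
     (\<forall>x. local_bounds_at A b \<mu> f g C x (y_star A b \<mu> g x)
            (dikin_nbhd A b (2 * \<eta>) (y_star A b \<mu> g x))) \<and>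
     (\<forall>lam>0. lam_\<eta> \<le> lam \<longrightarrow>
        (\<forall>x. local_bounds_at A b \<mu> f g C x (yl lam x) (dikin_nbhd A b (2 * \<eta>) (yl lam x)))) \<and>
     (\<forall>x1 x2.
        dikin_norm A b (y_star A b \<mu> g x1) (y_star A b \<mu> g x2 - y_star A b \<mu> g x1)
          \<le> l_star0 C * norm (x2 - x1)) \<and>
     (\<forall>lam1\<ge>lam0. \<forall>lam2\<ge>lam0. \<forall>x1 x2.
        dikin_norm A b (yl lam1 x1) (yl lam2 x2 - yl lam1 x1)
          \<le> 2 * l_f0 C / rho_psi C * \<bar>1 / lam2 - 1 / lam1\<bar> + l_lam0 C * norm (x2 - x1)) \<and>
     (\<forall>x1 x2.
        norm (gradient (F_barrier A b \<mu> f g) x2 - gradient (F_barrier A b \<mu> f g) x1)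
          \<le> L_F C * norm (x2 - x1)) \<and>
     (\<forall>x1 x2.
        op_norm_2_c A b (y_star A b \<mu> g x1)
            (jacobian (y_star A b \<mu> g) (at x2) - jacobian (y_star A b \<mu> g) (at x1))
          \<le> l_star1 C * norm (x2 - x1)) \<and>
     (\<forall>lam\<ge>lam0. \<forall>x1 x2.
        op_norm_2_c A b (yl lam x1) (jacobian (yl lam) (at x2) - jacobian (yl lam) (at x1))
          \<le> l_lam1 C * norm (x2 - x1))"

definition metric_gap :: "real \<Rightarrow> real" where
  "metric_gap \<eta> = 1 / (1 - \<eta>)\<^sup>2 - 1"

definition small_radius :: "real \<Rightarrow> real \<Rightarrow> dikin_consts \<Rightarrow> bool" where
  "small_radius \<eta> lam0 C \<longleftrightarrow>
     metric_gap \<eta> * l_psi1 C \<le> rho_psi C / 4 \<and>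
     (\<forall>lam\<ge>lam0. metric_gap \<eta> * (lam * l_psi1 C + l_f1 C) \<le> (lam * rho_psi C / 2) / 4)"


section \<open>Algorithm and step-size schedule\<close>

text \<open>
  \<open>z k t\<close> and \<open>y k t\<close> are the inner iterates of outer iteration \<open>k\<close>; the warm starts
  of iteration \<open>k\<close> are \<open>z k 0\<close> and \<open>y k 0\<close>.
\<close>

definition outer_direction :: "(real^'n \<Rightarrow> real^'p \<Rightarrow> real) \<Rightarrow> (real^'n \<Rightarrow> real^'p \<Rightarrow> real)
    \<Rightarrow> real \<Rightarrow> real^'n \<Rightarrow> real^'p \<Rightarrow> real^'p \<Rightarrow> real^'n" where
  "outer_direction f g lam x y z = grad_x f x y + lam *\<^sub>R (grad_x g x y - grad_x g x z)"

definition algorithm_run :: "real^'p^'m \<Rightarrow> real^'m \<Rightarrow> real \<Rightarrow> (real^'n \<Rightarrow> real^'p \<Rightarrow> real)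
    \<Rightarrow> (real^'n \<Rightarrow> real^'p \<Rightarrow> real) \<Rightarrow> nat \<Rightarrow> real
    \<Rightarrow> (nat \<Rightarrow> real) \<Rightarrow> (nat \<Rightarrow> real) \<Rightarrow> (nat \<Rightarrow> real)
    \<Rightarrow> (nat \<Rightarrow> real^'n) \<Rightarrow> (nat \<Rightarrow> nat \<Rightarrow> real^'p) \<Rightarrow> (nat \<Rightarrow> nat \<Rightarrow> real^'p) \<Rightarrow> bool" where
  "algorithm_run A b \<mu> f g T \<xi> \<alpha> \<gamma> lam x y z \<longleftrightarrow>
     (\<forall>k. \<forall>t<T.
        z k (Suc t) = z k t - \<gamma> k *\<^sub>R (matrix_inv (barrier_hess A b (z k 0)) *v grad_y (psi A b \<mu> g) (x k) (z k t)) \<and>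
        y k (Suc t) = y k t - \<alpha> k *\<^sub>R (matrix_inv (barrier_hess A b (y k 0)) *v
          (grad_y f (x k) (y k t) + lam k *\<^sub>R grad_y (psi A b \<mu> g) (x k) (y k t)))) \<and>
     (\<forall>k. z (Suc k) 0 = z k T \<and> y (Suc k) 0 = y k T \<and>
        x (Suc k) = x k - (\<xi> * \<alpha> k) *\<^sub>R
          outer_direction f g (lam k) (x k) (y (Suc k) 0) (z (Suc k) 0))"

text \<open>
  Upper bounds whose denominator may vanish (for instance when \<open>L_F C = 0\<close>) are multiplied out, so
  that division by zero imposes no constraint.
\<close>

definition barrier_aware_schedule :: "real \<Rightarrow> dikin_consts \<Rightarrow> real \<Rightarrow> real \<Rightarrow> real
    \<Rightarrow> nat \<Rightarrow> real \<Rightarrow> (nat \<Rightarrow> real) \<Rightarrow> (nat \<Rightarrow> real) \<Rightarrow> (nat \<Rightarrow> real) \<Rightarrow> (nat \<Rightarrow> real) \<Rightarrow> bool" where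
  "barrier_aware_schedule \<eta> C lf0 lg0 c\<^sub>\<xi> T \<xi> \<alpha> \<gamma> lam \<delta> \<longleftrightarrow>
     (let \<beta> = (\<lambda>k. \<alpha> k * lam k); D = lf0 / lam 0 + 2 * lg0 in
       max (2 * l_f1 C / rho_psi C) (8 * l_f0 C / (\<eta> * rho_psi C)) \<le> lam 0 \<and>
       (\<forall>k. \<beta> k \<le> \<gamma> k \<and>
            \<gamma> k \<le> min (1 / (4 * l_psi1 C)) (1 / (4 * real T * rho_psi C)) \<and>
            \<alpha> k * (2 * \<xi> * L_F C) \<le> 1) \<and>
       (\<forall>k. \<delta> k / lam k \<le> real T * rho_psi C * \<beta> k / 16 \<and>
            \<delta> k = lam (Suc k) - lam k \<and> 0 \<le> \<delta> k) \<and>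
       \<xi> / real T * (16 * l_star0 C * D) \<le> \<eta> * rho_psi C \<and>
       \<xi> / real T * (64 * l_lam0 C * D) \<le> \<eta> * rho_psi C \<and>
       \<xi> / real T \<le> c\<^sub>\<xi> * rho_psi C /
         max (l_psi1 C * (l_star0 C)\<^sup>2) (l_star1 C * sqrt (max (lg0\<^sup>2) (lf0\<^sup>2))))"

text \<open>
  An explicit admissible value for the sufficiently small absolute constant.  Since the dimensions
  are type variables of the theorem, a constant that is existentially quantified inside it could
  depend on them; a fixed number cannot.
\<close>

definition c_abs :: real where
  "c_abs = 1 / 10 ^ 6"

end

theory Submission
  imports Defs "HOL-Real_Asymp.Real_Asymp"
begin

text \<open>
  The algorithm is a two-time-scale scheme: the inner loops track the minimiser \<open>u = y\<^sub>\<mu>(x)\<close> of the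
  barrier problem and the minimiser \<open>p = y\<^sub>\<lambda>\<^sub>,\<^sub>\<mu>(x)\<close> of the penalised problem, and the outer loop descends
  along a direction that equals \<open>\<nabla>F\<^sub>\<mu>(x)\<close> up to the two tracking errors and a penalty bias.

  All distances are measured in the Dikin norm at the respective target.  The minimisers may approach
  the boundary of the polytope as \<open>x\<close> runs to infinity, so Euclidean bounds on the barrier Hessian would
  not be uniform in \<open>x\<close>, whereas the log-barrier metric changes by a factor close to one over a Dikin
  ball of small radius (\<open>dn_change_centre\<close>, \<open>barrier_hess_diff_le\<close>).

  Invariance.  A gradient step preconditioned by the frozen metric contracts towards the target
  (\<open>preconditioned_step\<close>), and with \<open>\<tau> = T \<rho> \<beta>\<close>, where \<open>\<beta> = \<alpha>\<^sub>k \<lambda>\<^sub>k\<close> does not depend on \<open>k\<close>, a whole inner loop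
  contracts by \<open>1 - \<tau> / 6\<close>.  The outer step and the change of the multiplier move the targets by at most
  \<open>\<eta> \<tau> / 16\<close>, which is less than the contraction gains (\<open>recentre\<close>, \<open>warm_starts_invariant\<close>).

  Bias.  Stationarity of \<open>p\<close> gives \<open>\<lambda> \<nabla>\<^sup>2\<psi> (p - u) = - \<nabla>\<^sub>y f + O(1 / \<lambda>)\<close>.  Hence
  \<open>\<lambda> (\<nabla>\<^sub>x g(x, p) - \<nabla>\<^sub>x g(x, u))\<close> is the implicit part of \<open>\<nabla>F\<^sub>\<mu>\<close> up to \<open>O(1 / \<lambda>)\<close> (\<open>hypergradient\<close>,
  \<open>proxy_bias\<close>).  For the same reason \<open>p - u\<close> is Lipschitz in \<open>x\<close> with a constant of order \<open>1 / \<lambda>\<close>, so that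
  for large \<open>\<lambda>\<close> both targets move with the Lipschitz constant of \<open>y\<^sub>\<mu>\<close> (\<open>proxy_shift\<close>).

  Rate.  The Lyapunov function \<open>V\<^sub>k = F\<^sub>\<mu>(x\<^sub>k) + w \<lambda>\<^sub>k (E\<^sub>z\<^sup>2 + E\<^sub>y\<^sup>2)\<close> weighs the squared tracking errors with the
  multiplier.  Their contraction dominates the error \<open>\<xi> \<alpha>\<^sub>k \<lambda>\<^sub>k\<^sup>2 E\<^sup>2 = \<xi> \<beta> \<lambda>\<^sub>k E\<^sup>2\<close> that they cause in the descent of
  \<open>F\<^sub>\<mu>\<close>, while the motion of the targets is absorbed by the squared outer direction because \<open>\<xi> / T\<close> is small.
  What remains is \<open>V\<^sub>k\<^sub>+\<^sub>1 \<le> V\<^sub>k - \<xi> \<alpha>\<^sub>k / 2 \<parallel>\<nabla>F\<^sub>\<mu>(x\<^sub>k)\<parallel>\<^sup>2 + O(1 / k)\<close> once \<open>\<lambda>\<^sub>k\<close> is large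
  (\<open>lyapunov_descent\<close>).  Summation bounds \<open>\<Sum> \<alpha>\<^sub>k \<parallel>\<nabla>F\<^sub>\<mu>(x\<^sub>k)\<parallel>\<^sup>2\<close> by a logarithm, and \<open>\<Sum> \<alpha>\<^sub>k\<close> grows like
  \<open>K\<^sup>2\<^sup>/\<^sup>3\<close> (\<open>min_rate_of_descent\<close>, \<open>complexity_of_min_rate\<close>).
\<close>

section \<open>Gradients and second derivatives\<close>

lemma gradient_eqI:
  assumes "GDERIV h z :> d"
  shows "gradient h z = d"
proof -
  have "d' = d" if "GDERIV h z :> d'" for d'
  proof -
    have "(\<lambda>v. inner v d') = (\<lambda>v. inner v d)"
      using that assms has_derivative_unique unfolding gderiv_def by blast
    then have "inner (d' - d) d' = inner (d' - d) d" by metis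
    then have "inner (d' - d) (d' - d) = 0" by (simp add: inner_diff_right)
    then show ?thesis by simp
  qed
  then show ?thesis unfolding gradient_def using assms by blast
qed

lemma GDERIV_gradient:
  fixes h :: "'a::euclidean_space \<Rightarrow> real"
  assumes "h differentiable (at z)"
  shows "GDERIV h z :> gradient h z"
proof -
  obtain h' where h': "(h has_derivative h') (at z)"
    using assms unfolding differentiable_def by blast
  interpret h': bounded_linear h' using h' by (rule has_derivative_bounded_linear)
  define d where "d = (\<Sum>b\<in>Basis. h' b *\<^sub>R b)"
  have "h' v = inner v d" for v
  proof -
    have "h' v = h' (\<Sum>b\<in>Basis. inner v b *\<^sub>R b)" by (simp add: euclidean_representation)
    also have "\<dots> = (\<Sum>b\<in>Basis. inner v b * h' b)" by (simp add: h'.sum h'.scaleR)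
    also have "\<dots> = inner v d" unfolding d_def
      by (simp add: inner_sum_right mult.commute)
    finally show ?thesis .
  qed
  then have "h' = (\<lambda>v. inner v d)" by auto
  then have "GDERIV h z :> d" unfolding gderiv_def using h' by simp
  then show ?thesis using gradient_eqI by metis
qed

lemma GDERIV_directional:
  assumes "GDERIV h (p + t *\<^sub>R a) :> d"
  shows "((\<lambda>t. h (p + t *\<^sub>R a)) has_real_derivative inner a d) (at t within S)"
proof -
  have "((\<lambda>t. h (p + t *\<^sub>R a)) has_derivative (\<lambda>s. inner (s *\<^sub>R a) d)) (at t within S)"
    by (rule has_derivative_compose[where g = h and f = "\<lambda>t. p + t *\<^sub>R a", of "\<lambda>s. s *\<^sub>R a"])
       (auto intro!: derivative_eq_intros assms[unfolded gderiv_def])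
  then show ?thesis
    by (rule has_derivative_imp_has_field_derivative) simp
qed

text \<open>
  The second difference of \<open>h\<close> over the parallelogram spanned by \<open>t a\<close> and \<open>t b\<close> is
  symmetric in \<open>a\<close> and \<open>b\<close>; the mean value theorem along \<open>a\<close> identifies its leading
  term as \<open>t\<^sup>2\<close> times \<open>D b \<bullet> a\<close>.
\<close>

lemma second_difference_limit:
  fixes h :: "'a::real_inner \<Rightarrow> real"
  assumes G: "\<And>z. GDERIV h z :> G z" and D: "(G has_derivative D) (at z)"
  shows "((\<lambda>t. (h (z + t *\<^sub>R a + t *\<^sub>R b) - h (z + t *\<^sub>R a) - h (z + t *\<^sub>R b) + h z) / t\<^sup>2)
            \<longlongrightarrow> inner (D b) a) (at_right 0)"
proof -
  interpret D: bounded_linear D using D by (rule has_derivative_bounded_linear)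
  define M where "M = 2 * norm a * (norm a + norm b) + 1"
  have M: "0 < M" unfolding M_def by (smt (verit) mult_nonneg_nonneg norm_ge_zero)
  define \<Delta> where "\<Delta> t = h (z + t *\<^sub>R a + t *\<^sub>R b) - h (z + t *\<^sub>R a) - h (z + t *\<^sub>R b) + h z" for t :: real
  have "\<forall>\<^sub>F t in at_right 0. dist (\<Delta> t / t\<^sup>2) (inner (D b) a) < e" if e: "0 < e" for e
  proof -
    obtain d where d: "0 < d"
      and Gd: "\<And>y. norm (y - z) < d \<Longrightarrow> norm (G y - G z - D (y - z)) \<le> e / M * norm (y - z)"
      using D e M unfolding has_derivative_at_alt by (metis divide_pos_pos)
    define t0 where "t0 = d / (norm a + norm b + 1)"
    have t0: "0 < t0" unfolding t0_def using d by (smt (verit) divide_pos_pos norm_ge_zero)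
    have "dist (\<Delta> t / t\<^sup>2) (inner (D b) a) < e" if t: "0 < t" "t < t0" for t
    proof -
      define k where "k s = h ((z + t *\<^sub>R b) + s *\<^sub>R a) - h (z + s *\<^sub>R a)" for s :: real
      have kd: "(k has_real_derivative inner a (G (z + t *\<^sub>R b + s *\<^sub>R a)) - inner a (G (z + s *\<^sub>R a))) (at s)" for s
        unfolding k_def by (intro derivative_intros GDERIV_directional G)
      obtain s where s: "0 < s" "s < t"
        and ks: "k t - k 0 = (t - 0) * (inner a (G (z + t *\<^sub>R b + s *\<^sub>R a)) - inner a (G (z + s *\<^sub>R a)))"
        using MVT2[OF t(1), of k "\<lambda>s. inner a (G (z + t *\<^sub>R b + s *\<^sub>R a)) - inner a (G (z + s *\<^sub>R a))"] kd
        by blast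
      have kD: "k t - k 0 = \<Delta> t" unfolding k_def \<Delta>_def by (simp add: algebra_simps)
      have td: "t * (norm a + norm b) < d"
      proof -
        have "t * (norm a + norm b) \<le> t * (norm a + norm b + 1)" using t by (intro mult_left_mono) auto
        also have "\<dots> < t0 * (norm a + norm b + 1)"
          using t by (intro mult_strict_right_mono) (auto simp: add_nonneg_pos)
        also have "\<dots> = d" unfolding t0_def by (smt (verit) nonzero_eq_divide_eq norm_ge_zero)
        finally show ?thesis .
      qed
      define r1 where "r1 = G (z + t *\<^sub>R b + s *\<^sub>R a) - G z - D (t *\<^sub>R b + s *\<^sub>R a)"
      define r2 where "r2 = G (z + s *\<^sub>R a) - G z - D (s *\<^sub>R a)"
      have n1: "norm (t *\<^sub>R b + s *\<^sub>R a) \<le> t * (norm a + norm b)"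
      proof -
        have "norm (t *\<^sub>R b + s *\<^sub>R a) \<le> t * norm b + s * norm a"
          using s t by (metis abs_of_pos norm_scaleR norm_triangle_ineq)
        also have "\<dots> \<le> t * norm b + t * norm a" using s by (intro add_left_mono mult_right_mono) auto
        finally show ?thesis by (simp add: algebra_simps)
      qed
      have n2: "norm (s *\<^sub>R a) \<le> t * (norm a + norm b)"
        using s t by (simp add: mult_mono)
      have em: "0 \<le> e / M" using e M by simp
      have b1: "norm r1 \<le> e / M * (t * (norm a + norm b))"
        using Gd[of "z + t *\<^sub>R b + s *\<^sub>R a"] n1 td mult_left_mono[OF n1 em]
        unfolding r1_def by (auto simp: add.assoc)
      have b2: "norm r2 \<le> e / M * (t * (norm a + norm b))"
        using Gd[of "z + s *\<^sub>R a"] n2 td mult_left_mono[OF n2 em] unfolding r2_def by auto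
      have "\<Delta> t = t * (inner a (D (t *\<^sub>R b)) + inner a (r1 - r2))"
        unfolding kD[symmetric] ks r1_def r2_def
        by (simp add: D.add inner_diff_right inner_add_right algebra_simps)
      then have "\<Delta> t / t\<^sup>2 - inner (D b) a = inner a (r1 - r2) / t"
        using t by (simp add: D.scaleR field_simps power2_eq_square inner_commute)
      moreover have "\<bar>inner a (r1 - r2)\<bar> \<le> t * (e / M * (M - 1))"
      proof -
        have "\<bar>inner a (r1 - r2)\<bar> \<le> norm a * norm (r1 - r2)" by (rule Cauchy_Schwarz_ineq2)
        also have "\<dots> \<le> norm a * (norm r1 + norm r2)"
          by (intro mult_left_mono norm_triangle_ineq4) auto
        also have "\<dots> \<le> norm a * (e / M * (t * (norm a + norm b)) + e / M * (t * (norm a + norm b)))"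
          using b1 b2 by (intro mult_left_mono add_mono) auto
        also have "\<dots> = t * (e / M * (M - 1))" unfolding M_def by (simp add: algebra_simps)
        finally show ?thesis .
      qed
      then have "\<bar>inner a (r1 - r2) / t\<bar> \<le> e / M * (M - 1)"
        using t by (simp only: abs_divide abs_of_pos pos_divide_le_eq mult.commute)
      ultimately have "\<bar>\<Delta> t / t\<^sup>2 - inner (D b) a\<bar> \<le> e / M * (M - 1)" by simp
      also have "\<dots> < e" using e M by (simp add: field_simps)
      finally show ?thesis by (simp add: dist_real_def)
    qed
    then show ?thesis
      unfolding eventually_at_right_field using t0 by blast
  qed
  then show ?thesis unfolding tendsto_iff \<Delta>_def by blast
qed

lemma second_derivative_symmetric:
  fixes h :: "'a::real_inner \<Rightarrow> real"
  assumes "\<And>z. GDERIV h z :> G z" "(G has_derivative D) (at z)"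
  shows "inner (D a) b = inner (D b) a"
proof -
  have "((\<lambda>t. (h (z + t *\<^sub>R a + t *\<^sub>R b) - h (z + t *\<^sub>R a) - h (z + t *\<^sub>R b) + h z) / t\<^sup>2)
            \<longlongrightarrow> inner (D a) b) (at_right 0)"
    using second_difference_limit[OF assms, of b a] by (simp add: algebra_simps)
  then show ?thesis
    using second_difference_limit[OF assms, of a b] tendsto_unique[of "at_right (0::real)"]
    by (auto simp: trivial_limit_at_right_real)
qed

text \<open>
  \<open>second_deriv h x y\<close> is the Hessian of \<open>h\<close> on the product space; its blocks are the partial
  Hessians, and its symmetry relates the two mixed blocks.
\<close>

definition second_deriv ::
    "(real^'n \<Rightarrow> real^'p \<Rightarrow> real) \<Rightarrow> real^'n \<Rightarrow> real^'p \<Rightarrow> (real^'n) \<times> (real^'p) \<Rightarrow> (real^'n) \<times> (real^'p)" where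
  "second_deriv h x y = frechet_derivative (gradient (case_prod h)) (at (x, y))"

lemma jacobian_mult_eq:
  fixes F :: "real^'a \<Rightarrow> real^'b"
  assumes "(F has_derivative F') (at x)"
  shows "jacobian F (at x) *v v = F' v"
proof -
  have "F' = frechet_derivative F (at x)" using assms by (rule frechet_derivative_at)
  moreover have "linear F'" using assms by (rule has_derivative_linear)
  ultimately show ?thesis unfolding jacobian_def by (simp add: matrix_works)
qed

context
  fixes h :: "real^'n \<Rightarrow> real^'p \<Rightarrow> real"
  assumes C2: "twice_cont_differentiable (case_prod h)"
begin

lemma joint_GDERIV: "GDERIV (case_prod h) z :> gradient (case_prod h) z"
  using C2 unfolding twice_cont_differentiable_def by (intro GDERIV_gradient) blast

lemma joint_has_second_derivative:
  "(gradient (case_prod h) has_derivative second_deriv h x y) (at (x, y))"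
  using C2 by (auto simp: twice_cont_differentiable_def second_deriv_def frechet_derivative_works)

lemma bounded_linear_second_deriv: "bounded_linear (second_deriv h x y)"
  using joint_has_second_derivative by (rule has_derivative_bounded_linear)

lemma second_deriv_symmetric:
  "inner (second_deriv h x y a) b = inner (second_deriv h x y b) a"
  by (rule second_derivative_symmetric[OF joint_GDERIV joint_has_second_derivative])

lemma GDERIV_fst: "GDERIV (\<lambda>x'. h x' y) x :> fst (gradient (case_prod h) (x, y))"
proof -
  have "((\<lambda>x'. case_prod h (x', y)) has_derivative
      (\<lambda>v. inner (v, 0) (gradient (case_prod h) (x, y)))) (at x)"
    by (rule has_derivative_compose[of "\<lambda>x'. (x', y)" "\<lambda>v. (v, 0)"])
       (auto intro!: derivative_eq_intros joint_GDERIV[unfolded gderiv_def])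
  then show ?thesis unfolding gderiv_def by (simp add: inner_prod_def)
qed

lemma GDERIV_snd: "GDERIV (h x) y :> snd (gradient (case_prod h) (x, y))"
proof -
  have "((\<lambda>y'. case_prod h (x, y')) has_derivative
      (\<lambda>v. inner (0, v) (gradient (case_prod h) (x, y)))) (at y)"
    by (rule has_derivative_compose[of "\<lambda>y'. (x, y')" "\<lambda>v. (0, v)"])
       (auto intro!: derivative_eq_intros joint_GDERIV[unfolded gderiv_def])
  then show ?thesis unfolding gderiv_def by (simp add: inner_prod_def)
qed

lemma grad_x_eq: "grad_x h x y = fst (gradient (case_prod h) (x, y))"
  unfolding grad_x_def by (rule gradient_eqI) (rule GDERIV_fst)

lemma grad_y_eq: "grad_y h x y = snd (gradient (case_prod h) (x, y))"
  unfolding grad_y_def by (rule gradient_eqI) (rule GDERIV_snd)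

lemma GDERIV_grad_y: "GDERIV (h x) y :> grad_y h x y"
  using GDERIV_snd by (simp add: grad_y_eq)

lemma joint_has_derivative_grad:
  "(case_prod h has_derivative (\<lambda>(v, u). inner v (grad_x h x y) + inner u (grad_y h x y))) (at (x, y))"
  using joint_GDERIV[of "(x, y)"] unfolding gderiv_def
  by (simp add: inner_prod_def grad_x_eq grad_y_eq case_prod_unfold)

lemma grad_y_partial_derivs:
  shows "(grad_y h x has_derivative (\<lambda>u. snd (second_deriv h x y (0, u)))) (at y)"
    and "((\<lambda>x'. grad_y h x' y) has_derivative (\<lambda>v. snd (second_deriv h x y (v, 0)))) (at x)"
    and "((\<lambda>y'. grad_x h x y') has_derivative (\<lambda>u. fst (second_deriv h x y (0, u)))) (at y)"
proof -
  have 1: "((\<lambda>y'. gradient (case_prod h) (x, y')) has_derivative (\<lambda>u. second_deriv h x y (0, u))) (at y)"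
    by (rule has_derivative_compose[of "\<lambda>y'. (x, y')" "\<lambda>v. (0, v)"])
       (auto intro!: derivative_eq_intros joint_has_second_derivative)
  have 2: "((\<lambda>x'. gradient (case_prod h) (x', y)) has_derivative (\<lambda>v. second_deriv h x y (v, 0))) (at x)"
    by (rule has_derivative_compose[of "\<lambda>x'. (x', y)" "\<lambda>v. (v, 0)"])
       (auto intro!: derivative_eq_intros joint_has_second_derivative)
  show "(grad_y h x has_derivative (\<lambda>u. snd (second_deriv h x y (0, u)))) (at y)"
    using has_derivative_snd[OF 1] by (simp add: grad_y_eq[abs_def])
  show "((\<lambda>x'. grad_y h x' y) has_derivative (\<lambda>v. snd (second_deriv h x y (v, 0)))) (at x)"
    using has_derivative_snd[OF 2] by (simp add: grad_y_eq[abs_def])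
  show "((\<lambda>y'. grad_x h x y') has_derivative (\<lambda>u. fst (second_deriv h x y (0, u)))) (at y)"
    using has_derivative_fst[OF 1] by (simp add: grad_x_eq[abs_def])
qed

lemma hess_yy_eq: "hess_yy h x y *v u = snd (second_deriv h x y (0, u))"
  unfolding hess_yy_def by (rule jacobian_mult_eq) (rule grad_y_partial_derivs)

lemma hess_xy_eq: "hess_xy h x y *v v = snd (second_deriv h x y (v, 0))"
  unfolding hess_xy_def by (rule jacobian_mult_eq) (rule grad_y_partial_derivs)

lemma grad_y_has_derivative: "(grad_y h x has_derivative (\<lambda>u. hess_yy h x y *v u)) (at y)"
  using grad_y_partial_derivs(1) by (simp add: hess_yy_eq)

lemma joint_grad_y_has_derivative:
  "((\<lambda>(x, y). grad_y h x y) has_derivative (\<lambda>(v, u). hess_xy h x y *v v + hess_yy h x y *v u)) (at (x, y))"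
proof -
  have "(\<lambda>(v, u). hess_xy h x y *v v + hess_yy h x y *v u) = (\<lambda>z. snd (second_deriv h x y z))"
  proof
    fix z :: "(real^'n) \<times> (real^'p)"
    interpret bounded_linear "second_deriv h x y" by (rule bounded_linear_second_deriv)
    have "second_deriv h x y (fst z, 0) + second_deriv h x y (0, snd z) = second_deriv h x y z"
      by (subst add[symmetric]) simp
    then show "(case z of (v, u) \<Rightarrow> hess_xy h x y *v v + hess_yy h x y *v u) = snd (second_deriv h x y z)"
      by (simp add: hess_xy_eq hess_yy_eq case_prod_unfold flip: snd_add)
  qed
  moreover have "(\<lambda>(x, y). grad_y h x y) = (\<lambda>z. snd (gradient (case_prod h) z))"
    by (auto simp: grad_y_eq)
  ultimately show ?thesis using has_derivative_snd[OF joint_has_second_derivative] by simp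
qed

lemma hess_yy_symmetric: "inner (hess_yy h x y *v u) w = inner (hess_yy h x y *v w) u"
  using second_deriv_symmetric[of x y "(0, u)" "(0, w)"] by (simp add: hess_yy_eq inner_prod_def)

text \<open>
  By the symmetry of the mixed blocks, the derivative of \<open>\<nabla>\<^sub>x h\<close> in a \<open>y\<close>-direction is expressed through
  \<open>hess_xy\<close>; this is how differences of \<open>\<nabla>\<^sub>x g\<close> become comparable with the hypergradient.
\<close>

lemma grad_x_directional_deriv:
  "((\<lambda>t. inner (grad_x h x (p + t *\<^sub>R d)) v) has_real_derivative
      inner d (hess_xy h x (p + t *\<^sub>R d) *v v)) (at t)"
proof -
  have "((\<lambda>t. grad_x h x (p + t *\<^sub>R d)) has_derivative
      (\<lambda>s. fst (second_deriv h x (p + t *\<^sub>R d) (0, s *\<^sub>R d)))) (at t)"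
    by (rule has_derivative_compose[of "\<lambda>t. p + t *\<^sub>R d" "\<lambda>s. s *\<^sub>R d"])
       (auto intro!: derivative_eq_intros grad_y_partial_derivs(3))
  then have "((\<lambda>t. inner (grad_x h x (p + t *\<^sub>R d)) v) has_derivative
      (\<lambda>s. inner (fst (second_deriv h x (p + t *\<^sub>R d) (0, s *\<^sub>R d))) v)) (at t)"
    by (rule has_derivative_inner_left)
  moreover have "inner (fst (second_deriv h x q (0, s *\<^sub>R d))) v = s * inner d (hess_xy h x q *v v)" for s q
    using second_deriv_symmetric[of x q "(0, s *\<^sub>R d)" "(v, 0)"]
    by (simp add: hess_xy_eq inner_prod_def inner_commute)
  ultimately show ?thesis
    by (intro has_derivative_imp_has_field_derivative) (auto simp: mult.commute)
qed

end

section \<open>Dikin geometry of the logarithmic barrier\<close>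

locale polytope =
  fixes A :: "real^'p^'m" and b :: "real^'m"
  assumes compact_Y: "compact (polyhedron_Y A b)"
    and interior_nonempty: "interior (polyhedron_Y A b) \<noteq> {}"
begin

abbreviation "Y \<equiv> polyhedron_Y A b"
abbreviation "I \<equiv> interior Y"
abbreviation "dn \<equiv> dikin_norm A b"
abbreviation "dd \<equiv> dikin_dual_norm A b"
abbreviation "H \<equiv> barrier_hess A b"

definition slack :: "'m \<Rightarrow> real^'p \<Rightarrow> real" where
  "slack i c = b $ i - row i A \<bullet> c"

text \<open>
  The Dikin norm is the Euclidean norm of the linear image \<open>scaled c u\<close>, whose entries are the
  directional changes of the slacks, up to sign, relative to the slacks.
\<close>

definition scaled :: "real^'p \<Rightarrow> real^'p \<Rightarrow> real^'m" where
  "scaled c u = (\<chi> i. (row i A \<bullet> u) / slack i c)"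

lemma mem_Y_iff: "y \<in> Y \<longleftrightarrow> (\<forall>i. row i A \<bullet> y \<le> b $ i)"
  by (simp add: polyhedron_Y_def less_eq_vec_def matrix_vector_mul_component row_def vec_lambda_eta)

text \<open>
  A zero row of \<open>A\<close> contributes a vacuous constraint whose slack may be zero even in the interior,
  so only the nonzero rows have positive slack there.
\<close>

lemma mem_interior_iff: "y \<in> I \<longleftrightarrow> (\<forall>i. row i A \<noteq> 0 \<longrightarrow> 0 < slack i y)"
proof
  assume y: "y \<in> I"
  then obtain e where e: "0 < e" "ball y e \<subseteq> Y" by (meson mem_interior)
  show "\<forall>i. row i A \<noteq> 0 \<longrightarrow> 0 < slack i y"
  proof (intro allI impI)
    fix i assume a: "row i A \<noteq> 0"
    define s where "s = e / (2 * norm (row i A))"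
    have s: "0 < s" using e a by (simp add: s_def)
    have "y + s *\<^sub>R row i A \<in> ball y e" using e a by (simp add: dist_norm s_def)
    then have "y + s *\<^sub>R row i A \<in> Y" using e by blast
    then have "row i A \<bullet> y + s * (row i A \<bullet> row i A) \<le> b $ i"
      unfolding mem_Y_iff by (auto simp: inner_add_right dest: spec[of _ i])
    moreover have "0 < s * (row i A \<bullet> row i A)" using s a by simp
    ultimately show "0 < slack i y" by (simp add: slack_def)
  qed
next
  assume y: "\<forall>i. row i A \<noteq> 0 \<longrightarrow> 0 < slack i y"
  define U where "U = (\<Inter>i\<in>{i. row i A \<noteq> 0}. {v. row i A \<bullet> v < b $ i})"
  have "open U" unfolding U_def by (intro open_INT) (auto simp: open_halfspace_lt)
  moreover have "U \<subseteq> Y"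
  proof
    fix v assume v: "v \<in> U"
    obtain w where w: "w \<in> Y" using interior_nonempty interior_subset by blast
    show "v \<in> Y" unfolding mem_Y_iff
    proof
      fix i
      show "row i A \<bullet> v \<le> b $ i"
      proof (cases "row i A = 0")
        case True then show ?thesis using w unfolding mem_Y_iff by (metis inner_zero_left)
      next
        case False then show ?thesis using v unfolding U_def by auto
      qed
    qed
  qed
  moreover have "y \<in> U" using y unfolding U_def slack_def by auto
  ultimately show "y \<in> I" using interior_maximal by blast
qed

lemma slack_pos: "y \<in> I \<Longrightarrow> row i A \<noteq> 0 \<Longrightarrow> 0 < slack i y"
  by (simp add: mem_interior_iff)

lemma slack_add: "slack i (c + u) = slack i c - row i A \<bullet> u"
  by (simp add: slack_def inner_add_right)

lemma convex_I: "convex I"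
  unfolding polyhedron_Y_def
  by (rule convex_interior) (auto simp: convex_def less_eq_vec_def matrix_vector_mul_component
      inner_add_right convex_bound_le)

definition barrier_grad :: "real^'p \<Rightarrow> real^'p" where
  "barrier_grad c = (\<Sum>i\<in>UNIV. (1 / slack i c) *\<^sub>R row i A)"

lemma GDERIV_barrier:
  assumes "c \<in> I"
  shows "GDERIV (barrier A b) c :> barrier_grad c"
proof -
  have "((\<lambda>y. ln (b $ i - row i A \<bullet> y)) has_derivative (\<lambda>v. - ((row i A \<bullet> v) / slack i c))) (at c)" for i
  proof (cases "row i A = 0")
    case True then show ?thesis by simp
  next
    case False
    then have "0 < slack i c" using slack_pos[OF assms] by blast
    then show ?thesis unfolding slack_def
      by (auto intro!: derivative_eq_intros simp: divide_inverse inner_diff_right)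
  qed
  then have "((\<lambda>y. - (\<Sum>i\<in>UNIV. ln (b $ i - row i A \<bullet> y)))
      has_derivative (\<lambda>v. - (\<Sum>i\<in>UNIV. - ((row i A \<bullet> v) / slack i c)))) (at c)"
    by (intro has_derivative_minus has_derivative_sum)
  then show ?thesis
    unfolding gderiv_def barrier_def[abs_def] barrier_grad_def
    by (simp add: inner_sum_right sum_negf inner_commute)
qed

lemma gradient_barrier: "c \<in> I \<Longrightarrow> gradient (barrier A b) c = barrier_grad c"
  by (rule gradient_eqI) (rule GDERIV_barrier)

lemma barrier_grad_has_derivative:
  assumes "c \<in> I"
  shows "(barrier_grad has_derivative
      (\<lambda>u. \<Sum>i\<in>UNIV. ((row i A \<bullet> u) / (slack i c)\<^sup>2) *\<^sub>R row i A)) (at c)"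
proof -
  have "((\<lambda>c. (1 / slack i c) *\<^sub>R row i A) has_derivative
      (\<lambda>u. ((row i A \<bullet> u) / (slack i c)\<^sup>2) *\<^sub>R row i A)) (at c)" for i
  proof (cases "row i A = 0")
    case True then show ?thesis by simp
  next
    case False
    then have "0 < slack i c" using slack_pos[OF assms] by blast
    then show ?thesis unfolding slack_def
      by (auto intro!: derivative_eq_intros simp: power2_eq_square field_simps inner_commute)
  qed
  then show ?thesis unfolding barrier_grad_def[abs_def] by (rule has_derivative_sum)
qed

lemma barrier_hess_mult:
  assumes "c \<in> I"
  shows "H c *v u = (\<Sum>i\<in>UNIV. ((row i A \<bullet> u) / (slack i c)\<^sup>2) *\<^sub>R row i A)"
  unfolding barrier_hess_def
  by (rule jacobian_mult_eq, rule has_derivative_transform_within_open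
      [OF barrier_grad_has_derivative[OF assms] open_interior assms])
    (simp add: gradient_barrier)

lemma barrier_grad_has_derivative_hess:
  "c \<in> I \<Longrightarrow> (barrier_grad has_derivative (\<lambda>u. H c *v u)) (at c)"
  using barrier_grad_has_derivative by (simp add: barrier_hess_mult)

lemma barrier_hess_inner:
  assumes "c \<in> I"
  shows "(H c *v u) \<bullet> v = scaled c u \<bullet> scaled c v"
  unfolding barrier_hess_mult[OF assms] scaled_def
  by (simp add: inner_sum_left inner_vec_def[of "vec_lambda _"] power2_eq_square)

lemma dn_eq: "c \<in> I \<Longrightarrow> dn c u = norm (scaled c u)"
  unfolding dikin_norm_def by (simp add: barrier_hess_inner norm_eq_sqrt_inner)

lemma linear_scaled: "linear (scaled c)"
  by (rule linearI) (auto simp: scaled_def vec_eq_iff inner_add_right add_divide_distrib)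

lemma scaled_diff: "scaled c (u - v) = scaled c u - scaled c v"
  using linear_diff[OF linear_scaled] .

lemma dn_nonneg: "c \<in> I \<Longrightarrow> 0 \<le> dn c u"
  by (simp add: dn_eq)

lemma dn_zero [simp]: "dn c 0 = 0"
  unfolding dikin_norm_def by simp

lemma dn_triangle: "c \<in> I \<Longrightarrow> dn c (u + v) \<le> dn c u + dn c v"
  by (simp add: dn_eq linear_add[OF linear_scaled] norm_triangle_ineq)

lemma dn_scaleR: "c \<in> I \<Longrightarrow> dn c (t *\<^sub>R u) = \<bar>t\<bar> * dn c u"
  by (simp add: dn_eq linear_cmul[OF linear_scaled])

lemma dn_minus_commute: "c \<in> I \<Longrightarrow> dn c (u - v) = dn c (v - u)"
  by (simp add: dn_eq scaled_diff norm_minus_commute)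

lemma dn_square: "c \<in> I \<Longrightarrow> (dn c u)\<^sup>2 = (H c *v u) \<bullet> u"
  by (simp add: dn_eq barrier_hess_inner power2_norm_eq_inner)

lemma row_le_dn:
  assumes "c \<in> I" "row i A \<noteq> 0"
  shows "\<bar>row i A \<bullet> u\<bar> \<le> slack i c * dn c u"
proof -
  have "\<bar>scaled c u $ i\<bar> \<le> dn c u" unfolding dn_eq[OF assms(1)] by (rule component_le_norm_cart)
  then show ?thesis using slack_pos[OF assms]
    by (simp add: scaled_def abs_divide pos_divide_le_eq mult.commute)
qed

text \<open>
  A displacement of Dikin norm below one decreases each positive slack by less than the slack itself.
\<close>

lemma dikin_ellipsoid:
  assumes "c \<in> I" "dn c u < 1"
  shows "c + u \<in> I"
  unfolding mem_interior_iff
proof (intro allI impI)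
  fix i assume a: "row i A \<noteq> 0"
  have "\<bar>row i A \<bullet> u\<bar> \<le> slack i c * dn c u" by (rule row_le_dn) fact+
  also have "\<dots> < slack i c * 1"
    using slack_pos[OF assms(1) a] assms(2) by (intro mult_strict_left_mono) auto
  finally show "0 < slack i (c + u)" by (simp add: slack_add)
qed

text \<open>
  The Dikin norms dominate the Euclidean norm uniformly in the centre, because every Dikin ellipsoid
  fits into the bounded set \<open>Y\<close>.
\<close>

lemma norm_le_dn: "\<exists>R>0. \<forall>c\<in>I. \<forall>u. norm u \<le> R * dn c u"
proof -
  obtain B where B: "0 < B" "\<And>y. y \<in> Y \<Longrightarrow> norm y \<le> B"
    using compact_imp_bounded[OF compact_Y] unfolding bounded_pos by blast
  have small: "norm u \<le> 2 * B" if "c \<in> I" "dn c u < 1" for c u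
  proof -
    have "c + u \<in> Y" "c \<in> Y" using dikin_ellipsoid[OF that] that interior_subset by auto
    then have "norm (c + u) \<le> B" "norm c \<le> B" using B by auto
    then show ?thesis using norm_triangle_ineq4[of "c + u" c] by auto
  qed
  have "norm u \<le> (4 * B) * dn c u" if c: "c \<in> I" for c u
  proof (cases "dn c u = 0")
    case True
    have "norm u = 0"
    proof (rule ccontr)
      assume nz: "norm u \<noteq> 0"
      have "norm ((3 * B / norm u) *\<^sub>R u) \<le> 2 * B"
        using c True by (intro small[OF c]) (simp add: dn_scaleR)
      then show False using nz B by (simp add: abs_of_pos)
    qed
    then show ?thesis using True by simp
  next
    case False
    then have pos: "0 < dn c u" using dn_nonneg[OF c, of u] by linarith
    have "norm ((1 / (2 * dn c u)) *\<^sub>R u) \<le> 2 * B"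
      using pos by (intro small[OF c]) (simp add: dn_scaleR[OF c])
    then show ?thesis using pos by (simp add: field_simps)
  qed
  then show ?thesis using B(1) by (intro exI[of _ "4 * B"]) auto
qed

lemma dn_eq_0_iff: "c \<in> I \<Longrightarrow> dn c u = 0 \<longleftrightarrow> u = 0"
  using norm_le_dn by (metis dn_zero mult_zero_right norm_le_zero_iff)

lemma barrier_hess_inv:
  assumes c: "c \<in> I"
  shows "H c *v (matrix_inv (H c) *v w) = w" "matrix_inv (H c) *v (H c *v w) = w"
proof -
  have "inj ((*v) (H c))"
  proof (rule injI)
    fix u v assume "H c *v u = H c *v v"
    then have "H c *v (u - v) = 0" by (simp add: matrix_vector_mult_diff_distrib)
    then have "(dn c (u - v))\<^sup>2 = 0" unfolding dn_square[OF c] by simp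
    then show "u = v" using dn_eq_0_iff[OF c] by simp
  qed
  then have "invertible (H c)"
    using matrix_left_invertible_injective invertible_left_inverse by blast
  then have "H c ** matrix_inv (H c) = mat 1" "matrix_inv (H c) ** H c = mat 1"
    unfolding matrix_inv_def invertible_def by (metis (mono_tags, lifting) someI_ex)+
  then show "H c *v (matrix_inv (H c) *v w) = w" "matrix_inv (H c) *v (H c *v w) = w"
    by (simp_all add: matrix_vector_mul_assoc)
qed

lemma dd_eq: "c \<in> I \<Longrightarrow> dd c w = dn c (matrix_inv (H c) *v w)"
  unfolding dikin_dual_norm_def dikin_norm_def by (simp add: barrier_hess_inv inner_commute)

lemma inner_le_dd:
  assumes c: "c \<in> I"
  shows "\<bar>w \<bullet> u\<bar> \<le> dd c w * dn c u"
proof -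
  have "w \<bullet> u = (H c *v (matrix_inv (H c) *v w)) \<bullet> u" by (simp add: barrier_hess_inv[OF c])
  also have "\<dots> = scaled c (matrix_inv (H c) *v w) \<bullet> scaled c u" by (rule barrier_hess_inner[OF c])
  finally show ?thesis unfolding dd_eq[OF c] by (simp add: dn_eq[OF c] Cauchy_Schwarz_ineq2)
qed

lemma inner_le_of_dd_le:
  assumes c: "c \<in> I" and "dd c w \<le> K"
  shows "\<bar>w \<bullet> u\<bar> \<le> K * dn c u"
  using inner_le_dd[OF c, of w u] mult_right_mono[OF assms(2) dn_nonneg[OF c, of u]] by linarith

lemma dd_nonneg: "c \<in> I \<Longrightarrow> 0 \<le> dd c w"
  by (simp add: dd_eq dn_nonneg)

text \<open>
  Testing with \<open>u = H\<^sup>-\<^sup>1 w\<close> shows that the dual norm is the least constant in the duality inequality.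
\<close>

lemma dd_le:
  assumes c: "c \<in> I" and le: "\<And>u. w \<bullet> u \<le> K * dn c u" and K: "0 \<le> K"
  shows "dd c w \<le> K"
proof -
  define v where "v = matrix_inv (H c) *v w"
  have "dn c v * dn c v = w \<bullet> v" unfolding power2_eq_square[symmetric] dn_square[OF c] v_def
    by (simp add: barrier_hess_inv[OF c])
  also have "\<dots> \<le> K * dn c v" by (rule le)
  finally have "dn c v \<le> K" using dn_nonneg[OF c, of v] K by (cases "dn c v = 0") auto
  then show ?thesis unfolding dd_eq[OF c] v_def .
qed

subsection \<open>Change of the centre\<close>

text \<open>
  In a Dikin ball of radius \<open>r\<close> every slack changes by a relative amount of at most \<open>r\<close>; all comparisons
  of metrics follow entrywise from this.
\<close>

lemma slack_ratio:
  assumes "c \<in> I" "dn c (y - c) \<le> r" "row i A \<noteq> 0"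
  shows "\<bar>slack i y - slack i c\<bar> \<le> r * slack i c"
proof -
  have "slack i y - slack i c = - (row i A \<bullet> (y - c))" by (simp add: slack_def inner_diff_right)
  then have "\<bar>slack i y - slack i c\<bar> \<le> slack i c * dn c (y - c)"
    using row_le_dn[OF assms(1,3), of "y - c"] by simp
  also have "\<dots> \<le> slack i c * r" using slack_pos[OF assms(1,3)] assms(2) by simp
  finally show ?thesis by (simp add: mult.commute)
qed

lemma norm_vec_le_scaled:
  fixes v w :: "real^'m"
  assumes "\<And>i. \<bar>v $ i\<bar> \<le> K * \<bar>w $ i\<bar>" "0 \<le> K"
  shows "norm v \<le> K * norm w"
proof -
  have "norm v \<le> norm (K *\<^sub>R w)"
    using assms by (intro norm_le_componentwise_cart) (simp add: abs_mult)
  then show ?thesis using assms(2) by simp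
qed

lemma dn_change_centre:
  assumes c: "c \<in> I" and y: "y \<in> I" and r: "dn c (y - c) \<le> r" "r < 1"
  shows "dn y u \<le> dn c u / (1 - r)" "dn c u \<le> (1 + r) * dn y u"
proof -
  have r0: "0 \<le> r" using r dn_nonneg[OF c] order_trans by blast
  have "\<bar>scaled y u $ i\<bar> \<le> (1 / (1 - r)) * \<bar>scaled c u $ i\<bar> \<and> \<bar>scaled c u $ i\<bar> \<le> (1 + r) * \<bar>scaled y u $ i\<bar>" for i
  proof (cases "row i A = 0")
    case True then show ?thesis by (simp add: scaled_def)
  next
    case False
    have s: "0 < slack i c" "0 < slack i y" using slack_pos[OF c False] slack_pos[OF y False] .
    have "\<bar>slack i y - slack i c\<bar> \<le> r * slack i c" by (rule slack_ratio) fact+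
    then have lo: "(1 - r) * slack i c \<le> slack i y" and hi: "slack i y \<le> (1 + r) * slack i c"
      by (auto simp: algebra_simps abs_le_iff)
    have "\<bar>row i A \<bullet> u\<bar> / slack i y \<le> \<bar>row i A \<bullet> u\<bar> / ((1 - r) * slack i c)"
      using lo s r by (intro divide_left_mono) auto
    moreover have "\<bar>row i A \<bullet> u\<bar> / slack i c \<le> (1 + r) * \<bar>row i A \<bullet> u\<bar> / slack i y"
    proof -
      have "\<bar>row i A \<bullet> u\<bar> * slack i y \<le> \<bar>row i A \<bullet> u\<bar> * ((1 + r) * slack i c)"
        using hi by (intro mult_left_mono) auto
      then show ?thesis using s by (simp add: field_simps)
    qed
    ultimately show ?thesis using s r by (simp add: scaled_def abs_divide)
  qed
  then show "dn y u \<le> dn c u / (1 - r)" "dn c u \<le> (1 + r) * dn y u"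
    using norm_vec_le_scaled[of "scaled y u" "1 / (1 - r)" "scaled c u"]
      norm_vec_le_scaled[of "scaled c u" "1 + r" "scaled y u"] r r0
    by (auto simp: dn_eq[OF c] dn_eq[OF y])
qed

text \<open>
  The gap \<open>(1 - r)\<^sup>-\<^sup>2 - 1\<close> bounds \<open>1 - (s\<^sub>c / s\<^sub>y)\<^sup>2\<close> over all slack ratios allowed in a Dikin ball
  of radius \<open>r\<close>; hence it bounds the difference of the two metrics as bilinear forms.
\<close>

lemma barrier_hess_diff_le:
  assumes c: "c \<in> I" and y: "y \<in> I" and r: "dn c (y - c) \<le> r" "r < 1"
  shows "\<bar>(H c *v u) \<bullet> v - (H y *v u) \<bullet> v\<bar> \<le> metric_gap r * dn c u * dn c v"
proof -
  have r0: "0 \<le> r" using r dn_nonneg[OF c] order_trans by blast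
  have gap: "0 \<le> metric_gap r" using r0 r(2) by (simp add: metric_gap_def power_le_one)
  define D where "D = (\<chi> i. scaled c u $ i - scaled y u $ i * (slack i c / slack i y))"
  have D: "\<bar>D $ i\<bar> \<le> metric_gap r * \<bar>scaled c u $ i\<bar>"
    and Deq: "D $ i * scaled c v $ i = scaled c u $ i * scaled c v $ i - scaled y u $ i * scaled y v $ i" for i
  proof -
    show "\<bar>D $ i\<bar> \<le> metric_gap r * \<bar>scaled c u $ i\<bar>"
    proof (cases "row i A = 0")
      case True then show ?thesis by (simp add: D_def scaled_def)
    next
      case False
      have s: "0 < slack i c" "0 < slack i y" using slack_pos[OF c False] slack_pos[OF y False] .
      have "\<bar>slack i y - slack i c\<bar> \<le> r * slack i c" by (rule slack_ratio) fact+
      then have lo: "(1 - r) * slack i c \<le> slack i y" and hi: "slack i y \<le> (1 + r) * slack i c"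
        by (auto simp: algebra_simps abs_le_iff)
      define q where "q = slack i c / slack i y"
      have q1: "q \<le> 1 / (1 - r)" using lo s r by (simp add: q_def field_simps)
      have q2: "1 / (1 + r) \<le> q" using hi s r0 by (simp add: q_def field_simps)
      have "q\<^sup>2 \<le> (1 / (1 - r))\<^sup>2" using q1 s by (intro power_mono) (auto simp: q_def)
      then have up: "q\<^sup>2 - 1 \<le> metric_gap r" by (simp add: metric_gap_def power_divide)
      have "(1 / (1 + r))\<^sup>2 \<le> q\<^sup>2" using q2 r0 by (intro power_mono) auto
      moreover have "1 - (1 / (1 + r))\<^sup>2 \<le> metric_gap r"
      proof -
        define s where "s = r / (1 - r)"
        have s: "0 \<le> s" "1 / (1 - r) = 1 + s" using r0 r(2) by (auto simp: s_def field_simps)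
        have "1 - r \<le> 1 / (1 + r)" using r0 by (simp add: field_simps)
        then have "(1 - r)\<^sup>2 \<le> (1 / (1 + r))\<^sup>2" using r(2) by (intro power_mono) auto
        then have "1 - (1 / (1 + r))\<^sup>2 \<le> 2 * r - r\<^sup>2" by (simp add: power2_eq_square algebra_simps)
        also have "\<dots> \<le> 2 * s + s\<^sup>2"
        proof -
          have "r \<le> s" using r0 r(2) by (simp add: s_def pos_le_divide_eq algebra_simps)
          then show ?thesis using zero_le_power2[of r] zero_le_power2[of s] by linarith
        qed
        also have "\<dots> = metric_gap r"
          using arg_cong[OF s(2), of "\<lambda>t. t\<^sup>2"]
          by (simp add: metric_gap_def power_divide power2_sum)
        finally show ?thesis .
      qed
      ultimately have "\<bar>1 - q\<^sup>2\<bar> \<le> metric_gap r" using up by linarith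
      moreover have "D $ i = scaled c u $ i * (1 - q\<^sup>2)"
        using s by (simp add: D_def scaled_def q_def power2_eq_square field_simps)
      ultimately show ?thesis
        by (simp only: abs_mult mult.commute[of "\<bar>scaled c u $ i\<bar>"] mult_right_mono abs_ge_zero)
    qed
    show "D $ i * scaled c v $ i = scaled c u $ i * scaled c v $ i - scaled y u $ i * scaled y v $ i"
    proof (cases "row i A = 0")
      case True then show ?thesis by (simp add: D_def scaled_def)
    next
      case False
      have s: "0 < slack i c" "0 < slack i y" using slack_pos[OF c False] slack_pos[OF y False] .
      then show ?thesis by (simp add: D_def scaled_def field_simps)
    qed
  qed
  have "(H c *v u) \<bullet> v - (H y *v u) \<bullet> v = D \<bullet> scaled c v"
    unfolding barrier_hess_inner[OF c] barrier_hess_inner[OF y]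
    by (simp add: inner_vec_def Deq sum_subtractf)
  also have "\<bar>\<dots>\<bar> \<le> norm D * norm (scaled c v)" by (rule Cauchy_Schwarz_ineq2)
  also have "\<dots> \<le> (metric_gap r * norm (scaled c u)) * norm (scaled c v)"
    by (intro mult_right_mono norm_vec_le_scaled D gap) auto
  finally show ?thesis by (simp add: dn_eq[OF c])
qed

end

section \<open>The barrier problem and its penalised proxy\<close>

text \<open>
  Divide the convexity inequality on the segment by the parameter \<open>t\<close> and let \<open>t\<close> tend to \<open>0\<close>.
\<close>

lemma strongly_convex_GDERIV_lower:
  fixes h :: "'a::real_inner \<Rightarrow> real"
  assumes sc: "strongly_convex \<rho> h" and d: "GDERIV h u :> d"
  shows "h u + (y - u) \<bullet> d + \<rho> / 2 * (norm (y - u))\<^sup>2 \<le> h y"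
proof -
  define \<phi> where "\<phi> t = h (u + t *\<^sub>R (y - u))" for t :: real
  have "(\<phi> has_real_derivative (y - u) \<bullet> d) (at 0)"
    unfolding \<phi>_def by (rule GDERIV_directional) (simp add: d)
  then have "((\<lambda>t. (\<phi> t - \<phi> 0) / t) \<longlongrightarrow> (y - u) \<bullet> d) (at 0)"
    by (simp add: has_field_derivative_iff)
  then have lim1: "((\<lambda>t. (\<phi> t - \<phi> 0) / t) \<longlongrightarrow> (y - u) \<bullet> d) (at_right 0)"
    by (rule filterlim_mono[OF _ order_refl]) (simp add: at_le)
  have lim2: "((\<lambda>t. h y - h u - \<rho> / 2 * (1 - t) * (norm (u - y))\<^sup>2)
      \<longlongrightarrow> h y - h u - \<rho> / 2 * (1 - 0) * (norm (u - y))\<^sup>2) (at_right 0)"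
    by (intro tendsto_intros)
  have "\<forall>\<^sub>F t in at_right (0::real). t \<in> {0<..<1}"
    by (rule eventually_at_right_real) simp
  then have "\<forall>\<^sub>F t in at_right 0. (\<phi> t - \<phi> 0) / t \<le> h y - h u - \<rho> / 2 * (1 - t) * (norm (u - y))\<^sup>2"
  proof eventually_elim
    case (elim t)
    then have "h ((1 - t) *\<^sub>R u + t *\<^sub>R y) \<le> (1 - t) * h u + t * h y - \<rho> / 2 * t * (1 - t) * (norm (u - y))\<^sup>2"
      using sc unfolding strongly_convex_def by auto
    moreover have "(1 - t) *\<^sub>R u + t *\<^sub>R y = u + t *\<^sub>R (y - u)" by (simp add: algebra_simps)
    ultimately have "\<phi> t - \<phi> 0 \<le> t * (h y - h u - \<rho> / 2 * (1 - t) * (norm (u - y))\<^sup>2)"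
      unfolding \<phi>_def by (simp add: algebra_simps)
    then show ?case using elim by (simp add: pos_divide_le_eq mult.commute)
  qed
  then have "(y - u) \<bullet> d \<le> h y - h u - \<rho> / 2 * (1 - 0) * (norm (u - y))\<^sup>2"
    by (rule tendsto_le[OF _ lim2 lim1, rotated]) (simp add: trivial_limit_at_right_real)
  then show ?thesis by (simp add: norm_minus_commute)
qed

lemma minimizer_GDERIV_zero:
  assumes "GDERIV h u :> d" "open S" "u \<in> S" "\<And>y. y \<in> S \<Longrightarrow> h u \<le> h y"
  shows "d = 0"
proof -
  have "(\<lambda>v. v \<bullet> d) = (\<lambda>v. 0)"
    using differential_zero_maxmin[OF assms(3,2) assms(1)[unfolded gderiv_def]] assms(4) by blast
  then have "d \<bullet> d = 0" by metis
  then show ?thesis by simp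
qed

locale bilevel = polytope A b
  for A :: "real^'p^'m" and b :: "real^'m" +
  fixes \<mu> :: real
    and f g :: "real^'n \<Rightarrow> real^'p \<Rightarrow> real"
    and lf0 lf1 lf2 lg0 lg1 lg2 \<rho>g :: real
    and yl :: "real \<Rightarrow> real^'n \<Rightarrow> real^'p"
  assumes mu_pos: "0 < \<mu>"
    and regularity: "objective_regularity f g lf0 lf1 lf2 lg0 lg1 lg2 \<rho>g"
    and proxy: "is_proxy_selection A b \<mu> f g yl"
begin

abbreviation "\<psi> \<equiv> psi A b \<mu> g"
abbreviation "ys \<equiv> y_star A b \<mu> g"

lemma C2_f: "twice_cont_differentiable (case_prod f)"
  and C2_g: "twice_cont_differentiable (case_prod g)"
  and rho_g_pos: "0 < \<rho>g"
  and strongly_convex_g: "strongly_convex \<rho>g (g x)"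
  and grad_x_f_le: "norm (grad_x f x y) \<le> lf0"
  and grad_x_g_le: "norm (grad_x g x y) \<le> lg0"
  using regularity by (auto simp: objective_regularity_def)

subsection \<open>Derivatives of the barrier objective\<close>

lemma GDERIV_psi:
  assumes "y \<in> I"
  shows "GDERIV (\<psi> x) y :> grad_y g x y + \<mu> *\<^sub>R barrier_grad y"
proof -
  have "GDERIV (\<lambda>y. g x y + \<mu> * barrier A b y) y :> grad_y g x y + (\<mu> *\<^sub>R barrier_grad y + barrier A b y *\<^sub>R 0)"
    by (intro GDERIV_add GDERIV_mult GDERIV_const GDERIV_grad_y[OF C2_g] GDERIV_barrier assms)
  then show ?thesis by (simp add: psi_def[abs_def])
qed

lemma grad_y_psi: "y \<in> I \<Longrightarrow> grad_y \<psi> x y = grad_y g x y + \<mu> *\<^sub>R barrier_grad y"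
  unfolding grad_y_def[of "psi A b \<mu> g"] by (rule gradient_eqI) (rule GDERIV_psi)

lemma GDERIV_grad_y_psi: "y \<in> I \<Longrightarrow> GDERIV (\<psi> x) y :> grad_y \<psi> x y"
  using GDERIV_psi by (simp add: grad_y_psi)

lemma hess_yy_psi:
  assumes "y \<in> I"
  shows "hess_yy \<psi> x y *v u = hess_yy g x y *v u + \<mu> *\<^sub>R (H y *v u)"
  unfolding hess_yy_def[of "psi A b \<mu> g"]
proof (rule jacobian_mult_eq, rule has_derivative_transform_within_open[OF _ open_interior assms])
  show "((\<lambda>y. grad_y g x y + \<mu> *\<^sub>R barrier_grad y) has_derivative
      (\<lambda>u. hess_yy g x y *v u + \<mu> *\<^sub>R (H y *v u))) (at y)"
    by (intro derivative_intros grad_y_has_derivative[OF C2_g] barrier_grad_has_derivative_hess assms)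
qed (auto simp: assms grad_y_psi)

lemma grad_y_psi_has_derivative:
  assumes "y \<in> I"
  shows "(grad_y \<psi> x has_derivative (\<lambda>u. hess_yy \<psi> x y *v u)) (at y)"
proof (rule has_derivative_transform_within_open[OF _ open_interior assms])
  show "((\<lambda>y. grad_y g x y + \<mu> *\<^sub>R barrier_grad y) has_derivative
      (\<lambda>u. hess_yy \<psi> x y *v u)) (at y)"
    unfolding hess_yy_psi[OF assms]
    by (intro derivative_intros grad_y_has_derivative[OF C2_g] barrier_grad_has_derivative_hess assms)
qed (auto simp: assms grad_y_psi)

lemma hess_xy_psi:
  assumes "y \<in> I"
  shows "hess_xy \<psi> x y = hess_xy g x y"
proof -
  have "hess_xy \<psi> x y *v v = hess_xy g x y *v v" for v
    unfolding hess_xy_def[of "psi A b \<mu> g"]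
  proof (rule jacobian_mult_eq)
    have "((\<lambda>x'. grad_y g x' y + \<mu> *\<^sub>R barrier_grad y) has_derivative (\<lambda>v. hess_xy g x y *v v + 0)) (at x)"
      unfolding hess_xy_eq[OF C2_g]
      by (intro has_derivative_add grad_y_partial_derivs[OF C2_g] has_derivative_const)
    then show "((\<lambda>x'. grad_y \<psi> x' y) has_derivative (\<lambda>v. hess_xy g x y *v v)) (at x)"
      using assms by (simp add: grad_y_psi)
  qed
  then show ?thesis by (simp add: matrix_eq)
qed

lemma hess_yy_psi_symmetric:
  assumes "y \<in> I"
  shows "(hess_yy \<psi> x y *v u) \<bullet> w = (hess_yy \<psi> x y *v w) \<bullet> u"
  unfolding hess_yy_psi[OF assms] inner_add_left inner_scaleR_left barrier_hess_inner[OF assms]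
  by (simp only: hess_yy_symmetric[OF C2_g, of x y u w] inner_commute[of "scaled y u"])

lemma joint_grad_y_psi_has_derivative:
  assumes "y \<in> I"
  shows "((\<lambda>(x, y). grad_y \<psi> x y) has_derivative
      (\<lambda>(v, u). hess_xy \<psi> x y *v v + hess_yy \<psi> x y *v u)) (at (x, y))"
proof (rule has_derivative_transform_within_open)
  have "((\<lambda>z. (\<lambda>(x, y). grad_y g x y) z + \<mu> *\<^sub>R barrier_grad (snd z)) has_derivative
      (\<lambda>z. (\<lambda>(v, u). hess_xy g x y *v v + hess_yy g x y *v u) z + \<mu> *\<^sub>R (H y *v snd z))) (at (x, y))"
    by (intro has_derivative_add has_derivative_scaleR_right joint_grad_y_has_derivative[OF C2_g]
        has_derivative_compose[where g = barrier_grad and f = snd]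
        bounded_linear_imp_has_derivative bounded_linear_snd)
      (simp add: barrier_grad_has_derivative_hess assms)
  moreover have "(\<lambda>z. (\<lambda>(v, u). hess_xy g x y *v v + hess_yy g x y *v u) z + \<mu> *\<^sub>R (H y *v snd z))
      = (\<lambda>(v, u). hess_xy \<psi> x y *v v + hess_yy \<psi> x y *v u)"
    by (auto simp: hess_xy_psi[OF assms] hess_yy_psi[OF assms])
  ultimately show "((\<lambda>z. (\<lambda>(x, y). grad_y g x y) z + \<mu> *\<^sub>R barrier_grad (snd z)) has_derivative
      (\<lambda>(v, u). hess_xy \<psi> x y *v v + hess_yy \<psi> x y *v u)) (at (x, y))" by simp
  show "open (UNIV \<times> I)" by (intro open_Times) auto
qed (auto simp: assms grad_y_psi)

subsection \<open>Existence, uniqueness and stationarity of the minimisers\<close>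

text \<open>
  The barrier blows up at the boundary of the bounded set \<open>Y\<close>: all other terms of \<open>\<psi>\<close> are bounded
  below, so points with a small slack lie above any prescribed level.  The minimisation may therefore
  be restricted to a compact set on which all slacks are bounded away from \<open>0\<close>.
\<close>

lemma psi_minimizer_exists: "\<exists>u\<in>I. \<forall>y\<in>I. \<psi> x u \<le> \<psi> x y"
proof -
  obtain y0 where y0: "y0 \<in> I" using interior_nonempty by blast
  have cont_g: "continuous_on S (g x)" for S
    by (intro continuous_at_imp_continuous_on ballI has_derivative_continuous
        [OF GDERIV_grad_y[OF C2_g, unfolded gderiv_def]])
  have "Y \<noteq> {}" using y0 interior_subset by blast
  then obtain m where m: "\<And>y. y \<in> Y \<Longrightarrow> m \<le> g x y"
    using continuous_attains_inf[OF compact_Y _ cont_g] by blast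
  obtain B where B: "0 < B" "\<And>y. y \<in> Y \<Longrightarrow> norm y \<le> B"
    using compact_imp_bounded[OF compact_Y] unfolding bounded_pos by blast
  define S where "S = 1 + (\<Sum>i\<in>UNIV. \<bar>b $ i\<bar> + norm (row i A) * B)"
  have term_nn: "0 \<le> \<bar>b $ i\<bar> + norm (row i A) * B" for i using B(1) by simp
  have S1: "1 \<le> S" unfolding S_def using term_nn by (simp add: sum_nonneg)
  have slack_S: "slack i y \<le> S" if "y \<in> Y" for i y
  proof -
    have "slack i y \<le> \<bar>b $ i\<bar> + norm (row i A) * norm y"
      unfolding slack_def using Cauchy_Schwarz_ineq2[of "row i A" y] by linarith
    also have "\<dots> \<le> \<bar>b $ i\<bar> + norm (row i A) * B"
      using B(2)[OF that] by (intro add_left_mono mult_left_mono) auto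
    also have "\<dots> \<le> (\<Sum>i\<in>UNIV. \<bar>b $ i\<bar> + norm (row i A) * B)"
      using term_nn by (intro member_le_sum) auto
    finally show ?thesis unfolding S_def by simp
  qed
  have ln_S: "ln (slack i y) \<le> ln S" if "y \<in> I" for i y
  proof (cases "0 < slack i y")
    case True
    moreover have "slack i y \<le> S" using slack_S that interior_subset by blast
    ultimately show ?thesis by simp
  next
    case False
    \<comment> \<open>only a zero row with \<open>b\<^sub>i = 0\<close> has a vanishing slack, and then \<open>ln 0 = 0\<close>\<close>
    have "slack i y = 0"
    proof (rule antisym)
      show "slack i y \<le> 0" using False by simp
      have "y \<in> Y" using that interior_subset by blast
      then show "0 \<le> slack i y" unfolding mem_Y_iff slack_def by simp
    qed
    then show ?thesis using S1 by simp
  qed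
  define N where "N = real CARD('m)"
  define \<epsilon> where "\<epsilon> = exp (- ((\<psi> x y0 - m) / \<mu> + N * ln S))"
  define K where "K = {y \<in> Y. \<forall>i. row i A \<noteq> 0 \<longrightarrow> \<epsilon> \<le> slack i y}"
  have \<epsilon>: "0 < \<epsilon>" unfolding \<epsilon>_def by simp
  have KI: "K \<subseteq> I"
  proof
    fix y assume "y \<in> K"
    then have "\<forall>i. row i A \<noteq> 0 \<longrightarrow> \<epsilon> \<le> slack i y" unfolding K_def by blast
    then show "y \<in> I" unfolding mem_interior_iff using \<epsilon> by (meson less_le_trans)
  qed
  have outside: "\<psi> x y0 < \<psi> x y" if y: "y \<in> I" "y \<notin> K" for y
  proof -
    obtain j where j: "row j A \<noteq> 0" "slack j y < \<epsilon>"
      using y interior_subset unfolding K_def by force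
    have "ln (slack j y) < ln \<epsilon>" using j slack_pos[OF y(1) j(1)] by simp
    moreover have "(\<Sum>i\<in>UNIV - {j}. ln (slack i y)) \<le> (\<Sum>i\<in>UNIV - {j}. ln S)"
      by (intro sum_mono ln_S y)
    moreover have "(\<Sum>i\<in>UNIV - {j}. ln S) \<le> N * ln S"
      using S1 by (simp add: N_def mult_right_mono)
    moreover have "(\<Sum>i\<in>UNIV. ln (slack i y)) = ln (slack j y) + (\<Sum>i\<in>UNIV - {j}. ln (slack i y))"
      by (simp add: sum.remove)
    ultimately have "(\<Sum>i\<in>UNIV. ln (slack i y)) < ln \<epsilon> + N * ln S" by linarith
    then have "(\<psi> x y0 - m) / \<mu> < barrier A b y"
      unfolding barrier_def \<epsilon>_def slack_def by simp
    then have "\<psi> x y0 - m < \<mu> * barrier A b y"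
      using mu_pos by (simp add: pos_divide_less_eq mult.commute)
    moreover have "m \<le> g x y" using m y interior_subset by blast
    ultimately show ?thesis by (simp add: psi_def)
  qed
  have y0K: "y0 \<in> K" using outside[OF y0] by blast
  have "K = Y \<inter> (\<Inter>i\<in>{i. row i A \<noteq> 0}. {y. row i A \<bullet> y \<le> b $ i - \<epsilon>})"
    unfolding K_def slack_def by (auto simp: le_diff_eq add.commute)
  then have "compact K"
    by (simp only:) (intro compact_Int_closed compact_Y closed_INT ballI closed_halfspace_le)
  moreover have "continuous_on K (\<psi> x)"
    using KI by (intro continuous_at_imp_continuous_on ballI has_derivative_continuous
        [OF GDERIV_psi[unfolded gderiv_def]]) blast
  ultimately obtain u where u: "u \<in> K" "\<And>y. y \<in> K \<Longrightarrow> \<psi> x u \<le> \<psi> x y"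
    using continuous_attains_inf[of K "\<psi> x"] y0K by blast
  have "\<psi> x u \<le> \<psi> x y" if "y \<in> I" for y
    using u outside[OF that] u(2)[OF y0K] by (cases "y \<in> K") auto
  then show ?thesis using u KI by blast
qed

lemma ys_in_I: "ys x \<in> I"
  and ys_minimizes: "y \<in> I \<Longrightarrow> \<psi> x (ys x) \<le> \<psi> x y"
proof -
  have "\<exists>u. is_arg_min (\<psi> x) (\<lambda>y. y \<in> I) u"
    using psi_minimizer_exists[of x] unfolding is_arg_min_linorder by blast
  then have "is_arg_min (\<psi> x) (\<lambda>y. y \<in> I) (ys x)"
    unfolding y_star_def arg_min_on_def arg_min_def by (rule someI_ex)
  then show "ys x \<in> I" "y \<in> I \<Longrightarrow> \<psi> x (ys x) \<le> \<psi> x y"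
    by (auto simp: is_arg_min_linorder)
qed

lemma grad_psi_ys: "grad_y \<psi> x (ys x) = 0"
  by (rule minimizer_GDERIV_zero[OF GDERIV_grad_y_psi[OF ys_in_I] open_interior ys_in_I ys_minimizes])

text \<open>
  Termwise this is \<open>ln s \<le> s - 1\<close> for the ratio of the two slacks.
\<close>

lemma barrier_convex_lower:
  assumes u: "u \<in> I" and y: "y \<in> I"
  shows "barrier A b u + (y - u) \<bullet> barrier_grad u \<le> barrier A b y"
proof -
  have "ln (slack i y) \<le> ln (slack i u) - (row i A \<bullet> (y - u)) / slack i u" for i
  proof (cases "row i A = 0")
    case True then show ?thesis by (simp add: slack_def)
  next
    case False
    have s: "0 < slack i u" "0 < slack i y" using slack_pos[OF u False] slack_pos[OF y False] .
    have "ln (slack i y / slack i u) \<le> slack i y / slack i u - 1"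
      using s by (intro ln_le_minus_one) simp
    moreover have "slack i y = slack i u - row i A \<bullet> (y - u)" by (simp add: slack_def inner_diff_right)
    moreover have "ln (slack i y / slack i u) = ln (slack i y) - ln (slack i u)"
      using s by (simp add: ln_div)
    ultimately show ?thesis using s by (simp add: diff_divide_distrib)
  qed
  then have "(\<Sum>i\<in>UNIV. ln (slack i y)) \<le> (\<Sum>i\<in>UNIV. ln (slack i u) - (row i A \<bullet> (y - u)) / slack i u)"
    by (intro sum_mono)
  then show ?thesis
    by (simp add: barrier_def slack_def[symmetric] barrier_grad_def sum_subtractf inner_sum_right
        inner_commute[of "y - u"])
qed

text \<open>
  Strong convexity of \<open>g\<close> and convexity of the barrier add up to a quadratic lower bound whose linear
  term vanishes at the minimiser.  In particular the minimiser is unique.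
\<close>

lemma psi_growth:
  assumes "y \<in> I"
  shows "\<psi> x (ys x) + \<rho>g / 2 * (norm (y - ys x))\<^sup>2 \<le> \<psi> x y"
proof -
  have "g x (ys x) + (y - ys x) \<bullet> grad_y g x (ys x) + \<rho>g / 2 * (norm (y - ys x))\<^sup>2 \<le> g x y"
    by (rule strongly_convex_GDERIV_lower[OF strongly_convex_g GDERIV_grad_y[OF C2_g]])
  moreover have "\<mu> * (barrier A b (ys x) + (y - ys x) \<bullet> barrier_grad (ys x)) \<le> \<mu> * barrier A b y"
    using mu_pos barrier_convex_lower[OF ys_in_I assms] by simp
  moreover have "(y - ys x) \<bullet> grad_y g x (ys x) + \<mu> * ((y - ys x) \<bullet> barrier_grad (ys x)) = 0"
    using arg_cong[OF grad_psi_ys[of x], of "\<lambda>d. (y - ys x) \<bullet> d"]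
    by (simp add: grad_y_psi[OF ys_in_I] inner_add_right)
  ultimately show ?thesis by (simp add: psi_def algebra_simps)
qed

lemma yl_in_I: "0 < lam \<Longrightarrow> yl lam x \<in> I"
  and yl_minimizes: "0 < lam \<Longrightarrow> y \<in> I \<Longrightarrow> f x (yl lam x) + lam * \<psi> x (yl lam x) \<le> f x y + lam * \<psi> x y"
proof -
  assume lam: "0 < lam"
  then have *: "is_arg_min (penalty_L A b \<mu> f g lam x) (\<lambda>y. y \<in> I) (yl lam x)"
    using proxy unfolding is_proxy_selection_def by blast
  show "yl lam x \<in> I" using * by (simp add: is_arg_min_linorder)
  assume "y \<in> I"
  then have "penalty_L A b \<mu> f g lam x (yl lam x) \<le> penalty_L A b \<mu> f g lam x y"
    using * by (simp add: is_arg_min_linorder)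
  then show "f x (yl lam x) + lam * \<psi> x (yl lam x) \<le> f x y + lam * \<psi> x y"
    by (simp add: penalty_L_def algebra_simps)
qed

lemma grad_L_yl:
  assumes "0 < lam"
  shows "grad_y f x (yl lam x) + lam *\<^sub>R grad_y \<psi> x (yl lam x) = 0"
proof (rule minimizer_GDERIV_zero[where S = I and h = "\<lambda>y. f x y + lam * \<psi> x y" and u = "yl lam x"])
  have "GDERIV (\<lambda>y. f x y + lam * \<psi> x y) (yl lam x)
      :> grad_y f x (yl lam x) + (lam *\<^sub>R grad_y \<psi> x (yl lam x) + \<psi> x (yl lam x) *\<^sub>R 0)"
    by (intro GDERIV_add GDERIV_mult GDERIV_const GDERIV_grad_y[OF C2_f] GDERIV_grad_y_psi yl_in_I assms)
  then show "GDERIV (\<lambda>y. f x y + lam * \<psi> x y) (yl lam x)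
      :> grad_y f x (yl lam x) + lam *\<^sub>R grad_y \<psi> x (yl lam x)" by simp
qed (auto simp: yl_in_I assms intro: yl_minimizes)

text \<open>
  The objective \<open>f x\<close> is bounded on \<open>Y\<close>, so optimality of the proxy leaves it a \<open>\<psi>\<close>-gap of
  order \<open>1 / \<lambda>\<close>, which quadratic growth turns into a distance.
\<close>

lemma yl_tendsto_ys: "((\<lambda>lam. yl lam x) \<longlongrightarrow> ys x) at_top"
proof -
  have "continuous_on Y (f x)"
    by (intro continuous_at_imp_continuous_on ballI has_derivative_continuous
        [OF GDERIV_grad_y[OF C2_f, unfolded gderiv_def]])
  then have "bounded (f x ` Y)" using compact_Y compact_continuous_image compact_imp_bounded by blast
  then obtain B where B: "\<And>y. y \<in> Y \<Longrightarrow> \<bar>f x y\<bar> \<le> B"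
    unfolding bounded_iff by auto
  have bound: "norm (yl lam x - ys x) \<le> sqrt (4 * B / \<rho>g * (1 / lam))" if lam: "0 < lam" for lam
  proof -
    have "f x (yl lam x) + lam * \<psi> x (yl lam x) \<le> f x (ys x) + lam * \<psi> x (ys x)"
      by (rule yl_minimizes[OF lam ys_in_I])
    moreover have "\<bar>f x (yl lam x)\<bar> \<le> B" "\<bar>f x (ys x)\<bar> \<le> B"
      using B yl_in_I[OF lam] ys_in_I interior_subset by blast+
    ultimately have "lam * (\<psi> x (yl lam x) - \<psi> x (ys x)) \<le> 2 * B" by (simp add: algebra_simps)
    moreover have "lam * (\<rho>g / 2 * (norm (yl lam x - ys x))\<^sup>2) \<le> lam * (\<psi> x (yl lam x) - \<psi> x (ys x))"
      using psi_growth[OF yl_in_I[OF lam, of x], of x] lam by (intro mult_left_mono) auto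
    ultimately have "lam * (\<rho>g / 2 * (norm (yl lam x - ys x))\<^sup>2) \<le> 2 * B" by linarith
    then have "(norm (yl lam x - ys x))\<^sup>2 \<le> 4 * B / \<rho>g * (1 / lam)"
      using lam rho_g_pos by (simp add: field_simps)
    then show ?thesis by (rule real_le_rsqrt)
  qed
  have "((\<lambda>lam. 1 / lam) \<longlongrightarrow> 0) (at_top :: real filter)"
    using tendsto_inverse_0_at_top[OF filterlim_ident] by (simp add: divide_inverse)
  then have "((\<lambda>lam. sqrt (4 * B / \<rho>g * (1 / lam))) \<longlongrightarrow> sqrt (4 * B / \<rho>g * 0)) (at_top :: real filter)"
    by (intro tendsto_intros)
  then have "((\<lambda>lam. sqrt (4 * B / \<rho>g * (1 / lam))) \<longlongrightarrow> 0) (at_top :: real filter)" by simp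
  then have "((\<lambda>lam. yl lam x - ys x) \<longlongrightarrow> 0) at_top"
    by (rule Lim_null_comparison[rotated]) (rule eventually_mono[OF eventually_gt_at_top bound])
  then show ?thesis using LIM_zero_iff by blast
qed

end

section \<open>Contraction of the preconditioned gradient step\<close>

context polytope
begin

text \<open>
  In the norm at the centre \<open>c\<close> the step with the frozen metric \<open>H z\<close> differs from the ideal step by
  the metric gap, which \<open>m / 4\<close> absorbs.  Symmetry of \<open>M\<close> enters through the co-coercivity
  \<open>\<bar>M e\<bar>\<^sub>*\<^sup>2 \<le> L \<langle>M e, e\<rangle>\<close>; without it the quadratic term of the expansion could not be compared
  with \<open>m\<close>.
\<close>

lemma preconditioned_linear_step:
  assumes c: "c \<in> I" and z: "z \<in> I" "dn c (z - c) \<le> \<eta>" "\<eta> < 1"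
    and sym: "\<And>u w. (M *v u) \<bullet> w = (M *v w) \<bullet> u"
    and lower: "\<And>u. m * (dn c u)\<^sup>2 \<le> (M *v u) \<bullet> u"
    and upper: "\<And>u. (M *v u) \<bullet> u \<le> L * (dn c u)\<^sup>2"
    and m: "0 < m" "m \<le> L" and gap: "metric_gap \<eta> * L \<le> m / 4"
    and step: "0 \<le> \<gamma>" "\<gamma> * L \<le> 3 / 8"
  shows "dn c (e - \<gamma> *\<^sub>R (matrix_inv (H z) *v (M *v e))) \<le> sqrt (1 - 3 / 4 * \<gamma> * m) * dn c e"
proof -
  have L: "0 < L" using m by linarith
  have eta0: "0 \<le> \<eta>" using z dn_nonneg[OF c] order_trans by blast
  have gap0: "0 \<le> metric_gap \<eta>" using eta0 z(3) by (simp add: metric_gap_def power_le_one)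
  have gap4: "metric_gap \<eta> \<le> 1 / 4"
  proof -
    have "metric_gap \<eta> * L \<le> 1 / 4 * L" using gap m by linarith
    then show ?thesis using L by simp
  qed
  have etasq: "(1 + \<eta>)\<^sup>2 \<le> 5 / 4"
  proof -
    have "1 + \<eta> \<le> 1 / (1 - \<eta>)" using eta0 z(3) by (simp add: field_simps)
    then have "(1 + \<eta>)\<^sup>2 \<le> (1 / (1 - \<eta>))\<^sup>2" using eta0 by (intro power_mono) auto
    then show ?thesis using gap4 by (simp add: metric_gap_def power_divide)
  qed
  define w where "w = M *v e"
  define v where "v = matrix_inv (H z) *v w"
  define N where "N = dd c w"
  define P where "P = w \<bullet> e"
  have N0: "0 \<le> N" unfolding N_def by (rule dd_nonneg[OF c])
  \<comment> \<open>co-coercivity: test positivity of \<open>M\<close> at \<open>e - s / L\<close>\<close>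
  have NP: "N\<^sup>2 \<le> L * P"
  proof -
    define s where "s = matrix_inv (H c) *v w"
    have Ns: "N = dn c s" unfolding N_def s_def by (rule dd_eq[OF c])
    have N2: "N\<^sup>2 = w \<bullet> s" unfolding Ns dn_square[OF c] s_def by (simp add: barrier_hess_inv[OF c])
    have "0 \<le> m * (dn c (e - (1 / L) *\<^sub>R s))\<^sup>2" using m by simp
    also have "\<dots> \<le> (M *v (e - (1 / L) *\<^sub>R s)) \<bullet> (e - (1 / L) *\<^sub>R s)" by (rule lower)
    also have "\<dots> = P - 2 / L * (w \<bullet> s) + 1 / L * (1 / L * ((M *v s) \<bullet> s))"
      using sym[of s e]
      by (simp add: matrix_vector_mult_diff_distrib matrix_vector_mult_scaleR inner_diff_left
          inner_diff_right w_def P_def algebra_simps)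
    also have "\<dots> \<le> P - 2 / L * N\<^sup>2 + 1 / L * (1 / L * (L * N\<^sup>2))"
      using upper[of s] L unfolding N2[symmetric] Ns by (intro add_mono mult_left_mono) auto
    also have "\<dots> = P - N\<^sup>2 / L" using L by (simp add: field_simps)
    finally show ?thesis using L by (simp add: field_simps)
  qed
  have PL: "P \<le> L * (dn c e)\<^sup>2" unfolding P_def w_def by (rule upper)
  have Pm: "m * (dn c e)\<^sup>2 \<le> P" unfolding P_def w_def by (rule lower)
  have E0: "0 \<le> dn c e" by (rule dn_nonneg[OF c])
  have NL: "N \<le> L * dn c e"
  proof (rule power2_le_imp_le)
    have "N\<^sup>2 \<le> L * (L * (dn c e)\<^sup>2)" using NP PL L by (meson mult_left_mono order_trans less_imp_le)
    then show "N\<^sup>2 \<le> (L * dn c e)\<^sup>2" by (simp add: power2_eq_square mult_ac)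
    show "0 \<le> L * dn c e" using L E0 by simp
  qed
  have vN: "dn c v \<le> 5 / 4 * N"
  proof -
    have z2: "(dn z v)\<^sup>2 = w \<bullet> v" unfolding dn_square[OF z(1)] v_def by (simp add: barrier_hess_inv[OF z(1)])
    have "dn c v \<le> (1 + \<eta>) * dn z v" by (rule dn_change_centre[OF c z])
    then have "(dn c v)\<^sup>2 \<le> ((1 + \<eta>) * dn z v)\<^sup>2" by (rule power_mono) (rule dn_nonneg[OF c])
    also have "\<dots> = (1 + \<eta>)\<^sup>2 * (w \<bullet> v)" by (simp add: power_mult_distrib z2)
    also have "\<dots> \<le> (1 + \<eta>)\<^sup>2 * (N * dn c v)"
      using inner_le_dd[OF c, of w v] unfolding N_def by (intro mult_left_mono) auto
    also have "\<dots> \<le> 5 / 4 * (N * dn c v)"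
      using etasq N0 dn_nonneg[OF c] by (intro mult_right_mono) auto
    finally have "dn c v * dn c v \<le> 5 / 4 * N * dn c v" by (simp add: power2_eq_square)
    then show ?thesis using dn_nonneg[OF c, of v] N0
      by (cases "dn c v = 0") auto
  qed
  have cross: "P - 5 / 16 * m * (dn c e)\<^sup>2 \<le> scaled c e \<bullet> scaled c v"
  proof -
    have "scaled c e \<bullet> scaled c v = (H c *v v) \<bullet> e" unfolding barrier_hess_inner[OF c] by (rule inner_commute)
    moreover have "(H z *v v) \<bullet> e = P" unfolding v_def P_def by (simp add: barrier_hess_inv[OF z(1)])
    moreover have "\<bar>(H c *v v) \<bullet> e - (H z *v v) \<bullet> e\<bar> \<le> metric_gap \<eta> * dn c v * dn c e"
      by (rule barrier_hess_diff_le[OF c z])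
    moreover have "metric_gap \<eta> * dn c v * dn c e \<le> 5 / 16 * m * (dn c e)\<^sup>2"
    proof -
      have "metric_gap \<eta> * dn c v \<le> metric_gap \<eta> * (5 / 4 * (L * dn c e))"
        using vN NL gap0 by (intro mult_left_mono) auto
      also have "\<dots> = 5 / 4 * dn c e * (metric_gap \<eta> * L)" by (simp add: algebra_simps)
      also have "\<dots> \<le> 5 / 4 * dn c e * (m / 4)" using gap E0 by (intro mult_left_mono) auto
      finally have "metric_gap \<eta> * dn c v * dn c e \<le> 5 / 4 * dn c e * (m / 4) * dn c e"
        using E0 by (rule mult_right_mono)
      then show ?thesis by (simp add: power2_eq_square algebra_simps)
    qed
    ultimately show ?thesis by linarith
  qed
  have quad: "\<gamma>\<^sup>2 * (dn c v)\<^sup>2 \<le> 75 / 128 * (\<gamma> * P)"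
  proof -
    have "(dn c v)\<^sup>2 \<le> (5 / 4 * N)\<^sup>2" using vN dn_nonneg[OF c] by (intro power_mono)
    also have "\<dots> \<le> 25 / 16 * (L * P)" using NP by (simp add: power_mult_distrib power_divide)
    finally have "\<gamma>\<^sup>2 * (dn c v)\<^sup>2 \<le> \<gamma>\<^sup>2 * (25 / 16 * (L * P))" by (rule mult_left_mono) simp
    also have "\<dots> = 25 / 16 * (\<gamma> * P) * (\<gamma> * L)" by (simp add: power2_eq_square)
    also have "\<dots> \<le> 25 / 16 * (\<gamma> * P) * (3 / 8)"
    proof (intro mult_left_mono step)
      have "0 \<le> P" using Pm m by (smt (verit) mult_nonneg_nonneg zero_le_power2)
      then show "0 \<le> 25 / 16 * (\<gamma> * P)" using step by simp
    qed
    finally show ?thesis by simp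
  qed
  have "(dn c (e - \<gamma> *\<^sub>R v))\<^sup>2 = (dn c e)\<^sup>2 - 2 * \<gamma> * (scaled c e \<bullet> scaled c v) + \<gamma>\<^sup>2 * (dn c v)\<^sup>2"
    unfolding dn_eq[OF c] scaled_diff linear_cmul[OF linear_scaled]
    unfolding power2_norm_eq_inner inner_diff_left inner_diff_right inner_scaleR_left inner_scaleR_right
    by (simp add: inner_commute power2_eq_square[of \<gamma>] algebra_simps)
  also have "\<dots> \<le> (dn c e)\<^sup>2 - 2 * \<gamma> * (P - 5 / 16 * m * (dn c e)\<^sup>2) + 75 / 128 * (\<gamma> * P)"
    using cross quad step by (intro add_mono diff_mono mult_left_mono) auto
  also have "\<dots> = (dn c e)\<^sup>2 + 5 / 8 * (\<gamma> * (m * (dn c e)\<^sup>2)) - 181 / 128 * (\<gamma> * P)"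
    by (simp add: algebra_simps)
  also have "\<dots> \<le> (dn c e)\<^sup>2 + 5 / 8 * (\<gamma> * (m * (dn c e)\<^sup>2)) - 181 / 128 * (\<gamma> * (m * (dn c e)\<^sup>2))"
    using Pm step by (intro diff_left_mono mult_left_mono) auto
  also have "\<dots> \<le> (dn c e)\<^sup>2 - 3 / 4 * (\<gamma> * (m * (dn c e)\<^sup>2))"
    using step m by simp
  also have "\<dots> = (1 - 3 / 4 * \<gamma> * m) * (dn c e)\<^sup>2" by (simp add: algebra_simps)
  finally have "sqrt ((dn c (e - \<gamma> *\<^sub>R v))\<^sup>2) \<le> sqrt ((1 - 3 / 4 * \<gamma> * m) * (dn c e)\<^sup>2)"
    by (rule real_sqrt_le_mono)
  then show ?thesis
    unfolding v_def w_def using dn_nonneg[OF c] E0 by (simp add: real_sqrt_mult)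
qed

text \<open>
  The mean value inequality along the segment from \<open>c\<close> reduces a gradient step to the linear steps
  with the Hessians at the points of the segment.
\<close>

lemma preconditioned_step:
  assumes c: "c \<in> I" and z: "z \<in> I" "dn c (z - c) \<le> \<eta>" "\<eta> < 1"
    and zero: "G c = 0"
    and deriv: "\<And>t. t \<in> {0..1} \<Longrightarrow> (G has_derivative (\<lambda>u. M (c + t *\<^sub>R (y - c)) *v u)) (at (c + t *\<^sub>R (y - c)))"
    and sym: "\<And>t u w. t \<in> {0..1} \<Longrightarrow> (M (c + t *\<^sub>R (y - c)) *v u) \<bullet> w = (M (c + t *\<^sub>R (y - c)) *v w) \<bullet> u"
    and lower: "\<And>t u. t \<in> {0..1} \<Longrightarrow> m * (dn c u)\<^sup>2 \<le> (M (c + t *\<^sub>R (y - c)) *v u) \<bullet> u"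
    and upper: "\<And>t u. t \<in> {0..1} \<Longrightarrow> (M (c + t *\<^sub>R (y - c)) *v u) \<bullet> u \<le> L * (dn c u)\<^sup>2"
    and m: "0 < m" "m \<le> L" and gap: "metric_gap \<eta> * L \<le> m / 4"
    and step: "0 \<le> \<gamma>" "\<gamma> * L \<le> 3 / 8"
  shows "dn c (y - \<gamma> *\<^sub>R (matrix_inv (H z) *v G y) - c) \<le> sqrt (1 - 3 / 4 * \<gamma> * m) * dn c (y - c)"
proof -
  define p where "p t = c + t *\<^sub>R (y - c)" for t :: real
  define \<Phi> where "\<Phi> t = scaled c (p t - \<gamma> *\<^sub>R (matrix_inv (H z) *v G (p t)))" for t
  define \<Phi>' where "\<Phi>' t s = scaled c (s *\<^sub>R (y - c) - \<gamma> *\<^sub>R (matrix_inv (H z) *v (M (p t) *v (s *\<^sub>R (y - c)))))" for t s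
  have bl: "bounded_linear (scaled c)" using linear_scaled by (simp add: linear_conv_bounded_linear)
  have d: "(\<Phi> has_derivative \<Phi>' t) (at t)" if t: "t \<in> {0..1}" for t
  proof -
    have "(p has_derivative (\<lambda>s. s *\<^sub>R (y - c))) (at t)"
      unfolding p_def by (auto intro!: derivative_eq_intros)
    moreover have "((\<lambda>t. G (p t)) has_derivative (\<lambda>s. M (p t) *v (s *\<^sub>R (y - c)))) (at t)"
      using deriv[OF t] by (intro has_derivative_compose[OF calculation]) (simp add: p_def)
    ultimately show ?thesis
      unfolding \<Phi>_def[abs_def] \<Phi>'_def[abs_def]
      by (intro bounded_linear.has_derivative[OF bl] derivative_intros
          bounded_linear.has_derivative[OF matrix_vector_mul_bounded_linear])
  qed
  have "continuous_on {0..1} \<Phi>"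
    using d by (intro continuous_at_imp_continuous_on ballI has_derivative_continuous)
  then obtain t where t: "t \<in> {0<..<1}" "norm (\<Phi> 1 - \<Phi> 0) \<le> norm (\<Phi>' t (1 - 0))"
    using mvt_general[of 0 1 \<Phi> \<Phi>'] d by auto
  have t01: "t \<in> {0..1}" using t by auto
  have "norm (\<Phi>' t (1 - 0)) = dn c ((y - c) - \<gamma> *\<^sub>R (matrix_inv (H z) *v (M (p t) *v (y - c))))"
    unfolding \<Phi>'_def dn_eq[OF c] by simp
  also have "\<dots> \<le> sqrt (1 - 3 / 4 * \<gamma> * m) * dn c (y - c)"
    using t01 unfolding p_def
    by (intro preconditioned_linear_step[OF c z _ _ _ m gap step] sym lower upper)
  finally have "norm (\<Phi> 1 - \<Phi> 0) \<le> sqrt (1 - 3 / 4 * \<gamma> * m) * dn c (y - c)" using t by linarith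
  moreover have "norm (\<Phi> 1 - \<Phi> 0) = dn c (y - \<gamma> *\<^sub>R (matrix_inv (H z) *v G y) - c)"
    unfolding dn_eq[OF c] \<Phi>_def p_def scaled_diff[symmetric] by (simp add: zero)
  ultimately show ?thesis by simp
qed

subsection \<open>Pointwise form of the operator bounds\<close>

lemma dd_scaleR: "c \<in> I \<Longrightarrow> dd c (t *\<^sub>R w) = \<bar>t\<bar> * dd c w"
  by (simp add: dd_eq matrix_vector_mult_scaleR dn_scaleR)

lemma dd_le_norm: "\<exists>R>0. \<forall>c\<in>I. \<forall>w. dd c w \<le> R * norm w"
proof -
  obtain R where R: "0 < R" "\<And>c u. c \<in> I \<Longrightarrow> norm u \<le> R * dn c u" using norm_le_dn by blast
  have "dd c w \<le> R * norm w" if c: "c \<in> I" for c w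
  proof (rule dd_le[OF c])
    fix u
    have "w \<bullet> u \<le> norm w * norm u" by (rule norm_cauchy_schwarz)
    also have "\<dots> \<le> norm w * (R * dn c u)" using R(2)[OF c] by (intro mult_left_mono) auto
    finally show "w \<bullet> u \<le> R * norm w * dn c u" by (simp add: algebra_simps)
  qed (use R in auto)
  then show ?thesis using R(1) by blast
qed

text \<open>
  An upper bound on a supremum of reals bounds its elements only if they are bounded above, which
  finite dimension guarantees for both operator norms.
\<close>

lemma op_norm_2_dual_bound:
  fixes M :: "real^'n^'p"
  assumes c: "c \<in> I" and le: "op_norm_2_dual A b c M \<le> K"
  shows "dd c (M *v v) \<le> K * norm v"
proof (cases "v = 0")
  case True
  then show ?thesis using dd_scaleR[OF c, of 0 0] by simp
next
  case False
  obtain R where R: "0 < R" "\<And>w. dd c w \<le> R * norm w" using dd_le_norm c by blast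
  obtain B where B: "\<And>u. norm (M *v u) \<le> norm u * B"
    using bounded_linear.bounded[OF matrix_vector_mul_bounded_linear[of M]] by blast
  have "bdd_above ((\<lambda>u. dd c (M *v u)) ` {u. norm u = 1})"
  proof (rule bdd_aboveI2)
    fix u :: "real^'n" assume "u \<in> {u. norm u = 1}"
    then have "norm (M *v u) \<le> B" using B[of u] by simp
    then show "dd c (M *v u) \<le> R * B" using R(2)[of "M *v u"] R(1) mult_left_mono[of "norm (M *v u)" B R] by linarith
  qed
  then have "dd c (M *v ((1 / norm v) *\<^sub>R v)) \<le> op_norm_2_dual A b c M"
    unfolding op_norm_2_dual_def using False by (intro cSUP_upper) auto
  then have "(1 / norm v) * dd c (M *v v) \<le> K"
    using le by (simp add: matrix_vector_mult_scaleR dd_scaleR[OF c])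
  then show ?thesis using False by (simp add: field_simps)
qed

lemma op_norm_c_dual_bound:
  assumes c: "c \<in> I" and le: "op_norm_c_dual A b c M \<le> K"
  shows "dd c (M *v v) \<le> K * dn c v"
proof (cases "v = 0")
  case True
  then show ?thesis using dd_scaleR[OF c, of 0 0] by simp
next
  case False
  then have v: "0 < dn c v" using dn_eq_0_iff[OF c] dn_nonneg[OF c, of v] by (simp add: less_le)
  obtain R where R: "0 < R" "\<And>w. dd c w \<le> R * norm w" using dd_le_norm c by blast
  obtain R' where R': "0 < R'" "\<And>u. norm u \<le> R' * dn c u" using norm_le_dn c by blast
  obtain B where B: "0 < B" "\<And>u. norm (M *v u) \<le> norm u * B"
    using bounded_linear.pos_bounded[OF matrix_vector_mul_bounded_linear[of M]] by blast
  have "bdd_above ((\<lambda>u. dd c (M *v u)) ` {u. dn c u = 1})"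
  proof (rule bdd_aboveI2)
    fix u assume "u \<in> {u. dn c u = 1}"
    then have "norm u * B \<le> R' * B" using R'(2)[of u] B(1) by simp
    then have "norm (M *v u) \<le> R' * B" using B(2)[of u] by linarith
    then show "dd c (M *v u) \<le> R * (R' * B)"
      using R(2)[of "M *v u"] R(1) mult_left_mono[of "norm (M *v u)" "R' * B" R] by linarith
  qed
  then have "dd c (M *v ((1 / dn c v) *\<^sub>R v)) \<le> op_norm_c_dual A b c M"
    unfolding op_norm_c_dual_def using v by (intro cSUP_upper) (auto simp: dn_scaleR[OF c])
  then have "(1 / dn c v) * dd c (M *v v) \<le> K"
    using le v by (simp add: matrix_vector_mult_scaleR dd_scaleR[OF c])
  then show ?thesis using v by (simp add: field_simps)
qed

end

section \<open>The local Dikin model\<close>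

text \<open>
  The last two assumptions are the lower bounds on the initial multiplier: \<open>lam0_f1\<close> makes the curvature
  of \<open>f\<close> at most half of that of \<open>\<lambda> \<psi>\<close>, and \<open>lam0_f0\<close> keeps the proxies within \<open>\<eta> / 4\<close> of the exact
  minimisers.
\<close>

locale dikin_model = bilevel A b \<mu> f g lf0 lf1 lf2 lg0 lg1 lg2 \<rho>g yl
  for A :: "real^'p^'m" and b :: "real^'m" and \<mu> :: real
    and f g :: "real^'n \<Rightarrow> real^'p \<Rightarrow> real"
    and lf0 lf1 lf2 lg0 lg1 lg2 \<rho>g :: real
    and yl :: "real \<Rightarrow> real^'n \<Rightarrow> real^'p" +
  fixes \<eta> lam_\<eta> lam0 :: real and C :: dikin_consts
  assumes eta_pos: "0 < \<eta>" and eta_half: "\<eta> < 1 / 2"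
    and radius: "small_radius \<eta> lam0 C"
    and constants: "local_dikin_constants A b \<mu> f g yl \<eta> lam_\<eta> lam0 C"
    and lam0_pos: "0 < lam0" and lam_eta_le: "lam_\<eta> \<le> lam0"
    and lam0_f1: "2 * l_f1 C / rho_psi C \<le> lam0"
    and lam0_f0: "8 * l_f0 C / (\<eta> * rho_psi C) \<le> lam0"
begin

abbreviation "\<rho> \<equiv> rho_psi C"
abbreviation "L1 \<equiv> l_psi1 C"
abbreviation "nbhd \<equiv> dikin_nbhd A b"

text \<open>
  Exact minimisers and proxies satisfy the same local bounds around themselves; stating the
  consequences for any such centre covers both.
\<close>

definition is_centre :: "real^'n \<Rightarrow> real^'p \<Rightarrow> bool" where
  "is_centre x c \<longleftrightarrow> c \<in> I \<and> local_bounds_at A b \<mu> f g C x c (nbhd (2 * \<eta>) c)"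

lemma ys_centre: "is_centre x (ys x)"
  using constants ys_in_I by (simp add: is_centre_def local_dikin_constants_def)

lemma yl_centre: "lam0 \<le> lam \<Longrightarrow> is_centre x (yl lam x)"
  using constants yl_in_I[of lam] lam0_pos lam_eta_le
  by (simp add: is_centre_def local_dikin_constants_def)

lemma rho_pos: "0 < \<rho>"
  and l_star0_ge: "1 \<le> l_star0 C"
  and ys_lipschitz: "dn (ys x1) (ys x2 - ys x1) \<le> l_star0 C * norm (x2 - x1)"
  and yl_lipschitz: "lam0 \<le> lam1 \<Longrightarrow> lam0 \<le> lam2 \<Longrightarrow>
      dn (yl lam1 x1) (yl lam2 x2 - yl lam1 x1)
        \<le> 2 * l_f0 C / \<rho> * \<bar>1 / lam2 - 1 / lam1\<bar> + l_lam0 C * norm (x2 - x1)"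
  and grad_F_lipschitz: "norm (gradient (F_barrier A b \<mu> f g) x2 - gradient (F_barrier A b \<mu> f g) x1)
      \<le> L_F C * norm (x2 - x1)"
  using constants by (auto simp: local_dikin_constants_def)

lemma centre_in_I: "is_centre x c \<Longrightarrow> c \<in> I"
  by (simp add: is_centre_def)

lemma nbhd_iff: "y \<in> nbhd r c \<longleftrightarrow> y \<in> I \<and> dn c (y - c) \<le> r"
  by (auto simp: dikin_nbhd_def)

lemma nbhd_mono: "y \<in> nbhd r c \<Longrightarrow> r \<le> r' \<Longrightarrow> y \<in> nbhd r' c"
  by (auto simp: nbhd_iff)

lemma nbhd_centre: "c \<in> I \<Longrightarrow> 0 \<le> r \<Longrightarrow> c \<in> nbhd r c"
  by (simp add: nbhd_iff)

lemma nbhd_I: "y \<in> nbhd r c \<Longrightarrow> y \<in> I"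
  by (simp add: nbhd_iff)

lemma nbhd_segment:
  assumes "y \<in> nbhd r c" "c \<in> I" "t \<in> {0..1}"
  shows "c + t *\<^sub>R (y - c) \<in> nbhd r c" "dn c (t *\<^sub>R (y - c)) \<le> dn c (y - c)"
proof -
  have 1: "dn c (t *\<^sub>R (y - c)) \<le> dn c (y - c)"
    using assms dn_nonneg[of c "y - c"] by (simp add: dn_scaleR mult_left_le_one_le)
  have "(1 - t) *\<^sub>R c + t *\<^sub>R y \<in> I"
    using convex_I assms by (intro convexD) (auto simp: nbhd_iff)
  moreover have "(1 - t) *\<^sub>R c + t *\<^sub>R y = c + t *\<^sub>R (y - c)" by (simp add: algebra_simps)
  ultimately show "c + t *\<^sub>R (y - c) \<in> nbhd r c" "dn c (t *\<^sub>R (y - c)) \<le> dn c (y - c)"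
    using 1 assms by (auto simp: nbhd_iff)
qed

lemma grad_x_mvt:
  assumes C2: "twice_cont_differentiable (case_prod h)" and c: "c \<in> I" and y: "y \<in> nbhd r c"
  shows "\<exists>w\<in>nbhd r c. dn c (w - c) \<le> dn c (y - c) \<and>
    (grad_x h x y - grad_x h x c) \<bullet> v = (hess_xy h x w *v v) \<bullet> (y - c)"
proof -
  have "\<exists>t>0. t < 1 \<and> grad_x h x (c + 1 *\<^sub>R (y - c)) \<bullet> v - grad_x h x (c + 0 *\<^sub>R (y - c)) \<bullet> v
      = (1 - 0) * ((y - c) \<bullet> (hess_xy h x (c + t *\<^sub>R (y - c)) *v v))"
    by (rule MVT2) (auto intro: grad_x_directional_deriv[OF C2])
  then obtain t where t: "0 < t" "t < 1"
    and eq: "(grad_x h x y - grad_x h x c) \<bullet> v = (y - c) \<bullet> (hess_xy h x (c + t *\<^sub>R (y - c)) *v v)"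
    by (auto simp: inner_diff_left)
  show ?thesis using nbhd_segment[OF y c, of t] t unfolding eq
    by (intro bexI[of _ "c + t *\<^sub>R (y - c)"]) (auto simp: inner_commute)
qed

context
  fixes x :: "real^'n" and c y :: "real^'p"
  assumes centre: "is_centre x c" and y: "y \<in> nbhd (2 * \<eta>) c"
begin

lemma hess_psi_lower: "\<rho> * (dn c u)\<^sup>2 \<le> (hess_yy \<psi> x y *v u) \<bullet> u"
  and hess_psi_upper: "(hess_yy \<psi> x y *v u) \<bullet> u \<le> L1 * (dn c u)\<^sup>2"
  using centre y unfolding is_centre_def local_bounds_at_def loewner_le_def
  by (auto simp: dn_square scaleR_matrix_vector_assoc[symmetric])

lemma hess_xy_psi_le: "\<bar>(hess_xy \<psi> x y *v v) \<bullet> u\<bar> \<le> L1 * norm v * dn c u"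
  and hess_xy_f_le: "\<bar>(hess_xy f x y *v v) \<bullet> u\<bar> \<le> l_f1 C * norm v * dn c u"
  and hess_yy_f_le: "\<bar>(hess_yy f x y *v w) \<bullet> u\<bar> \<le> l_f1 C * dn c w * dn c u"
  using centre y unfolding is_centre_def local_bounds_at_def
  by (auto intro!: inner_le_of_dd_le op_norm_2_dual_bound op_norm_c_dual_bound)

lemma hess_yy_psi_diff_le:
  assumes y2: "y2 \<in> nbhd (2 * \<eta>) c"
  shows "\<bar>(hess_yy \<psi> x y *v v - hess_yy \<psi> x y2 *v v) \<bullet> u\<bar> \<le> \<bar>l_psi2 C\<bar> * dn c (y - y2) * dn c v * dn c u"
proof -
  note cI = centre_in_I[OF centre]
  have "dd c ((hess_yy \<psi> x y - hess_yy \<psi> x y2) *v v) \<le> (l_psi2 C * dn c (y - y2)) * dn c v"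
    using centre y y2 unfolding is_centre_def local_bounds_at_def by (intro op_norm_c_dual_bound) auto
  also have "\<dots> \<le> (\<bar>l_psi2 C\<bar> * dn c (y - y2)) * dn c v"
    using cI by (intro mult_right_mono dn_nonneg) auto
  finally show ?thesis using inner_le_of_dd_le[OF cI] by (simp add: matrix_vector_mult_diff_rdistrib)
qed

lemma hess_xy_psi_diff_le:
  assumes y2: "y2 \<in> nbhd (2 * \<eta>) c"
  shows "\<bar>(hess_xy \<psi> x y *v v - hess_xy \<psi> x y2 *v v) \<bullet> u\<bar> \<le> \<bar>l_psi2 C\<bar> * dn c (y - y2) * norm v * dn c u"
proof -
  note cI = centre_in_I[OF centre]
  have "dd c ((hess_xy \<psi> x y - hess_xy \<psi> x y2) *v v) \<le> (l_psi2 C * dn c (y - y2)) * norm v"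
    using centre y y2 unfolding is_centre_def local_bounds_at_def by (intro op_norm_2_dual_bound) auto
  also have "\<dots> \<le> (\<bar>l_psi2 C\<bar> * dn c (y - y2)) * norm v"
    using cI by (intro mult_right_mono dn_nonneg) auto
  finally show ?thesis using inner_le_of_dd_le[OF cI] by (simp add: matrix_vector_mult_diff_rdistrib)
qed

end

lemma grad_x_f_diff_le:
  assumes centre: "is_centre x c" and y: "y \<in> nbhd (2 * \<eta>) c"
  shows "\<bar>(grad_x f x y - grad_x f x c) \<bullet> v\<bar> \<le> l_f1 C * norm v * dn c (y - c)"
  using grad_x_mvt[OF C2_f centre_in_I[OF centre] y, of x v] hess_xy_f_le[OF centre] by auto

lemma grad_x_g_diff_le:
  assumes centre: "is_centre x c" and y: "y \<in> nbhd (2 * \<eta>) c"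
  shows "\<bar>(grad_x g x y - grad_x g x c) \<bullet> v\<bar> \<le> L1 * norm v * dn c (y - c)"
proof -
  obtain w where w: "w \<in> nbhd (2 * \<eta>) c"
    and eq: "(grad_x g x y - grad_x g x c) \<bullet> v = (hess_xy g x w *v v) \<bullet> (y - c)"
    using grad_x_mvt[OF C2_g centre_in_I[OF centre] y, of x v] by blast
  show ?thesis
    using hess_xy_psi_le[OF centre w, of v "y - c"] unfolding eq hess_xy_psi[OF nbhd_I[OF w]] .
qed

lemma l_f1_nonneg: "0 \<le> l_f1 C" and rho_le_L1: "\<rho> \<le> L1"
proof -
  define x :: "real^'n" where "x = 0"
  define c where "c = ys x"
  have c: "is_centre x c" unfolding c_def by (rule ys_centre)
  have cn: "c \<in> nbhd (2 * \<eta>) c" using centre_in_I[OF c] eta_pos by (intro nbhd_centre) auto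
  obtain u :: "real^'p" where u: "norm u = 1" using vector_choose_size[of 1] by auto
  have u1: "0 < dn c u"
    using dn_eq_0_iff[OF centre_in_I[OF c]] dn_nonneg[OF centre_in_I[OF c], of u] u
    by (metis less_eq_real_def norm_zero zero_neq_one)
  show "\<rho> \<le> L1"
    using order_trans[OF hess_psi_lower[OF c cn, of u] hess_psi_upper[OF c cn, of u]] u1 by simp
  have "0 \<le> l_f1 C * (dn c u * dn c u)"
    using hess_yy_f_le[OF c cn, of u u] by (simp add: mult.assoc)
  moreover have "0 < dn c u * dn c u" using u1 by simp
  ultimately show "0 \<le> l_f1 C" by (meson linorder_not_le mult_neg_pos)
qed

lemma l_f0_nonneg: "0 \<le> l_f0 C"
proof -
  define x :: "real^'n" where "x = 0"
  have "ys x \<in> nbhd (2 * \<eta>) (ys x)" using ys_in_I eta_pos by (intro nbhd_centre) auto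
  then have "dd (ys x) (grad_y f x (ys x)) \<le> l_f0 C"
    using ys_centre[of x] unfolding is_centre_def local_bounds_at_def by blast
  then show ?thesis using dd_nonneg[OF ys_in_I] order_trans by blast
qed

lemma l_lam0_nonneg: "0 \<le> l_lam0 C"
proof -
  obtain v :: "real^'n" where v: "norm v = 1" using vector_choose_size[of 1] by auto
  have "dn (yl lam0 0) (yl lam0 v - yl lam0 0) \<le> l_lam0 C"
    using yl_lipschitz[of lam0 lam0 0 v] v by simp
  then show ?thesis using dn_nonneg[OF yl_in_I[OF lam0_pos]] order_trans by blast
qed

lemma L1_pos: "0 < L1"
  using rho_pos rho_le_L1 by linarith

subsection \<open>Inner steps\<close>

text \<open>
  The two kinds of inner step differ only in the curvature pair: \<open>(\<rho>, L1)\<close> for the exact problem and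
  \<open>(\<lambda> \<rho> / 2, \<lambda> L1 + l_f1)\<close> for the penalised one.
\<close>

lemma exact_inner_step:
  assumes z0: "z0 \<in> nbhd \<eta> (ys x)" and z: "z \<in> nbhd \<eta> (ys x)"
    and step: "0 \<le> \<gamma>" "\<gamma> \<le> 1 / (4 * L1)"
  shows "dn (ys x) (z - \<gamma> *\<^sub>R (matrix_inv (H z0) *v grad_y \<psi> x z) - ys x)
      \<le> sqrt (1 - 3 / 4 * \<gamma> * \<rho>) * dn (ys x) (z - ys x)"
proof (rule preconditioned_step[where M = "hess_yy \<psi> x" and L = L1])
  have mem: "ys x + t *\<^sub>R (z - ys x) \<in> nbhd (2 * \<eta>) (ys x)" if "t \<in> {0..1}" for t
    using eta_pos by (intro nbhd_mono[OF nbhd_segment(1)[OF z ys_in_I that]]) simp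
  show "z0 \<in> I" "dn (ys x) (z0 - ys x) \<le> \<eta>" using z0 by (auto simp: nbhd_iff)
  show "(grad_y \<psi> x has_derivative (\<lambda>u. hess_yy \<psi> x (ys x + t *\<^sub>R (z - ys x)) *v u))
      (at (ys x + t *\<^sub>R (z - ys x)))" if "t \<in> {0..1}" for t
    using mem[OF that] by (intro grad_y_psi_has_derivative nbhd_I)
  show "(hess_yy \<psi> x (ys x + t *\<^sub>R (z - ys x)) *v u) \<bullet> w = (hess_yy \<psi> x (ys x + t *\<^sub>R (z - ys x)) *v w) \<bullet> u"
    if "t \<in> {0..1}" for t u w using mem[OF that] by (intro hess_yy_psi_symmetric nbhd_I)
  show "\<rho> * (dn (ys x) u)\<^sup>2 \<le> (hess_yy \<psi> x (ys x + t *\<^sub>R (z - ys x)) *v u) \<bullet> u" if "t \<in> {0..1}" for t u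
    by (rule hess_psi_lower[OF ys_centre mem[OF that]])
  show "(hess_yy \<psi> x (ys x + t *\<^sub>R (z - ys x)) *v u) \<bullet> u \<le> L1 * (dn (ys x) u)\<^sup>2" if "t \<in> {0..1}" for t u
    by (rule hess_psi_upper[OF ys_centre mem[OF that]])
  show "metric_gap \<eta> * L1 \<le> \<rho> / 4" using radius by (simp add: small_radius_def)
  have "\<gamma> * L1 \<le> 1 / 4" using step L1_pos by (simp add: field_simps)
  then show "\<gamma> * L1 \<le> 3 / 8" by simp
qed (use eta_half step rho_pos rho_le_L1 in \<open>auto simp: ys_in_I grad_psi_ys\<close>)

lemma l_f1_le: "lam0 \<le> lam \<Longrightarrow> l_f1 C \<le> lam * \<rho> / 2"
proof -
  assume "lam0 \<le> lam"
  then have "2 * l_f1 C / \<rho> \<le> lam" using lam0_f1 by linarith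
  then show ?thesis using rho_pos by (simp add: pos_divide_le_eq)
qed

lemma proxy_inner_step:
  assumes lam: "lam0 \<le> lam"
    and z0: "z0 \<in> nbhd \<eta> (yl lam x)" and z: "z \<in> nbhd \<eta> (yl lam x)"
    and step: "0 \<le> \<alpha>" "\<alpha> * lam \<le> 1 / (4 * L1)"
  shows "dn (yl lam x) (z - \<alpha> *\<^sub>R (matrix_inv (H z0) *v (grad_y f x z + lam *\<^sub>R grad_y \<psi> x z)) - yl lam x)
      \<le> sqrt (1 - 3 / 8 * (\<alpha> * lam) * \<rho>) * dn (yl lam x) (z - yl lam x)"
proof -
  have lam_pos: "0 < lam" using lam lam0_pos by linarith
  define c where "c = yl lam x"
  have c: "is_centre x c" unfolding c_def by (rule yl_centre[OF lam])
  note cI = centre_in_I[OF c]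
  note lf = l_f1_le[OF lam]
  have mem: "c + t *\<^sub>R (z - c) \<in> nbhd (2 * \<eta>) c" if "t \<in> {0..1}" for t
    using eta_pos by (intro nbhd_mono[OF nbhd_segment(1)[OF z[folded c_def] cI that]]) simp
  define M where "M = (\<lambda>w. hess_yy f x w + lam *\<^sub>R hess_yy \<psi> x w)"
  have M: "M w *v u = hess_yy f x w *v u + lam *\<^sub>R (hess_yy \<psi> x w *v u)" for w u
    by (simp add: M_def matrix_vector_mult_add_rdistrib scaleR_matrix_vector_assoc)
  have step': "\<alpha> * lam * L1 \<le> 1 / 4" using step L1_pos by (simp add: field_simps)
  have sqeq: "1 - 3 / 8 * (\<alpha> * lam) * \<rho> = 1 - 3 / 4 * \<alpha> * (lam * \<rho> / 2)" by simp
  have "dn c (z - \<alpha> *\<^sub>R (matrix_inv (H z0) *v (grad_y f x z + lam *\<^sub>R grad_y \<psi> x z)) - c)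
      \<le> sqrt (1 - 3 / 4 * \<alpha> * (lam * \<rho> / 2)) * dn c (z - c)"
  proof (rule preconditioned_step[where M = M and L = "lam * L1 + l_f1 C"
        and G = "\<lambda>y. grad_y f x y + lam *\<^sub>R grad_y \<psi> x y"])
    show "z0 \<in> I" "dn c (z0 - c) \<le> \<eta>" using z0 by (auto simp: nbhd_iff c_def)
    show "grad_y f x c + lam *\<^sub>R grad_y \<psi> x c = 0" unfolding c_def by (rule grad_L_yl[OF lam_pos])
    show "((\<lambda>y. grad_y f x y + lam *\<^sub>R grad_y \<psi> x y) has_derivative (\<lambda>u. M (c + t *\<^sub>R (z - c)) *v u))
        (at (c + t *\<^sub>R (z - c)))" if "t \<in> {0..1}" for t
      unfolding M using mem[OF that]
      by (intro derivative_intros grad_y_has_derivative[OF C2_f] grad_y_psi_has_derivative nbhd_I)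
    show "(M (c + t *\<^sub>R (z - c)) *v u) \<bullet> w = (M (c + t *\<^sub>R (z - c)) *v w) \<bullet> u" if "t \<in> {0..1}" for t u w
      unfolding M inner_add_left inner_scaleR_left
      by (simp only: hess_yy_symmetric[OF C2_f, of x "c + t *\<^sub>R (z - c)" u w]
          hess_yy_psi_symmetric[OF nbhd_I[OF mem[OF that]], of x u w])
    have sq: "dn c u * dn c u = (dn c u)\<^sup>2" for u by (simp add: power2_eq_square)
    show "lam * \<rho> / 2 * (dn c u)\<^sup>2 \<le> (M (c + t *\<^sub>R (z - c)) *v u) \<bullet> u" if "t \<in> {0..1}" for t u
    proof -
      have "\<bar>(hess_yy f x (c + t *\<^sub>R (z - c)) *v u) \<bullet> u\<bar> \<le> l_f1 C * (dn c u)\<^sup>2"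
        using hess_yy_f_le[OF c mem[OF that], of u u] by (simp add: mult.assoc sq)
      moreover have "lam * (\<rho> * (dn c u)\<^sup>2) \<le> lam * ((hess_yy \<psi> x (c + t *\<^sub>R (z - c)) *v u) \<bullet> u)"
        using hess_psi_lower[OF c mem[OF that]] lam_pos by simp
      moreover have "l_f1 C * (dn c u)\<^sup>2 \<le> lam * \<rho> / 2 * (dn c u)\<^sup>2" using lf by (rule mult_right_mono) simp
      moreover have "lam * \<rho> / 2 * (dn c u)\<^sup>2 = lam * (\<rho> * (dn c u)\<^sup>2) - lam * \<rho> / 2 * (dn c u)\<^sup>2" by simp
      ultimately show ?thesis unfolding M inner_add_left inner_scaleR_left by linarith
    qed
    show "(M (c + t *\<^sub>R (z - c)) *v u) \<bullet> u \<le> (lam * L1 + l_f1 C) * (dn c u)\<^sup>2" if "t \<in> {0..1}" for t u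
    proof -
      have "\<bar>(hess_yy f x (c + t *\<^sub>R (z - c)) *v u) \<bullet> u\<bar> \<le> l_f1 C * (dn c u)\<^sup>2"
        using hess_yy_f_le[OF c mem[OF that], of u u] by (simp add: mult.assoc sq)
      moreover have "lam * ((hess_yy \<psi> x (c + t *\<^sub>R (z - c)) *v u) \<bullet> u) \<le> lam * (L1 * (dn c u)\<^sup>2)"
        using hess_psi_upper[OF c mem[OF that]] lam_pos by simp
      ultimately show ?thesis unfolding M inner_add_left inner_scaleR_left distrib_right by linarith
    qed
    have "lam * \<rho> \<le> lam * L1" using lam_pos rho_le_L1 by simp
    then show "lam * \<rho> / 2 \<le> lam * L1 + l_f1 C" using l_f1_nonneg lam_pos rho_pos
      by (smt (verit) field_sum_of_halves mult_pos_pos)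
    show "metric_gap \<eta> * (lam * L1 + l_f1 C) \<le> lam * \<rho> / 2 / 4"
      using radius lam by (simp add: small_radius_def)
    show "\<alpha> * (lam * L1 + l_f1 C) \<le> 3 / 8"
    proof -
      have "\<alpha> * l_f1 C \<le> \<alpha> * (lam * \<rho> / 2)" using lf step by (intro mult_left_mono)
      also have "\<dots> \<le> \<alpha> * (lam * L1 / 2)"
        using \<open>lam * \<rho> \<le> lam * L1\<close> step by (intro mult_left_mono) auto
      finally show ?thesis using step' by (simp add: algebra_simps)
    qed
  qed (use eta_half step rho_pos lam_pos in \<open>auto simp: cI\<close>)
  then show ?thesis unfolding c_def sqeq .
qed

end

section \<open>Sensitivity of the two minimisers\<close>

text \<open>
  If the derivative of \<open>\<Phi>\<close> ignores the second component, the increments of \<open>u\<close> enter only through the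
  remainder, which a Lipschitz bound controls.
\<close>

lemma has_derivative_along_lipschitz_curve:
  fixes \<Phi> :: "'a::real_normed_vector \<times> 'b::real_normed_vector \<Rightarrow> real"
  assumes \<Phi>: "(\<Phi> has_derivative (\<lambda>(h, k). l h)) (at (x, u x))"
    and u: "\<And>x'. norm (u x' - u x) \<le> K * norm (x' - x)"
  shows "((\<lambda>x'. \<Phi> (x', u x')) has_derivative l) (at x)"
  unfolding has_derivative_at_alt
proof (intro conjI allI impI)
  have "bounded_linear (\<lambda>h::'a. (h, 0::'b))"
    by (intro bounded_linear_Pair bounded_linear_ident bounded_linear_zero)
  from bounded_linear_compose[OF has_derivative_bounded_linear[OF \<Phi>] this]
  show "bounded_linear l" by simp
  fix e :: real assume e: "0 < e"
  define M where "M = 1 + \<bar>K\<bar>"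
  have M: "0 < M" by (simp add: M_def)
  obtain d where d: "0 < d"
    and \<Phi>d: "\<And>z. norm (z - (x, u x)) < d \<Longrightarrow>
        norm (\<Phi> z - \<Phi> (x, u x) - (\<lambda>(h, k). l h) (z - (x, u x))) \<le> e / M * norm (z - (x, u x))"
    using \<Phi> e M unfolding has_derivative_at_alt by (meson divide_pos_pos)
  have n: "norm ((x', u x') - (x, u x)) \<le> M * norm (x' - x)" for x'
  proof -
    have "norm ((x', u x') - (x, u x)) \<le> norm (x' - x) + norm (u x' - u x)"
      by (simp add: norm_Pair_le)
    also have "\<dots> \<le> norm (x' - x) + \<bar>K\<bar> * norm (x' - x)"
      using u[of x'] by (smt (verit) mult_right_mono norm_ge_zero)
    finally show ?thesis by (simp add: M_def algebra_simps)
  qed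
  show "\<exists>d>0. \<forall>y. norm (y - x) < d \<longrightarrow>
      norm (\<Phi> (y, u y) - \<Phi> (x, u x) - l (y - x)) \<le> e * norm (y - x)"
  proof (intro exI[of _ "d / M"] conjI allI impI)
    show "0 < d / M" using d M by simp
    fix x' assume "norm (x' - x) < d / M"
    then have "M * norm (x' - x) < d" using M by (simp add: field_simps)
    then have "norm ((x', u x') - (x, u x)) < d" using n[of x'] by linarith
    then have "norm (\<Phi> (x', u x') - \<Phi> (x, u x) - l (x' - x)) \<le> e / M * norm ((x', u x') - (x, u x))"
      using \<Phi>d[of "(x', u x')"] by simp
    also have "\<dots> \<le> e / M * (M * norm (x' - x))" using e M n by (intro mult_left_mono) auto
    finally show "norm (\<Phi> (x', u x') - \<Phi> (x, u x) - l (x' - x)) \<le> e * norm (x' - x)" using M by simp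
  qed
qed

lemma norm_le_of_inner_le:
  fixes w :: "'a::real_inner"
  assumes "\<And>v. w \<bullet> v \<le> K * norm v" "0 \<le> K"
  shows "norm w \<le> K"
proof (cases "w = 0")
  case False
  have "norm w * norm w \<le> K * norm w"
    using assms(1)[of w] by (simp add: power2_norm_eq_inner[symmetric] power2_eq_square)
  then show ?thesis using False by simp
qed (use assms in simp)

context dikin_model
begin

text \<open>
  The Lipschitz constant of the proxies as functions of \<open>1 / \<lambda>\<close>.
\<close>

definition E :: real where "E = 2 * l_f0 C / \<rho>"

lemma E_nonneg: "0 \<le> E"
  unfolding E_def using l_f0_nonneg rho_pos by simp

lemma E_le: "lam0 \<le> lam \<Longrightarrow> E / lam \<le> \<eta> / 4"
proof -
  assume lam: "lam0 \<le> lam"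
  have "8 * l_f0 C / (\<eta> * \<rho>) \<le> lam" using lam lam0_f0 by linarith
  then have "8 * l_f0 C \<le> lam * (\<eta> * \<rho>)" using eta_pos rho_pos by (simp add: pos_divide_le_eq)
  then show ?thesis unfolding E_def using rho_pos lam lam0_pos by (simp add: field_simps)
qed

text \<open>
  Letting the second multiplier tend to infinity in the Lipschitz bound for the proxies turns it into
  a bound on the distance to the exact minimiser.
\<close>

lemma proxy_distance:
  assumes lam: "lam0 \<le> lam"
  shows "dn (yl lam x) (ys x - yl lam x) \<le> E / lam"
proof -
  have pos: "0 < lam" using lam lam0_pos by linarith
  note pI = yl_in_I[OF pos]
  have "((\<lambda>l2. scaled (yl lam x) (yl l2 x - yl lam x)) \<longlongrightarrow> scaled (yl lam x) (ys x - yl lam x)) at_top"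
    by (intro bounded_linear.tendsto[OF linear_scaled[unfolded linear_conv_bounded_linear]]
        tendsto_diff yl_tendsto_ys tendsto_const)
  then have lim1: "((\<lambda>l2. dn (yl lam x) (yl l2 x - yl lam x)) \<longlongrightarrow> dn (yl lam x) (ys x - yl lam x)) at_top"
    unfolding dn_eq[OF pI] by (rule tendsto_norm)
  have "((\<lambda>l2. 1 / l2) \<longlongrightarrow> 0) (at_top :: real filter)"
    using tendsto_inverse_0_at_top[OF filterlim_ident] by (simp add: divide_inverse)
  then have lim2: "((\<lambda>l2. E * \<bar>1 / l2 - 1 / lam\<bar>) \<longlongrightarrow> E * \<bar>0 - 1 / lam\<bar>) at_top"
    by (intro tendsto_intros)
  have "\<forall>\<^sub>F l2 in at_top. dn (yl lam x) (yl l2 x - yl lam x) \<le> E * \<bar>1 / l2 - 1 / lam\<bar>"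
    using eventually_ge_at_top[of lam0]
  proof eventually_elim
    case (elim l2)
    then show ?case using yl_lipschitz[OF lam elim, of x x] by (simp add: E_def)
  qed
  then have "dn (yl lam x) (ys x - yl lam x) \<le> E * \<bar>0 - 1 / lam\<bar>"
    by (rule tendsto_le[OF _ lim2 lim1, rotated]) simp
  then show ?thesis using pos by simp
qed

text \<open>
  The proxy lies within \<open>1 / 8\<close> of the exact minimiser, so their two norms are interchangeable up to
  factors close to one.
\<close>

lemma proxy_distance_exact:
  assumes lam: "lam0 \<le> lam"
  shows "dn (ys x) (yl lam x - ys x) \<le> 8 / 7 * (E / lam)"
    and "dn (ys x) u \<le> 8 / 7 * dn (yl lam x) u"
    and "dn (yl lam x) u \<le> 9 / 8 * dn (ys x) u"
proof -
  have pos: "0 < lam" using lam lam0_pos by linarith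
  note pI = yl_in_I[OF pos]
  have r: "dn (yl lam x) (ys x - yl lam x) \<le> 1 / 8"
    using proxy_distance[OF lam, of x] E_le[OF lam] eta_half by linarith
  show 1: "dn (ys x) u \<le> 8 / 7 * dn (yl lam x) u" for u
    using dn_change_centre(1)[OF pI ys_in_I r, of u] by simp
  show "dn (yl lam x) u \<le> 9 / 8 * dn (ys x) u"
    using dn_change_centre(2)[OF pI ys_in_I r, of u] by simp
  have "dn (ys x) (yl lam x - ys x) \<le> 8 / 7 * dn (yl lam x) (yl lam x - ys x)" by (rule 1)
  also have "\<dots> \<le> 8 / 7 * (E / lam)"
    using proxy_distance[OF lam, of x] unfolding dn_minus_commute[OF pI[of x], of "yl lam x"] by simp
  finally show "dn (ys x) (yl lam x - ys x) \<le> 8 / 7 * (E / lam)" .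
qed

lemma yl_mem_nbhd: "lam0 \<le> lam \<Longrightarrow> yl lam x \<in> nbhd (2 * \<eta>) (ys x)"
  using proxy_distance_exact(1)[of lam x] E_le[of lam] yl_in_I[of lam x] lam0_pos eta_pos
  by (auto simp: nbhd_iff)

lemma ys_euclidean_lipschitz: "\<exists>K. \<forall>x x'. norm (ys x' - ys x) \<le> K * norm (x' - x)"
proof -
  obtain R where R: "0 < R" "\<And>c u. c \<in> I \<Longrightarrow> norm u \<le> R * dn c u" using norm_le_dn by blast
  have "norm (ys x' - ys x) \<le> R * l_star0 C * norm (x' - x)" for x x'
  proof -
    have "norm (ys x' - ys x) \<le> R * dn (ys x) (ys x' - ys x)" by (rule R(2)[OF ys_in_I])
    also have "\<dots> \<le> R * (l_star0 C * norm (x' - x))" using R(1) ys_lipschitz by (intro mult_left_mono) auto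
    finally show ?thesis by simp
  qed
  then show ?thesis by blast
qed

text \<open>
  The adjoint \<open>a\<close> solves \<open>\<nabla>\<^sup>2\<psi> a = \<nabla>\<^sub>y f\<close>.  Since \<open>\<nabla>\<^sub>y \<psi>\<close> vanishes along the solution curve, \<open>F\<close> is the
  restriction of \<open>f - a \<bullet> \<nabla>\<^sub>y \<psi>\<close> to that curve; the choice of \<open>a\<close> annihilates its \<open>y\<close>-derivative,
  so Lipschitz continuity of the curve suffices for differentiability of \<open>F\<close>.
\<close>

lemma hypergradient:
  "\<exists>a. hess_yy \<psi> x (ys x) *v a = grad_y f x (ys x) \<and>
       GDERIV (F_barrier A b \<mu> f g) x :> grad_x f x (ys x) - a v* hess_xy \<psi> x (ys x)"
proof -
  define u where "u = ys x"
  note uI = ys_in_I[of x, folded u_def]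
  have un: "u \<in> nbhd (2 * \<eta>) u" using uI eta_pos by (intro nbhd_centre) auto
  define M where "M = hess_yy \<psi> x u"
  have "inj ((*v) M)"
  proof (rule injI)
    fix v w assume "M *v v = M *v w"
    then have "M *v (v - w) = 0" by (simp add: matrix_vector_mult_diff_distrib)
    then have "\<rho> * (dn u (v - w))\<^sup>2 \<le> 0"
      using hess_psi_lower[OF ys_centre[of x, folded u_def] un, of "v - w"] by (simp add: M_def)
    then have "dn u (v - w) = 0" using rho_pos by (simp add: mult_le_0_iff)
    then show "v = w" using dn_eq_0_iff[OF uI] by simp
  qed
  then have "surj ((*v) M)" by (intro linear_injective_imp_surjective matrix_vector_mul_linear) auto
  then obtain a where a: "M *v a = grad_y f x u" by (metis surjD)
  define \<Phi> where "\<Phi> = (\<lambda>z. case_prod f z - a \<bullet> (\<lambda>(x, y). grad_y \<psi> x y) z)"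
  define l where "l v = v \<bullet> (grad_x f x u - a v* hess_xy \<psi> x u)" for v
  have "(\<Phi> has_derivative (\<lambda>z. (\<lambda>(v, k). v \<bullet> grad_x f x u + k \<bullet> grad_y f x u) z
      - a \<bullet> (\<lambda>(v, k). hess_xy \<psi> x u *v v + hess_yy \<psi> x u *v k) z)) (at (x, u))"
    unfolding \<Phi>_def
    by (intro has_derivative_diff has_derivative_inner_right joint_has_derivative_grad[OF C2_f]
        joint_grad_y_psi_has_derivative[OF uI])
  moreover have "(\<lambda>z. (\<lambda>(v, k). v \<bullet> grad_x f x u + k \<bullet> grad_y f x u) z
      - a \<bullet> (\<lambda>(v, k). hess_xy \<psi> x u *v v + hess_yy \<psi> x u *v k) z) = (\<lambda>(v, k). l v)"
  proof (rule ext, clarify)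
    fix v :: "real^'n" and k :: "real^'p"
    have "a \<bullet> (M *v k) = k \<bullet> grad_y f x u"
      using hess_yy_psi_symmetric[OF uI, of x k a] a by (simp add: M_def inner_commute)
    moreover have "v \<bullet> (a v* hess_xy \<psi> x u) = a \<bullet> (hess_xy \<psi> x u *v v)"
      by (simp add: inner_commute[of v] dot_lmul_matrix)
    ultimately show "v \<bullet> grad_x f x u + k \<bullet> grad_y f x u - a \<bullet> (hess_xy \<psi> x u *v v + hess_yy \<psi> x u *v k) = l v"
      by (simp add: l_def M_def inner_add_right inner_diff_right)
  qed
  ultimately have "(\<Phi> has_derivative (\<lambda>(v, k). l v)) (at (x, ys x))" by (simp add: u_def)
  moreover obtain K where "\<And>x x'. norm (ys x' - ys x) \<le> K * norm (x' - x)"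
    using ys_euclidean_lipschitz by blast
  ultimately have "((\<lambda>x'. \<Phi> (x', ys x')) has_derivative l) (at x)"
    by (rule has_derivative_along_lipschitz_curve)
  moreover have "(\<lambda>x'. \<Phi> (x', ys x')) = F_barrier A b \<mu> f g"
    by (auto simp: \<Phi>_def grad_psi_ys F_barrier_def)
  ultimately have "GDERIV (F_barrier A b \<mu> f g) x :> grad_x f x u - a v* hess_xy \<psi> x u"
    unfolding gderiv_def l_def[abs_def] by simp
  then show ?thesis using a unfolding M_def u_def by blast
qed

lemma GDERIV_F: "GDERIV (F_barrier A b \<mu> f g) x :> gradient (F_barrier A b \<mu> f g) x"
  using hypergradient[of x] gradient_eqI by metis

lemma grad_f_lipschitz:
  "norm (grad_x f x y - grad_x f x' y') \<le> lf1 * (norm (x - x') + norm (y - y'))" (is ?X)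
  "norm (grad_y f x y - grad_y f x' y') \<le> lf1 * (norm (x - x') + norm (y - y'))" (is ?Y)
  and lf1_nonneg: "0 \<le> lf1"
proof -
  have lip: "lf1-lipschitz_on UNIV (gradient (case_prod f))"
    using regularity by (simp add: objective_regularity_def)
  then show lf1: "0 \<le> lf1" by (rule lipschitz_on_nonneg)
  define D where "D = gradient (case_prod f) (x, y) - gradient (case_prod f) (x', y')"
  have "norm D \<le> lf1 * norm ((x, y) - (x', y'))"
    unfolding D_def dist_norm[symmetric] by (rule lipschitz_onD[OF lip]) auto
  also have "\<dots> \<le> lf1 * (norm (x - x') + norm (y - y'))"
    using lf1 by (intro mult_left_mono) (simp_all add: norm_Pair_le)
  finally have D: "norm D \<le> lf1 * (norm (x - x') + norm (y - y'))" .
  have "norm (fst D) \<le> norm D" "norm (snd D) \<le> norm D"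
    by (metis norm_fst_le norm_snd_le prod.collapse)+
  then show ?X ?Y using D
    by (auto simp: grad_x_eq[OF C2_f] grad_y_eq[OF C2_f] D_def)
qed

lemma hess_yy_g_lipschitz:
  "norm (hess_yy g x y *v u - hess_yy g x' y *v u) \<le> lg2 * norm (x - x') * norm u"
  and lg2_nonneg: "0 \<le> lg2"
proof -
  have lip: "lg2-lipschitz_on UNIV (hessian (case_prod g))"
    using regularity by (simp add: objective_regularity_def)
  then show lg2: "0 \<le> lg2" by (rule lipschitz_on_nonneg)
  have hess: "blinfun_apply (hessian (case_prod g) (x, y)) = second_deriv g x y" for x y
    using bounded_linear_second_deriv[OF C2_g, of x y]
    by (simp add: hessian_def second_deriv_def bounded_linear_Blinfun_apply)
  define D where "D = hessian (case_prod g) (x, y) - hessian (case_prod g) (x', y)"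
  have "norm D \<le> lg2 * norm ((x, y) - (x', y))"
    unfolding D_def dist_norm[symmetric] by (rule lipschitz_onD[OF lip]) auto
  then have D: "norm D \<le> lg2 * norm (x - x')" by simp
  have "hess_yy g x y *v u - hess_yy g x' y *v u = snd (blinfun_apply D (0, u))"
    by (simp add: hess_yy_eq[OF C2_g] D_def minus_blinfun.rep_eq hess)
  then have "norm (hess_yy g x y *v u - hess_yy g x' y *v u) \<le> norm (blinfun_apply D (0, u))"
    by (metis norm_snd_le prod.collapse)
  also have "\<dots> \<le> norm D * norm (0 :: real^'n, u)" by (rule norm_blinfun)
  also have "\<dots> \<le> lg2 * norm (x - x') * norm u" using D by (simp add: mult_right_mono)
  finally show "norm (hess_yy g x y *v u - hess_yy g x' y *v u) \<le> lg2 * norm (x - x') * norm u" .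
qed

lemma grad_y_psi_mvt:
  assumes "c \<in> I" "y \<in> nbhd r c"
  shows "\<exists>w\<in>nbhd r c. dn c (w - c) \<le> dn c (y - c) \<and>
    e \<bullet> (grad_y \<psi> x y - grad_y \<psi> x c) = e \<bullet> (hess_yy \<psi> x w *v (y - c))"
proof -
  have d: "((\<lambda>t. e \<bullet> grad_y \<psi> x (c + t *\<^sub>R (y - c))) has_real_derivative
      e \<bullet> (hess_yy \<psi> x (c + t *\<^sub>R (y - c)) *v (y - c))) (at t)" if "t \<in> {0..1}" for t
  proof -
    have "((\<lambda>t. c + t *\<^sub>R (y - c)) has_derivative (\<lambda>s. s *\<^sub>R (y - c))) (at t)"
      by (auto intro!: derivative_eq_intros)
    then have "((\<lambda>t. grad_y \<psi> x (c + t *\<^sub>R (y - c))) has_derivative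
        (\<lambda>s. hess_yy \<psi> x (c + t *\<^sub>R (y - c)) *v (s *\<^sub>R (y - c)))) (at t)"
      using nbhd_I[OF nbhd_segment(1)[OF assms(2,1) that]]
      by (intro has_derivative_compose[OF _ grad_y_psi_has_derivative]) auto
    then have "((\<lambda>t. e \<bullet> grad_y \<psi> x (c + t *\<^sub>R (y - c))) has_derivative
        (\<lambda>s. e \<bullet> (hess_yy \<psi> x (c + t *\<^sub>R (y - c)) *v (s *\<^sub>R (y - c))))) (at t)"
      by (rule has_derivative_inner_right)
    then show ?thesis
      by (rule has_derivative_imp_has_field_derivative) (simp add: matrix_vector_mult_scaleR mult.commute)
  qed
  then have "\<exists>t>0. t < 1 \<and> e \<bullet> grad_y \<psi> x (c + 1 *\<^sub>R (y - c)) - e \<bullet> grad_y \<psi> x (c + 0 *\<^sub>R (y - c))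
      = (1 - 0) * (e \<bullet> (hess_yy \<psi> x (c + t *\<^sub>R (y - c)) *v (y - c)))"
    by (intro MVT2) auto
  then obtain t where t: "0 < t" "t < 1"
    and eq: "e \<bullet> (grad_y \<psi> x y - grad_y \<psi> x c) = e \<bullet> (hess_yy \<psi> x (c + t *\<^sub>R (y - c)) *v (y - c))"
    by (auto simp: inner_diff_right)
  then show ?thesis using nbhd_segment[OF assms(2,1), of t]
    by (intro bexI[of _ "c + t *\<^sub>R (y - c)"]) auto
qed

text \<open>
  Write \<open>d\<close> for the displacement of the proxy from the exact minimiser.  Linearising the stationarity
  of the proxy shows that \<open>\<lambda> d\<close> approximates the negative adjoint \<open>-a\<close> up to \<open>O(1 / \<lambda>)\<close>; therefore
  the difference quotient \<open>\<lambda> (\<nabla>\<^sub>x g(p) - \<nabla>\<^sub>x g(u))\<close> reproduces the implicit part of the hypergradient.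
\<close>

lemma proxy_bias:
  "\<exists>B\<ge>0. \<forall>x. \<forall>lam\<ge>lam0.
     norm (outer_direction f g lam x (yl lam x) (ys x) - gradient (F_barrier A b \<mu> f g) x) \<le> B / lam"
proof -
  obtain R where R: "0 < R" "\<And>c u. c \<in> I \<Longrightarrow> norm u \<le> R * dn c u" using norm_le_dn by blast
  define B2 where "B2 = (4 * \<bar>l_psi2 C\<bar> * E\<^sup>2 + 2 * lf1 * R\<^sup>2 * E) / \<rho>"
  define B where "B = 2 * lf1 * R * E + 4 * \<bar>l_psi2 C\<bar> * E\<^sup>2 + L1 * B2"
  have B2: "0 \<le> B2" unfolding B2_def using lf1_nonneg R(1) E_nonneg rho_pos by simp
  have B: "0 \<le> B" unfolding B_def using lf1_nonneg R(1) E_nonneg L1_pos B2 by simp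
  have main: "norm (outer_direction f g lam x (yl lam x) (ys x) - gradient (F_barrier A b \<mu> f g) x) \<le> B / lam"
    if lam: "lam0 \<le> lam" for x lam
  proof -
    have pos: "0 < lam" using lam lam0_pos by linarith
    define u p d where "u = ys x" and "p = yl lam x" and "d = p - u"
    have uI: "u \<in> I" and pI: "p \<in> I" using ys_in_I yl_in_I[OF pos] by (auto simp: u_def p_def)
    note uc = ys_centre[of x, folded u_def]
    have un: "u \<in> nbhd (2 * \<eta>) u" using uI eta_pos by (intro nbhd_centre) auto
    have pn: "p \<in> nbhd (2 * \<eta>) u" unfolding u_def p_def by (rule yl_mem_nbhd[OF lam])
    have Elam: "0 \<le> E / lam" using E_nonneg pos by simp
    have d: "dn u d \<le> 2 * E / lam" "0 \<le> dn u d"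
      using proxy_distance_exact(1)[OF lam, of x] Elam dn_nonneg[OF uI] unfolding d_def p_def u_def by auto
    have dR: "norm d \<le> R * (2 * E / lam)"
      using R(2)[OF uI, of d] mult_left_mono[OF d(1), of R] R(1) by linarith
    obtain a where a: "hess_yy \<psi> x u *v a = grad_y f x u"
      and grad: "gradient (F_barrier A b \<mu> f g) x = grad_x f x u - a v* hess_xy \<psi> x u"
      using hypergradient[of x] gradient_eqI unfolding u_def by metis
    define e where "e = lam *\<^sub>R d + a"
    have eB: "dn u e \<le> B2 / lam"
    proof -
      have e0: "0 \<le> dn u e" by (rule dn_nonneg[OF uI])
      obtain w where w: "w \<in> nbhd (2 * \<eta>) u" "dn u (w - u) \<le> dn u d"
        and eq: "e \<bullet> (grad_y \<psi> x p - grad_y \<psi> x u) = e \<bullet> (hess_yy \<psi> x w *v d)"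
        using grad_y_psi_mvt[OF uI pn, of e x] unfolding d_def by blast
      have stat: "grad_y f x p + lam *\<^sub>R grad_y \<psi> x p = 0" unfolding p_def by (rule grad_L_yl[OF pos])
      have zero: "grad_y \<psi> x u = 0" unfolding u_def by (rule grad_psi_ys)
      have "lam * (e \<bullet> (hess_yy \<psi> x w *v d)) = - (e \<bullet> grad_y f x p)"
        using arg_cong[OF stat, of "\<lambda>v. e \<bullet> v"] by (simp add: eq[symmetric] zero inner_add_right)
      then have "(hess_yy \<psi> x u *v e) \<bullet> e
          = lam * ((hess_yy \<psi> x u *v d - hess_yy \<psi> x w *v d) \<bullet> e) + (grad_y f x u - grad_y f x p) \<bullet> e"
        by (simp add: e_def matrix_vector_right_distrib matrix_vector_mult_scaleR a
            inner_add_left inner_diff_left inner_commute algebra_simps)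
      moreover have "(hess_yy \<psi> x u *v d - hess_yy \<psi> x w *v d) \<bullet> e \<le> (\<bar>l_psi2 C\<bar> * (2 * E / lam)\<^sup>2) * dn u e"
      proof -
        have "(hess_yy \<psi> x u *v d - hess_yy \<psi> x w *v d) \<bullet> e \<le> \<bar>l_psi2 C\<bar> * dn u (u - w) * dn u d * dn u e"
          using hess_yy_psi_diff_le[OF uc un w(1), of d e] by linarith
        also have "\<dots> \<le> \<bar>l_psi2 C\<bar> * (2 * E / lam) * (2 * E / lam) * dn u e"
          using w(2) d e0 dn_nonneg[OF uI] E_nonneg pos
          by (intro mult_right_mono mult_mono mult_left_mono)
            (auto simp: dn_minus_commute[OF uI, of u w] intro: mult_nonneg_nonneg)
        finally show ?thesis by (simp add: power2_eq_square mult.assoc)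
      qed
      moreover have "(grad_y f x u - grad_y f x p) \<bullet> e \<le> (lf1 * (R * (2 * E / lam)) * R) * dn u e"
      proof -
        have "(grad_y f x u - grad_y f x p) \<bullet> e \<le> norm (grad_y f x u - grad_y f x p) * norm e"
          by (rule norm_cauchy_schwarz)
        also have "\<dots> \<le> (lf1 * (R * (2 * E / lam))) * (R * dn u e)"
        proof (intro mult_mono)
          have "norm (grad_y f x u - grad_y f x p) \<le> lf1 * norm d"
            using grad_f_lipschitz(2)[of x u x p] by (simp add: d_def norm_minus_commute)
          also have "\<dots> \<le> lf1 * (R * (2 * E / lam))" using dR lf1_nonneg by (rule mult_left_mono)
          finally show "norm (grad_y f x u - grad_y f x p) \<le> lf1 * (R * (2 * E / lam))" .
          show "norm e \<le> R * dn u e" by (rule R(2)[OF uI])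
          show "0 \<le> lf1 * (R * (2 * E / lam))" using lf1_nonneg R(1) E_nonneg pos by simp
        qed simp
        finally show ?thesis by (simp add: mult_ac)
      qed
      moreover have "\<rho> * (dn u e)\<^sup>2 \<le> (hess_yy \<psi> x u *v e) \<bullet> e" by (rule hess_psi_lower[OF uc un])
      ultimately have "\<rho> * (dn u e)\<^sup>2 \<le> lam * ((\<bar>l_psi2 C\<bar> * (2 * E / lam)\<^sup>2) * dn u e)
          + (lf1 * (R * (2 * E / lam)) * R) * dn u e"
        using pos by (smt (verit) mult_left_mono)
      also have "\<dots> = \<rho> * (B2 / lam) * dn u e"
        using pos rho_pos by (simp add: B2_def power2_eq_square field_simps)
      finally have "(dn u e) * dn u e \<le> (B2 / lam) * dn u e"
        using rho_pos pos by (simp add: power2_eq_square field_simps)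
      then show ?thesis using e0 B2 pos mult_right_le_imp_le[of "dn u e" "dn u e" "B2 / lam"]
        by (cases "dn u e = 0") (simp, linarith)
    qed
    show ?thesis
    proof (rule norm_le_of_inner_le)
      fix v
      obtain w where w: "w \<in> nbhd (2 * \<eta>) u" "dn u (w - u) \<le> dn u d"
        and eq: "(grad_x g x p - grad_x g x u) \<bullet> v = (hess_xy \<psi> x w *v v) \<bullet> d"
        using grad_x_mvt[OF C2_g uI pn, of x v] hess_xy_psi[OF nbhd_I] unfolding d_def by metis
      have split: "(outer_direction f g lam x p u - gradient (F_barrier A b \<mu> f g) x) \<bullet> v
          = (grad_x f x p - grad_x f x u) \<bullet> v + lam * ((hess_xy \<psi> x w *v v - hess_xy \<psi> x u *v v) \<bullet> d)
            + (hess_xy \<psi> x u *v v) \<bullet> e"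
      proof -
        have "(outer_direction f g lam x p u - gradient (F_barrier A b \<mu> f g) x) \<bullet> v
            = (grad_x f x p - grad_x f x u) \<bullet> v + lam * ((grad_x g x p - grad_x g x u) \<bullet> v)
              + (a v* hess_xy \<psi> x u) \<bullet> v"
          by (simp add: outer_direction_def grad inner_diff_left inner_add_left algebra_simps)
        also have "(a v* hess_xy \<psi> x u) \<bullet> v = (hess_xy \<psi> x u *v v) \<bullet> a"
          unfolding dot_lmul_matrix by (rule inner_commute)
        finally show ?thesis
          unfolding eq by (simp add: e_def inner_diff_left inner_add_right algebra_simps)
      qed
      have t1: "(grad_x f x p - grad_x f x u) \<bullet> v \<le> (lf1 * (R * (2 * E / lam))) * norm v"
      proof -
        have "(grad_x f x p - grad_x f x u) \<bullet> v \<le> norm (grad_x f x p - grad_x f x u) * norm v"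
          by (rule norm_cauchy_schwarz)
        moreover have "norm (grad_x f x p - grad_x f x u) \<le> lf1 * norm d"
          using grad_f_lipschitz(1)[of x p x u] by (simp add: d_def)
        moreover have "lf1 * norm d \<le> lf1 * (R * (2 * E / lam))" using dR lf1_nonneg by (rule mult_left_mono)
        ultimately show ?thesis by (smt (verit) mult_right_mono norm_ge_zero)
      qed
      have t2: "(hess_xy \<psi> x w *v v - hess_xy \<psi> x u *v v) \<bullet> d \<le> (\<bar>l_psi2 C\<bar> * (2 * E / lam)\<^sup>2) * norm v"
      proof -
        have "(hess_xy \<psi> x w *v v - hess_xy \<psi> x u *v v) \<bullet> d \<le> \<bar>l_psi2 C\<bar> * dn u (w - u) * norm v * dn u d"
          using hess_xy_psi_diff_le[OF uc w(1) un, of v d] by linarith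
        also have "\<dots> \<le> \<bar>l_psi2 C\<bar> * (2 * E / lam) * norm v * (2 * E / lam)"
          using w(2) d dn_nonneg[OF uI] E_nonneg pos
          by (intro mult_mono mult_right_mono mult_left_mono) auto
        finally show ?thesis by (simp add: power2_eq_square mult_ac)
      qed
      have t3: "(hess_xy \<psi> x u *v v) \<bullet> e \<le> L1 * norm v * (B2 / lam)"
        using hess_xy_psi_le[OF uc un, of v e] mult_left_mono[OF eB, of "L1 * norm v"] L1_pos by simp
      have "(outer_direction f g lam x p u - gradient (F_barrier A b \<mu> f g) x) \<bullet> v
          \<le> (lf1 * (R * (2 * E / lam))) * norm v + lam * ((\<bar>l_psi2 C\<bar> * (2 * E / lam)\<^sup>2) * norm v)
            + L1 * norm v * (B2 / lam)"
        unfolding split using t1 mult_left_mono[OF t2, of lam] t3 pos by linarith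
      also have "\<dots> = B / lam * norm v"
        using pos by (simp add: B_def power2_eq_square field_simps)
      finally show "(outer_direction f g lam x (yl lam x) (ys x) - gradient (F_barrier A b \<mu> f g) x) \<bullet> v
          \<le> B / lam * norm v" unfolding u_def p_def .
    qed (use B pos in simp)
  qed
  then show ?thesis using B by blast
qed

text \<open>
  The displacement of the proxy is itself Lipschitz in \<open>x\<close> with a constant of order \<open>1 / \<lambda>\<close>:
  subtract the stationarity conditions at \<open>x\<close> and \<open>x'\<close> and apply the mean value theorem to both
  segments with a common parameter.
\<close>

lemma displacement_lipschitz:
  "\<exists>B\<ge>0. \<forall>x x'. \<forall>lam\<ge>lam0.
     l_star0 C * norm (x' - x) \<le> \<eta> / 16 \<longrightarrow>
     dn (ys x') ((yl lam x' - ys x') - (yl lam x - ys x)) \<le> B / lam * norm (x' - x)"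
proof -
  obtain R where R: "0 < R" "\<And>c u. c \<in> I \<Longrightarrow> norm u \<le> R * dn c u" using norm_le_dn by blast
  define K where "K = R * lf1 * (1 + R * l_lam0 C) + lg2 * R\<^sup>2 * (2 * E) + \<bar>l_psi2 C\<bar> * (l_star0 C + 2 * l_lam0 C) * (4 * E)"
  have K: "0 \<le> K" unfolding K_def
    using R(1) lf1_nonneg l_lam0_nonneg lg2_nonneg E_nonneg l_star0_ge by simp
  have main: "dn (ys x') ((yl lam x' - ys x') - (yl lam x - ys x)) \<le> K / \<rho> / lam * norm (x' - x)"
    if lam: "lam0 \<le> lam" and close: "l_star0 C * norm (x' - x) \<le> \<eta> / 16" for x x' lam
  proof -
    have pos: "0 < lam" using lam lam0_pos by linarith
    define h where "h = norm (x' - x)"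
    have h0: "0 \<le> h" by (simp add: h_def)
    define u p d where "u = ys x" and "p = yl lam x" and "d = p - u"
    define u' p' d' where "u' = ys x'" and "p' = yl lam x'" and "d' = p' - u'"
    define e where "e = d' - d"
    have uI: "u \<in> I" "u' \<in> I" and pI: "p \<in> I" "p' \<in> I"
      using ys_in_I yl_in_I[OF pos] by (auto simp: u_def p_def u'_def p'_def)
    note uc = ys_centre[of x, folded u_def] and uc' = ys_centre[of x', folded u'_def]
    have Elam: "0 \<le> E / lam" "E / lam \<le> \<eta> / 4" using E_nonneg pos E_le[OF lam] by auto
    have du: "dn u (u' - u) \<le> l_star0 C * h" "dn u (u' - u) \<le> \<eta> / 16" "dn u (u' - u) \<le> 1 / 32"
      using ys_lipschitz[of x x'] close eta_half unfolding u_def u'_def h_def by linarith+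
    have d: "dn u d \<le> 8 / 7 * (E / lam)" and d': "dn u' d' \<le> 8 / 7 * (E / lam)"
      unfolding d_def p_def u_def d'_def p'_def u'_def by (rule proxy_distance_exact(1)[OF lam])+
    have conv: "dn u v \<le> 33 / 32 * dn u' v" for v
      using dn_change_centre(2)[OF uI du(3)] by simp
    have dp: "dn u (p' - p) \<le> 2 * l_lam0 C * h"
    proof -
      have "dn p (p' - p) \<le> l_lam0 C * h"
        using yl_lipschitz[OF lam lam, of x x'] unfolding p_def p'_def h_def by simp
      moreover have "dn u (p' - p) \<le> 8 / 7 * dn p (p' - p)"
        unfolding u_def p_def by (rule proxy_distance_exact(2)[OF lam])
      moreover have "0 \<le> dn p (p' - p)" by (rule dn_nonneg[OF pI(1)])
      ultimately show ?thesis by linarith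
    qed
    define e0 where "e0 = dn u' e"
    have e0: "0 \<le> e0" unfolding e0_def by (rule dn_nonneg[OF uI(2)])
    have eR: "norm e \<le> R * e0" unfolding e0_def by (rule R(2)[OF uI(2)])
    have dnorm: "norm d \<le> R * (2 * E / lam)"
    proof -
      have "norm d \<le> R * dn u d" by (rule R(2)[OF uI(1)])
      also have "\<dots> \<le> R * (2 * E / lam)" using d Elam R(1) by (intro mult_left_mono) auto
      finally show ?thesis .
    qed
    define w w' where "w t = u + t *\<^sub>R d" and "w' t = u' + t *\<^sub>R d'" for t :: real
    have wmem: "w t \<in> nbhd (2 * \<eta>) u" and w'mem': "w' t \<in> nbhd (2 * \<eta>) u'"
      and w'mem: "w' t \<in> nbhd (2 * \<eta>) u" if t: "t \<in> {0..1}" for t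
    proof -
      have pn: "p \<in> nbhd (2 * \<eta>) u" "p' \<in> nbhd (2 * \<eta>) u'"
        unfolding u_def p_def u'_def p'_def by (rule yl_mem_nbhd[OF lam])+
      show "w t \<in> nbhd (2 * \<eta>) u" unfolding w_def d_def by (rule nbhd_segment(1)[OF pn(1) uI(1) t])
      show m: "w' t \<in> nbhd (2 * \<eta>) u'" unfolding w'_def d'_def by (rule nbhd_segment(1)[OF pn(2) uI(2) t])
      have "dn u (w' t - u) \<le> dn u (u' - u) + dn u (t *\<^sub>R d')"
        using dn_triangle[OF uI(1), of "u' - u" "t *\<^sub>R d'"] by (simp add: w'_def algebra_simps)
      also have "dn u (t *\<^sub>R d') \<le> 33 / 32 * dn u' (t *\<^sub>R d')" by (rule conv)
      also have "dn u' (t *\<^sub>R d') \<le> dn u' d'" unfolding d'_def by (rule nbhd_segment(2)[OF pn(2) uI(2) t])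
      finally have "dn u (w' t - u) \<le> 2 * \<eta>" using du(2) d' Elam eta_pos by linarith
      then show "w' t \<in> nbhd (2 * \<eta>) u" using nbhd_I[OF m] by (simp add: nbhd_iff)
    qed
    define \<phi> where "\<phi> t = e \<bullet> (grad_y \<psi> x' (w' t) - grad_y \<psi> x (w t))" for t
    have deriv: "(\<phi> has_real_derivative e \<bullet> (hess_yy \<psi> x' (w' t) *v d' - hess_yy \<psi> x (w t) *v d)) (at t)"
      if t: "t \<in> {0..1}" for t
    proof -
      have "(w has_derivative (\<lambda>s. s *\<^sub>R d)) (at t)" "(w' has_derivative (\<lambda>s. s *\<^sub>R d')) (at t)"
        unfolding w_def[abs_def] w'_def[abs_def] by (auto intro!: derivative_eq_intros)
      then have "((\<lambda>t. grad_y \<psi> x (w t)) has_derivative (\<lambda>s. hess_yy \<psi> x (w t) *v (s *\<^sub>R d))) (at t)"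
        "((\<lambda>t. grad_y \<psi> x' (w' t)) has_derivative (\<lambda>s. hess_yy \<psi> x' (w' t) *v (s *\<^sub>R d'))) (at t)"
        using nbhd_I[OF wmem[OF t]] nbhd_I[OF w'mem[OF t]]
        by (auto intro!: has_derivative_compose[OF _ grad_y_psi_has_derivative])
      then have "(\<phi> has_derivative (\<lambda>s. e \<bullet> (hess_yy \<psi> x' (w' t) *v (s *\<^sub>R d') - hess_yy \<psi> x (w t) *v (s *\<^sub>R d)))) (at t)"
        unfolding \<phi>_def[abs_def] by (intro has_derivative_inner_right has_derivative_diff)
      then show ?thesis
        by (rule has_derivative_imp_has_field_derivative)
          (simp add: matrix_vector_mult_scaleR inner_diff_right algebra_simps)
    qed
    then have "\<exists>t>0. t < 1 \<and> \<phi> 1 - \<phi> 0 = (1 - 0) * (e \<bullet> (hess_yy \<psi> x' (w' t) *v d' - hess_yy \<psi> x (w t) *v d))"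
      by (intro MVT2) auto
    then obtain t where "0 < t" "t < 1"
      and mvt: "\<phi> 1 - \<phi> 0 = e \<bullet> (hess_yy \<psi> x' (w' t) *v d' - hess_yy \<psi> x (w t) *v d)" by auto
    then have t: "t \<in> {0..1}" by simp
    have phi0: "\<phi> 0 = 0" by (simp add: \<phi>_def w_def w'_def u_def u'_def grad_psi_ys)
    have phi1: "\<phi> 1 \<le> R * lf1 * (1 + R * l_lam0 C) / lam * h * e0"
    proof -
      have stat: "grad_y \<psi> z (yl lam z) = - (1 / lam) *\<^sub>R grad_y f z (yl lam z)" for z
      proof -
        have "grad_y f z (yl lam z) = - (lam *\<^sub>R grad_y \<psi> z (yl lam z))"
          using grad_L_yl[OF pos, of z] by (simp add: eq_neg_iff_add_eq_0)
        then show ?thesis using pos by simp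
      qed
      have "\<phi> 1 = (1 / lam) * (e \<bullet> (grad_y f x p - grad_y f x' p'))"
        using stat[of x] stat[of x']
        by (simp add: \<phi>_def w_def w'_def d_def d'_def p_def p'_def inner_diff_right algebra_simps)
      also have "\<dots> \<le> (1 / lam) * (R * e0 * (lf1 * (h + R * (l_lam0 C * h))))"
      proof (rule mult_left_mono)
        have "norm (grad_y f x p - grad_y f x' p') \<le> lf1 * (norm (x - x') + norm (p - p'))"
          by (rule grad_f_lipschitz)
        also have "\<dots> \<le> lf1 * (h + R * (l_lam0 C * h))"
        proof (intro mult_left_mono add_mono lf1_nonneg)
          have "norm (p' - p) \<le> R * dn p (p' - p)" by (rule R(2)[OF pI(1)])
          also have "\<dots> \<le> R * (l_lam0 C * h)"
            using yl_lipschitz[OF lam lam, of x x'] R(1) unfolding p_def p'_def h_def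
            by (intro mult_left_mono) auto
          finally show "norm (p - p') \<le> R * (l_lam0 C * h)" by (simp add: norm_minus_commute)
        qed (simp add: h_def norm_minus_commute)
        finally have n: "norm (grad_y f x p - grad_y f x' p') \<le> lf1 * (h + R * (l_lam0 C * h))" .
        have "e \<bullet> (grad_y f x p - grad_y f x' p') \<le> norm e * norm (grad_y f x p - grad_y f x' p')"
          by (rule norm_cauchy_schwarz)
        also have "\<dots> \<le> R * e0 * (lf1 * (h + R * (l_lam0 C * h)))"
          using eR n R(1) e0 by (intro mult_mono) auto
        finally show "e \<bullet> (grad_y f x p - grad_y f x' p') \<le> R * e0 * (lf1 * (h + R * (l_lam0 C * h)))" .
      qed (use pos in simp)
      finally show ?thesis by (simp add: algebra_simps add_divide_distrib)
    qed
    have x_part: "\<bar>e \<bullet> (hess_yy \<psi> x' (w' t) *v d - hess_yy \<psi> x (w' t) *v d)\<bar> \<le> R * e0 * (lg2 * h * (R * (2 * E / lam)))"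
    proof -
      have w'I: "w' t \<in> I" using nbhd_I[OF w'mem[OF t]] .
      have "norm (hess_yy \<psi> x' (w' t) *v d - hess_yy \<psi> x (w' t) *v d) \<le> lg2 * norm (x' - x) * norm d"
        unfolding hess_yy_psi[OF w'I] using hess_yy_g_lipschitz(1)[of x' "w' t" d x] by simp
      also have "\<dots> \<le> lg2 * h * (R * (2 * E / lam))"
        unfolding h_def[symmetric] using dnorm lg2_nonneg h0 by (intro mult_left_mono) auto
      finally have "norm e * norm (hess_yy \<psi> x' (w' t) *v d - hess_yy \<psi> x (w' t) *v d)
          \<le> R * e0 * (lg2 * h * (R * (2 * E / lam)))"
        using eR R(1) e0 by (intro mult_mono) auto
      then show ?thesis using Cauchy_Schwarz_ineq2 order_trans by blast
    qed
    have y_part: "\<bar>e \<bullet> (hess_yy \<psi> x (w' t) *v d - hess_yy \<psi> x (w t) *v d)\<bar>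
        \<le> \<bar>l_psi2 C\<bar> * ((l_star0 C + 2 * l_lam0 C) * h) * (2 * E / lam) * (2 * e0)"
    proof -
      have "w' t - w t = (1 - t) *\<^sub>R (u' - u) + t *\<^sub>R (p' - p)"
        by (simp add: w_def w'_def d_def d'_def algebra_simps)
      then have "dn u (w' t - w t) \<le> (1 - t) * dn u (u' - u) + t * dn u (p' - p)"
        using dn_triangle[OF uI(1), of "(1 - t) *\<^sub>R (u' - u)" "t *\<^sub>R (p' - p)"] t
        by (simp add: dn_scaleR[OF uI(1)])
      also have "\<dots> \<le> dn u (u' - u) + dn u (p' - p)"
        using t dn_nonneg[OF uI(1)] by (intro add_mono mult_left_le_one_le) auto
      also have "\<dots> \<le> (l_star0 C + 2 * l_lam0 C) * h" using du(1) dp by (simp add: algebra_simps)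
      finally have w: "dn u (w' t - w t) \<le> (l_star0 C + 2 * l_lam0 C) * h" .
      have "\<bar>(hess_yy \<psi> x (w' t) *v d - hess_yy \<psi> x (w t) *v d) \<bullet> e\<bar>
          \<le> \<bar>l_psi2 C\<bar> * dn u (w' t - w t) * dn u d * dn u e"
        by (rule hess_yy_psi_diff_le[OF uc w'mem[OF t] wmem[OF t]])
      also have "\<dots> \<le> \<bar>l_psi2 C\<bar> * ((l_star0 C + 2 * l_lam0 C) * h) * (2 * E / lam) * (2 * e0)"
      proof (intro mult_mono)
        show "dn u d \<le> 2 * E / lam" using d Elam by simp
        show "dn u e \<le> 2 * e0" using conv[of e] e0 unfolding e0_def by simp
        show "0 \<le> \<bar>l_psi2 C\<bar> * ((l_star0 C + 2 * l_lam0 C) * h)"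
          using l_star0_ge l_lam0_nonneg h0 by simp
        then show "0 \<le> \<bar>l_psi2 C\<bar> * ((l_star0 C + 2 * l_lam0 C) * h) * (2 * E / lam)"
          using Elam E_nonneg pos by simp
      qed (use w dn_nonneg[OF uI(1)] in auto)
      finally show ?thesis by (simp add: inner_commute)
    qed
    have "\<rho> * e0\<^sup>2 \<le> e \<bullet> (hess_yy \<psi> x' (w' t) *v e)"
      using hess_psi_lower[OF uc' w'mem'[OF t], of e] by (simp add: e0_def inner_commute)
    moreover have "e \<bullet> (hess_yy \<psi> x' (w' t) *v e) = \<phi> 1
        - e \<bullet> (hess_yy \<psi> x' (w' t) *v d - hess_yy \<psi> x (w' t) *v d)
        - e \<bullet> (hess_yy \<psi> x (w' t) *v d - hess_yy \<psi> x (w t) *v d)"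
    proof -
      have "hess_yy \<psi> x' (w' t) *v e = hess_yy \<psi> x' (w' t) *v d' - hess_yy \<psi> x' (w' t) *v d"
        unfolding e_def by (rule matrix_vector_mult_diff_distrib)
      then show ?thesis using mvt phi0 by (simp only: inner_diff_right)
    qed
    ultimately have "\<rho> * e0\<^sup>2 \<le> R * lf1 * (1 + R * l_lam0 C) / lam * h * e0
        + R * e0 * (lg2 * h * (R * (2 * E / lam)))
        + \<bar>l_psi2 C\<bar> * ((l_star0 C + 2 * l_lam0 C) * h) * (2 * E / lam) * (2 * e0)"
      using phi1 x_part y_part by linarith
    also have "\<dots> = \<rho> * (K / \<rho> / lam * h) * e0"
      using rho_pos pos by (simp add: K_def power2_eq_square add_divide_distrib algebra_simps)
    finally have "e0 * e0 \<le> (K / \<rho> / lam * h) * e0" using rho_pos pos by (simp add: power2_eq_square field_simps)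
    moreover have "0 \<le> K / \<rho> / lam * h" using K rho_pos pos h0 by simp
    ultimately have "e0 \<le> K / \<rho> / lam * h"
      using e0 mult_right_le_imp_le[of e0 e0 "K / \<rho> / lam * h"] by (cases "e0 = 0") (simp, linarith)
    then show ?thesis unfolding e0_def e_def d_def d'_def u_def p_def u'_def p'_def h_def .
  qed
  then show ?thesis using K rho_pos by (intro exI[of _ "K / \<rho>"]) auto
qed

text \<open>
  Consequently the proxy inherits, up to a factor and \<open>O(1 / \<lambda>)\<close>, the Lipschitz constant of the exact
  minimiser.  It is this constant, not \<open>l_lam0\<close>, whose square enters the smallness condition on \<open>\<xi> / T\<close>.
\<close>

lemma proxy_shift:
  "\<exists>B\<ge>0. \<forall>x x'. \<forall>lam\<ge>lam0. \<forall>lam'\<ge>lam0.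
     l_star0 C * norm (x' - x) \<le> \<eta> / 16 \<longrightarrow> l_lam0 C * norm (x' - x) \<le> \<eta> / 16 \<longrightarrow>
     dn (yl lam x) (yl lam' x' - yl lam x)
       \<le> 2 * E * \<bar>1 / lam' - 1 / lam\<bar> + 2 * (l_star0 C + B / lam) * norm (x' - x)"
proof -
  obtain B where B: "0 \<le> B" "\<And>x x' lam. lam0 \<le> lam \<Longrightarrow> l_star0 C * norm (x' - x) \<le> \<eta> / 16 \<Longrightarrow>
     dn (ys x') ((yl lam x' - ys x') - (yl lam x - ys x)) \<le> B / lam * norm (x' - x)"
    using displacement_lipschitz by blast
  have main: "dn (yl lam x) (yl lam' x' - yl lam x)
       \<le> 2 * E * \<bar>1 / lam' - 1 / lam\<bar> + 2 * (l_star0 C + B / lam) * norm (x' - x)"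
    if lam: "lam0 \<le> lam" and lam': "lam0 \<le> lam'" and c1: "l_star0 C * norm (x' - x) \<le> \<eta> / 16"
      and c2: "l_lam0 C * norm (x' - x) \<le> \<eta> / 16" for x x' lam lam'
  proof -
    have pos: "0 < lam" "0 < lam'" using lam lam' lam0_pos by linarith+
    note uI = ys_in_I[of x] and uI' = ys_in_I[of x'] and pI = yl_in_I[OF pos(1), of x] and pI' = yl_in_I[OF pos(1), of x']
    have r1: "dn (yl lam x) (yl lam x' - yl lam x) \<le> 1 / 32"
      using yl_lipschitz[OF lam lam, of x x'] c2 eta_half by simp
    have r2: "dn (ys x) (ys x' - ys x) \<le> 1 / 32"
      using ys_lipschitz[of x x'] c1 eta_half by linarith
    define D where "D = (yl lam x' - ys x') - (yl lam x - ys x)"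
    have split: "yl lam' x' - yl lam x = (yl lam' x' - yl lam x') + ((ys x' - ys x) + D)"
      by (simp add: D_def)
    have "dn (yl lam x) (yl lam' x' - yl lam x)
        \<le> dn (yl lam x) (yl lam' x' - yl lam x') + (dn (yl lam x) (ys x' - ys x) + dn (yl lam x) D)"
      unfolding split
      using dn_triangle[OF pI, of "yl lam' x' - yl lam x'" "(ys x' - ys x) + D"]
        dn_triangle[OF pI, of "ys x' - ys x" D] by linarith
    moreover have "dn (yl lam x) (yl lam' x' - yl lam x') \<le> 2 * E * \<bar>1 / lam' - 1 / lam\<bar>"
    proof -
      define X where "X = \<bar>1 / lam' - 1 / lam\<bar>"
      have "dn (yl lam x) (yl lam' x' - yl lam x') \<le> 33 / 32 * dn (yl lam x') (yl lam' x' - yl lam x')"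
        using dn_change_centre(2)[OF pI pI' r1] by simp
      moreover have "dn (yl lam x') (yl lam' x' - yl lam x') \<le> E * X"
        using yl_lipschitz[OF lam lam', of x' x'] by (simp add: E_def X_def)
      moreover have "0 \<le> E * X" using E_nonneg by (simp add: X_def)
      ultimately have "dn (yl lam x) (yl lam' x' - yl lam x') \<le> 2 * (E * X)" by linarith
      then show ?thesis by (simp add: X_def)
    qed
    moreover have "dn (yl lam x) (ys x' - ys x) \<le> 2 * (l_star0 C * norm (x' - x))"
      using proxy_distance_exact(3)[OF lam, of x "ys x' - ys x"] ys_lipschitz[of x x']
        dn_nonneg[OF uI, of "ys x' - ys x"] by linarith
    moreover have "dn (ys x) D \<le> 33 / 32 * dn (ys x') D"
      using dn_change_centre(2)[OF uI uI' r2, of D] by simp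
    then have "dn (yl lam x) D \<le> 2 * (B / lam * norm (x' - x))"
      using proxy_distance_exact(3)[OF lam, of x D] B(2)[OF lam c1, folded D_def] dn_nonneg[OF uI', of D] by linarith
    ultimately show ?thesis by (simp add: algebra_simps)
  qed
  then show ?thesis using B(1) by blast
qed

end

section \<open>Forward invariance of the target neighbourhoods\<close>

text \<open>
  Bernoulli's inequality for \<open>(1 + s) ^ T\<close>, together with \<open>(1 - s) (1 + s) \<le> 1\<close>.
\<close>

lemma geometric_contraction_le:
  fixes s \<tau> :: real
  assumes "0 \<le> s" "s \<le> 1" "real T * s = 3 / 16 * \<tau>" "0 \<le> \<tau>" "\<tau> \<le> 1 / 4"
  shows "(1 - s) ^ T \<le> 1 - \<tau> / 6"
proof -
  have "(1 - s) ^ T * (1 + 3 / 16 * \<tau>) \<le> (1 - s) ^ T * (1 + s) ^ T"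
    using Bernoulli_inequality[of s T] assms by (intro mult_left_mono) auto
  also have "\<dots> = (1 - s\<^sup>2) ^ T"
    by (simp add: power_mult_distrib[symmetric] power2_eq_square algebra_simps)
  also have "\<dots> \<le> 1" using assms by (intro power_le_one) (auto simp: power_le_one)
  also have "1 \<le> (1 - \<tau> / 6) * (1 + 3 / 16 * \<tau>)"
  proof -
    have "\<tau> * \<tau> \<le> 1 / 4 * \<tau>" using assms by (intro mult_right_mono) auto
    then show ?thesis using assms by (simp add: algebra_simps)
  qed
  finally show ?thesis using assms by (simp add: mult_le_cancel_right)
qed

text \<open>
  Young's inequality with weight \<open>\<tau> / 6\<close>: the contraction pays for the recentring factor and the
  growth of the multiplier and still leaves a decrease of \<open>\<tau> / 42\<close>.
\<close>

lemma weighted_error_recursion: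
  fixes \<tau> E E' s w w' :: real
  assumes \<tau>: "0 < \<tau>" "\<tau> \<le> 1 / 4" and E: "0 \<le> E" "0 \<le> s" "0 \<le> E'"
    and E': "E' \<le> (1 + \<tau> / 30) * ((1 - \<tau> / 6) * E + s)"
    and w: "0 \<le> w" "w' \<le> w * (1 + \<tau> / 16)"
  shows "w' * E'\<^sup>2 \<le> w * ((1 - \<tau> / 42) * E\<^sup>2 + 7 / \<tau> * s\<^sup>2)"
proof -
  define a where "a = (1 - \<tau> / 6) * E"
  have t2: "\<tau> * \<tau> \<le> 1 / 4 * \<tau>" using \<tau> by (intro mult_right_mono) auto
  have t2': "\<tau>\<^sup>2 \<le> 1 / 4 * \<tau>" using t2 by (simp add: power2_eq_square)
  have young: "2 * a * s \<le> \<tau> / 6 * a\<^sup>2 + 6 / \<tau> * s\<^sup>2"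
  proof -
    have "0 \<le> (\<tau> * a - 6 * s)\<^sup>2 / (6 * \<tau>)" using \<tau> by simp
    also have "\<dots> = \<tau> / 6 * a\<^sup>2 + 6 / \<tau> * s\<^sup>2 - 2 * a * s"
      using \<tau> by (simp add: power2_eq_square field_simps)
    finally show ?thesis by simp
  qed
  have "(a + s)\<^sup>2 = a\<^sup>2 + 2 * a * s + s\<^sup>2" by (simp add: power2_sum)
  also have "\<dots> \<le> (1 + \<tau> / 6) * a\<^sup>2 + (1 + 6 / \<tau>) * s\<^sup>2" using young by (simp add: algebra_simps)
  also have "(1 + \<tau> / 6) * a\<^sup>2 \<le> (1 - \<tau> / 6) * E\<^sup>2"
  proof -
    have "(1 + \<tau> / 6) * (1 - \<tau> / 6) \<le> 1" by (simp add: algebra_simps)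
    then have "((1 + \<tau> / 6) * (1 - \<tau> / 6)) * ((1 - \<tau> / 6) * E\<^sup>2) \<le> 1 * ((1 - \<tau> / 6) * E\<^sup>2)"
      using \<tau> by (intro mult_right_mono) auto
    then show ?thesis by (simp add: a_def power2_eq_square mult_ac)
  qed
  finally have as: "(a + s)\<^sup>2 \<le> (1 - \<tau> / 6) * E\<^sup>2 + (1 + 6 / \<tau>) * s\<^sup>2" by simp
  have M: "(1 + \<tau> / 16) * (1 + \<tau> / 30)\<^sup>2 \<le> 1 + \<tau> / 7"
  proof -
    have "(1 + \<tau> / 30)\<^sup>2 = 1 + \<tau> / 15 + \<tau>\<^sup>2 / 900" by (simp add: power2_eq_square algebra_simps)
    also have "\<dots> \<le> 1 + \<tau> / 14" using t2' \<tau> by simp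
    finally have "(1 + \<tau> / 16) * (1 + \<tau> / 30)\<^sup>2 \<le> (1 + \<tau> / 16) * (1 + \<tau> / 14)"
      using \<tau> by (intro mult_left_mono) auto
    also have "\<dots> = 1 + 15 / 112 * \<tau> + \<tau> * \<tau> / 224" by (simp add: field_simps)
    also have "\<dots> \<le> 1 + \<tau> / 7" using t2 \<tau> by linarith
    finally show ?thesis .
  qed
  have "w' * E'\<^sup>2 \<le> (w * (1 + \<tau> / 16)) * E'\<^sup>2" using w(2) by (rule mult_right_mono) simp
  also have "\<dots> \<le> (w * (1 + \<tau> / 16)) * ((1 + \<tau> / 30) * (a + s))\<^sup>2"
    using E' E w \<tau> by (intro mult_left_mono power_mono) (auto simp: a_def)
  also have "\<dots> = w * ((1 + \<tau> / 16) * (1 + \<tau> / 30)\<^sup>2) * (a + s)\<^sup>2" by (simp add: power_mult_distrib)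
  also have "\<dots> \<le> w * (1 + \<tau> / 7) * ((1 - \<tau> / 6) * E\<^sup>2 + (1 + 6 / \<tau>) * s\<^sup>2)"
    using M as w \<tau> by (intro mult_mono mult_left_mono) auto
  also have "\<dots> = w * (((1 + \<tau> / 7) * (1 - \<tau> / 6)) * E\<^sup>2 + ((1 + \<tau> / 7) * (1 + 6 / \<tau>)) * s\<^sup>2)"
    by (simp only: distrib_left[of "1 + \<tau> / 7" "(1 - \<tau> / 6) * E\<^sup>2"] mult.assoc)
  also have "\<dots> \<le> w * ((1 - \<tau> / 42) * E\<^sup>2 + 7 / \<tau> * s\<^sup>2)"
  proof (intro mult_left_mono add_mono mult_right_mono)
    show "(1 + \<tau> / 7) * (1 - \<tau> / 6) \<le> 1 - \<tau> / 42" using \<tau> by (simp add: algebra_simps)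
    have "(1 + \<tau> / 7) * (\<tau> + 6) = 6 + 13 / 7 * \<tau> + \<tau> * \<tau> / 7" by (simp add: field_simps)
    also have "\<dots> \<le> 7" using t2 \<tau> by linarith
    finally have "(1 + \<tau> / 7) * (\<tau> + 6) \<le> 7" .
    then have "((1 + \<tau> / 7) * (\<tau> + 6)) / \<tau> \<le> 7 / \<tau>" using \<tau> by (intro divide_right_mono) auto
    moreover have "1 + 6 / \<tau> = (\<tau> + 6) / \<tau>" using \<tau> by (simp add: add_divide_distrib)
    ultimately show "(1 + \<tau> / 7) * (1 + 6 / \<tau>) \<le> 7 / \<tau>" by simp
  qed (use w in auto)
  finally show ?thesis .
qed

text \<open>
  A run of the algorithm for step sizes with constant product \<open>\<beta> = \<alpha>\<^sub>k \<lambda>\<^sub>k\<close>.  In the schedule of the theorem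
  the exponents \<open>1 / 3\<close> of \<open>\<alpha>\<^sub>k\<close> and \<open>\<lambda>\<^sub>k\<close> cancel, so the inner loops contract at a rate independent of \<open>k\<close>.
\<close>

locale penalty_run = dikin_model A b \<mu> f g lf0 lf1 lf2 lg0 lg1 lg2 \<rho>g yl \<eta> lam_\<eta> lam0 C
  for A :: "real^'p^'m" and b :: "real^'m" and \<mu> :: real
    and f g :: "real^'n \<Rightarrow> real^'p \<Rightarrow> real"
    and lf0 lf1 lf2 lg0 lg1 lg2 \<rho>g :: real
    and yl :: "real \<Rightarrow> real^'n \<Rightarrow> real^'p"
    and \<eta> lam_\<eta> lam0 :: real and C :: dikin_consts +
  fixes T :: nat and \<xi> \<beta> \<gamma> D :: real and \<alpha> lam :: "nat \<Rightarrow> real"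
    and x :: "nat \<Rightarrow> real^'n" and y z :: "nat \<Rightarrow> nat \<Rightarrow> real^'p"
  assumes T1: "1 \<le> T" and xi_pos: "0 < \<xi>" and alpha_pos: "0 < \<alpha> k"
    and lam_0: "lam 0 = lam0" and lam_mono: "lam k \<le> lam (Suc k)"
    and beta: "\<alpha> k * lam k = \<beta>"
    and gamma: "\<beta> \<le> \<gamma>" "\<gamma> \<le> 1 / (4 * l_psi1 C)" "\<gamma> \<le> 1 / (4 * real T * rho_psi C)"
    and alpha_L_F: "\<alpha> k * (2 * \<xi> * L_F C) \<le> 1"
    and lam_growth: "lam (Suc k) - lam k \<le> lam k * (real T * rho_psi C * \<beta> / 16)"
    and D: "D = lf0 / lam0 + 2 * lg0"
    and ratio_exact: "\<xi> / real T * (16 * l_star0 C * D) \<le> \<eta> * rho_psi C"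
    and ratio_proxy: "\<xi> / real T * (64 * l_lam0 C * D) \<le> \<eta> * rho_psi C"
    and ratio_abs: "\<xi> / real T * (l_psi1 C * (l_star0 C)\<^sup>2) \<le> c_abs * rho_psi C"
    and run: "algorithm_run A b \<mu> f g T \<xi> \<alpha> (\<lambda>_. \<gamma>) lam x y z"
    and warm_start: "z 0 0 \<in> dikin_nbhd A b \<eta> (y_star A b \<mu> g (x 0))"
      "y 0 0 \<in> dikin_nbhd A b \<eta> (yl lam0 (x 0))"
begin

text \<open>
  Up to a numerical factor, \<open>\<tau>\<close> is the contraction gained by a whole inner loop.
\<close>

definition \<tau> :: real where "\<tau> = real T * \<rho> * \<beta>"

lemma lam_ge: "lam0 \<le> lam k"
proof (induction k)
  case (Suc k)
  then show ?case using lam_mono[of k] by linarith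
qed (simp add: lam_0)

lemma lam_pos: "0 < lam k"
  using lam_ge[of k] lam0_pos by linarith

lemma beta_pos: "0 < \<beta>"
  using beta[of 0] alpha_pos[of 0] lam_pos[of 0] by (metis mult_pos_pos)

lemma T_pos: "0 < real T"
  using T1 by simp

lemma tau_pos: "0 < \<tau>"
  unfolding \<tau>_def using T_pos rho_pos beta_pos by simp

lemma tau_le: "\<tau> \<le> 1 / 4"
proof -
  have "\<beta> \<le> 1 / (4 * real T * \<rho>)" using gamma by linarith
  then show ?thesis unfolding \<tau>_def using T_pos rho_pos by (simp add: field_simps)
qed

lemma beta_L1: "\<beta> \<le> 1 / (4 * L1)"
  using gamma by linarith

text \<open>
  The penalised loop contracts with \<open>3 / 4 * \<alpha> * (\<lambda> \<rho> / 2) = 3 / 8 * \<beta> * \<rho>\<close>; the exact loop, with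
  \<open>3 / 4 * \<gamma> * \<rho>\<close> and \<open>\<gamma> \<ge> \<beta>\<close>, is at least as fast.
\<close>

lemma inner_rate: "sqrt (1 - 3 / 8 * \<beta> * \<rho>) ^ T \<le> 1 - \<tau> / 6" "1 - 3 / 8 * \<beta> * \<rho> \<ge> 0"
proof -
  have "\<beta> * \<rho> \<le> \<tau>"
    using T_pos T1 beta_pos rho_pos unfolding \<tau>_def
    by (simp add: mult_le_cancel_right1 mult.commute mult.left_commute)
  then have b: "\<beta> * \<rho> \<le> 1 / 4" using tau_le by linarith
  have b0: "0 \<le> \<beta> * \<rho>" using beta_pos rho_pos by simp
  show 0: "1 - 3 / 8 * \<beta> * \<rho> \<ge> 0" using b by simp
  define s where "s = 3 / 16 * (\<beta> * \<rho>)"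
  have "sqrt (1 - 3 / 8 * \<beta> * \<rho>) \<le> 1 - s"
  proof (rule real_le_lsqrt)
    show "0 \<le> 1 - s" using b by (simp add: s_def)
    have "(1 - s)\<^sup>2 = 1 - 2 * s + s\<^sup>2" by (simp add: power2_diff)
    moreover have "1 - 3 / 8 * \<beta> * \<rho> = 1 - 2 * s" by (simp add: s_def)
    ultimately show "1 - 3 / 8 * \<beta> * \<rho> \<le> (1 - s)\<^sup>2" using zero_le_power2[of s] by linarith
  qed
  then have "sqrt (1 - 3 / 8 * \<beta> * \<rho>) ^ T \<le> (1 - s) ^ T"
    using 0 by (intro power_mono) auto
  also have "\<dots> \<le> 1 - \<tau> / 6"
    using b b0 tau_pos tau_le by (intro geometric_contraction_le) (auto simp: s_def \<tau>_def)
  finally show "sqrt (1 - 3 / 8 * \<beta> * \<rho>) ^ T \<le> 1 - \<tau> / 6" .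
qed

text \<open>
  Contraction keeps the iterates within the radius \<open>\<eta> < 1\<close>, and the Dikin ellipsoid then keeps them in
  the interior, so the one-step estimate can be iterated.
\<close>

lemma inner_loop:
  fixes w :: "nat \<Rightarrow> real^'p"
  assumes c: "c \<in> I" and w0: "w 0 \<in> nbhd \<eta> c"
    and step: "\<And>t. t < T \<Longrightarrow> w t \<in> nbhd \<eta> c \<Longrightarrow>
        dn c (w (Suc t) - c) \<le> sqrt (1 - 3 / 8 * \<beta> * \<rho>) * dn c (w t - c)"
  shows "t \<le> T \<Longrightarrow> w t \<in> nbhd \<eta> c"
    and "dn c (w T - c) \<le> (1 - \<tau> / 6) * dn c (w 0 - c)"
proof -
  define r where "r = sqrt (1 - 3 / 8 * \<beta> * \<rho>)"
  have r: "0 \<le> r" "r \<le> 1" unfolding r_def using inner_rate(2) beta_pos rho_pos by auto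
  have e0: "0 \<le> dn c (w 0 - c)" by (rule dn_nonneg[OF c])
  have main: "w t \<in> nbhd \<eta> c \<and> dn c (w t - c) \<le> r ^ t * dn c (w 0 - c)" if "t \<le> T" for t
    using that
  proof (induction t)
    case (Suc t)
    then have IH: "w t \<in> nbhd \<eta> c" "dn c (w t - c) \<le> r ^ t * dn c (w 0 - c)" by auto
    have s: "dn c (w (Suc t) - c) \<le> r * dn c (w t - c)"
      unfolding r_def using Suc.prems IH by (intro step) auto
    also have "\<dots> \<le> 1 * dn c (w t - c)" using r dn_nonneg[OF c] by (intro mult_right_mono) auto
    finally have le: "dn c (w (Suc t) - c) \<le> \<eta>" using IH(1) by (simp add: nbhd_iff)
    then have "c + (w (Suc t) - c) \<in> I" using eta_half by (intro dikin_ellipsoid[OF c]) simp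
    then have "w (Suc t) \<in> nbhd \<eta> c" using le by (simp add: nbhd_iff)
    moreover have "dn c (w (Suc t) - c) \<le> r * (r ^ t * dn c (w 0 - c))"
      using s mult_left_mono[OF IH(2) r(1)] by linarith
    ultimately show ?case by (simp add: mult.assoc)
  qed (use w0 in simp)
  show "t \<le> T \<Longrightarrow> w t \<in> nbhd \<eta> c" using main by blast
  have "dn c (w T - c) \<le> r ^ T * dn c (w 0 - c)" using main by blast
  also have "\<dots> \<le> (1 - \<tau> / 6) * dn c (w 0 - c)"
    using inner_rate(1) e0 unfolding r_def by (rule mult_right_mono)
  finally show "dn c (w T - c) \<le> (1 - \<tau> / 6) * dn c (w 0 - c)" .
qed

text \<open>
  Moving the centre by \<open>s\<close> adds \<open>s\<close> to the error and changes the norm by a factor of at most \<open>1 / (1 - s)\<close>.  A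
  contraction by \<open>1 - \<tau> / 6\<close> outweighs both effects when \<open>s \<le> \<eta> \<tau> / 16\<close>.
\<close>

lemma recentre:
  assumes c: "c \<in> I" "c' \<in> I" and w: "w \<in> I"
    and s: "dn c (c' - c) \<le> s" "dn c (c' - c) \<le> \<eta> * \<tau> / 16"
  shows "dn c' (w - c') \<le> (1 + \<tau> / 30) * (dn c (w - c) + s)"
    and "dn c (w - c) \<le> (1 - \<tau> / 6) * \<eta> \<Longrightarrow> w \<in> nbhd \<eta> c'"
proof -
  have et: "\<eta> * \<tau> / 16 \<le> \<tau> / 32" using eta_half tau_pos by simp
  have d: "dn c (c' - c) \<le> \<tau> / 32" using s et by linarith
  have tri: "dn c (w - c') \<le> dn c (w - c) + dn c (c' - c)"
    using dn_triangle[OF c(1), of "w - c" "c - c'"] dn_minus_commute[OF c(1), of c c'] by simp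
  have fac: "1 / (1 - \<tau> / 32) \<le> 1 + \<tau> / 30"
  proof -
    have "\<tau> * \<tau> \<le> 1 / 4 * \<tau>" using tau_pos tau_le by (intro mult_right_mono) auto
    then have "1 \<le> (1 - \<tau> / 32) * (1 + \<tau> / 30)" using tau_pos by (simp add: algebra_simps)
    then show ?thesis using tau_le by (simp add: pos_divide_le_eq mult.commute)
  qed
  have gen: "dn c' (w - c') \<le> (1 + \<tau> / 30) * dn c (w - c')"
  proof -
    have "dn c' (w - c') \<le> dn c (w - c') * (1 / (1 - \<tau> / 32))"
      using dn_change_centre(1)[OF c d, of "w - c'"] tau_le by simp
    also have "\<dots> \<le> dn c (w - c') * (1 + \<tau> / 30)" using fac dn_nonneg[OF c(1)] by (rule mult_left_mono)
    finally show ?thesis by (simp add: mult.commute)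
  qed
  show "dn c' (w - c') \<le> (1 + \<tau> / 30) * (dn c (w - c) + s)"
    using gen mult_left_mono[of "dn c (w - c')" "dn c (w - c) + s" "1 + \<tau> / 30"] tri s tau_pos by linarith
  assume w': "dn c (w - c) \<le> (1 - \<tau> / 6) * \<eta>"
  have "dn c (w - c') \<le> (1 - \<tau> / 6) * \<eta> + \<eta> * \<tau> / 16" using tri w' s by linarith
  then have "dn c' (w - c') \<le> (1 + \<tau> / 30) * ((1 - \<tau> / 6) * \<eta> + \<eta> * \<tau> / 16)"
    using gen mult_left_mono[of "dn c (w - c')" "(1 - \<tau> / 6) * \<eta> + \<eta> * \<tau> / 16" "1 + \<tau> / 30"] tau_pos by linarith
  also have "\<dots> = \<eta> * ((1 + \<tau> / 30) * (1 - 5 / 48 * \<tau>))" by (simp add: algebra_simps)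
  also have "\<dots> \<le> \<eta> * 1"
  proof (rule mult_left_mono)
    have "0 \<le> \<tau> * \<tau>" by simp
    then show "(1 + \<tau> / 30) * (1 - 5 / 48 * \<tau>) \<le> 1" using tau_pos by (simp add: algebra_simps)
  qed (use eta_pos in simp)
  finally show "w \<in> nbhd \<eta> c'" using w by (simp add: nbhd_iff)
qed

abbreviation "F \<equiv> F_barrier A b \<mu> f g"
abbreviation "q k \<equiv> outer_direction f g (lam k) (x k) (y (Suc k) 0) (z (Suc k) 0)"

lemma run_z: "t < T \<Longrightarrow> z k (Suc t) = z k t - \<gamma> *\<^sub>R (matrix_inv (H (z k 0)) *v grad_y \<psi> (x k) (z k t))"
  and run_y: "t < T \<Longrightarrow> y k (Suc t) = y k t - \<alpha> k *\<^sub>R (matrix_inv (H (y k 0)) *v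
          (grad_y f (x k) (y k t) + lam k *\<^sub>R grad_y \<psi> (x k) (y k t)))"
  and run_next: "z (Suc k) 0 = z k T" "y (Suc k) 0 = y k T"
  and run_x: "x (Suc k) = x k - (\<xi> * \<alpha> k) *\<^sub>R q k"
  using run by (auto simp: algorithm_run_def)

lemma lf0_nonneg: "0 \<le> lf0" and lg0_nonneg: "0 \<le> lg0"
  using grad_x_f_le grad_x_g_le norm_ge_zero order_trans by blast+

lemma x_step: "norm (x (Suc k) - x k) = \<xi> * \<alpha> k * norm (q k)"
  and x_step_le: "norm (x (Suc k) - x k) \<le> \<xi> * \<beta> * D"
proof -
  show eq: "norm (x (Suc k) - x k) = \<xi> * \<alpha> k * norm (q k)"
    using xi_pos alpha_pos[of k] by (simp add: run_x)
  define d where "d = grad_x g (x k) (y (Suc k) 0) - grad_x g (x k) (z (Suc k) 0)"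
  have d: "norm d \<le> 2 * lg0"
    unfolding d_def using norm_triangle_ineq4 grad_x_g_le by (smt (verit))
  have "norm (q k) \<le> norm (grad_x f (x k) (y (Suc k) 0)) + norm (lam k *\<^sub>R d)"
    unfolding outer_direction_def d_def by (rule norm_triangle_ineq)
  also have "\<dots> \<le> lf0 + lam k * (2 * lg0)"
    using grad_x_f_le lam_pos[of k] mult_left_mono[OF d, of "lam k"] by (intro add_mono) auto
  also have "lf0 \<le> lam k * (lf0 / lam0)"
    using mult_right_mono[OF lam_ge[of k] lf0_nonneg] lam0_pos by (simp add: field_simps)
  finally have "norm (q k) \<le> lam k * D" unfolding D by (simp add: algebra_simps)
  then have "\<xi> * \<alpha> k * norm (q k) \<le> \<xi> * \<alpha> k * (lam k * D)"
    using xi_pos alpha_pos[of k] by (intro mult_left_mono) auto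
  also have "\<dots> = \<xi> * \<beta> * D" using beta[of k] by (metis mult.assoc)
  finally show "norm (x (Suc k) - x k) \<le> \<xi> * \<beta> * D" using eq by simp
qed

lemma exact_shift_le: "l_star0 C * norm (x (Suc k) - x k) \<le> \<eta> * \<tau> / 16"
proof -
  have "l_star0 C * norm (x (Suc k) - x k) \<le> l_star0 C * (\<xi> * \<beta> * D)"
    using x_step_le l_star0_ge by (intro mult_left_mono) auto
  also have "\<dots> = (\<xi> / real T * (16 * l_star0 C * D)) * (real T * \<beta> / 16)"
    using T_pos by simp
  also have "\<dots> \<le> (\<eta> * \<rho>) * (real T * \<beta> / 16)"
    using ratio_exact T_pos beta_pos by (intro mult_right_mono) auto
  finally show ?thesis by (simp add: \<tau>_def mult_ac)
qed

lemma proxy_shift_le: "l_lam0 C * norm (x (Suc k) - x k) \<le> \<eta> * \<tau> / 64"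
proof -
  have "l_lam0 C * norm (x (Suc k) - x k) \<le> l_lam0 C * (\<xi> * \<beta> * D)"
    using x_step_le l_lam0_nonneg by (intro mult_left_mono) auto
  also have "\<dots> = (\<xi> / real T * (64 * l_lam0 C * D)) * (real T * \<beta> / 64)"
    using T_pos by simp
  also have "\<dots> \<le> (\<eta> * \<rho>) * (real T * \<beta> / 64)"
    using ratio_proxy T_pos beta_pos by (intro mult_right_mono) auto
  finally show ?thesis by (simp add: \<tau>_def mult_ac)
qed

lemma eta_tau_le: "\<eta> * \<tau> \<le> \<eta> / 4"
  using tau_le eta_pos mult_left_mono[of \<tau> "1 / 4" \<eta>] by simp

lemma inverse_lam_diff: "\<bar>1 / lam (Suc k) - 1 / lam k\<bar> \<le> (lam (Suc k) - lam k) / (lam k)\<^sup>2"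
proof -
  have "\<bar>1 / lam (Suc k) - 1 / lam k\<bar> = (lam (Suc k) - lam k) / (lam k * lam (Suc k))"
    using lam_pos[of k] lam_pos[of "Suc k"] lam_mono[of k] by (simp add: field_simps abs_divide)
  also have "\<dots> \<le> (lam (Suc k) - lam k) / (lam k * lam k)"
    using lam_pos[of k] lam_mono[of k] by (intro divide_left_mono mult_left_mono mult_pos_pos) auto
  finally show ?thesis by (simp add: power2_eq_square)
qed

lemma exact_centre_shift:
  "dn (ys (x k)) (ys (x (Suc k)) - ys (x k)) \<le> \<eta> * \<tau> / 16"
  using ys_lipschitz exact_shift_le order_trans by blast

lemma proxy_centre_shift:
  "dn (yl (lam k) (x k)) (yl (lam (Suc k)) (x (Suc k)) - yl (lam k) (x k)) \<le> \<eta> * \<tau> / 16"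
proof -
  have "E * \<bar>1 / lam (Suc k) - 1 / lam k\<bar> \<le> E * (lam k * (\<tau> / 16) / (lam k)\<^sup>2)"
  proof (rule mult_left_mono[OF _ E_nonneg], rule order_trans[OF inverse_lam_diff])
    show "(lam (Suc k) - lam k) / (lam k)\<^sup>2 \<le> lam k * (\<tau> / 16) / (lam k)\<^sup>2"
      using lam_growth[of k] by (intro divide_right_mono) (auto simp: \<tau>_def)
  qed
  also have "\<dots> = (E / lam k) * (\<tau> / 16)" using lam_pos[of k] by (simp add: power2_eq_square)
  also have "\<dots> \<le> (\<eta> / 4) * (\<tau> / 16)"
    using E_le[OF lam_ge[of k]] tau_pos by (intro mult_right_mono) auto
  finally have "E * \<bar>1 / lam (Suc k) - 1 / lam k\<bar> \<le> \<eta> * \<tau> / 64" by simp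
  then show ?thesis
    using yl_lipschitz[OF lam_ge[of k] lam_ge[of "Suc k"], of "x k" "x (Suc k)"] proxy_shift_le[of k]
      mult_pos_pos[OF eta_pos tau_pos] by (simp add: E_def)
qed

lemma exact_inner_loop:
  assumes "z k 0 \<in> nbhd \<eta> (ys (x k))"
  shows "t \<le> T \<Longrightarrow> z k t \<in> nbhd \<eta> (ys (x k))"
    and "dn (ys (x k)) (z k T - ys (x k)) \<le> (1 - \<tau> / 6) * dn (ys (x k)) (z k 0 - ys (x k))"
proof -
  have step: "dn (ys (x k)) (z k (Suc t) - ys (x k)) \<le> sqrt (1 - 3 / 8 * \<beta> * \<rho>) * dn (ys (x k)) (z k t - ys (x k))"
    if t: "t < T" "z k t \<in> nbhd \<eta> (ys (x k))" for t
  proof -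
    have "dn (ys (x k)) (z k (Suc t) - ys (x k)) \<le> sqrt (1 - 3 / 4 * \<gamma> * \<rho>) * dn (ys (x k)) (z k t - ys (x k))"
      unfolding run_z[OF t(1)] using gamma beta_pos by (intro exact_inner_step assms t) auto
    also have "\<dots> \<le> sqrt (1 - 3 / 8 * \<beta> * \<rho>) * dn (ys (x k)) (z k t - ys (x k))"
    proof (intro mult_right_mono real_sqrt_le_mono dn_nonneg ys_in_I)
      have "\<beta> * \<rho> \<le> \<gamma> * \<rho>" "0 \<le> \<beta> * \<rho>" using gamma(1) rho_pos beta_pos by auto
      then show "1 - 3 / 4 * \<gamma> * \<rho> \<le> 1 - 3 / 8 * \<beta> * \<rho>" by simp
    qed
    finally show ?thesis .
  qed
  show "t \<le> T \<Longrightarrow> z k t \<in> nbhd \<eta> (ys (x k))"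
    "dn (ys (x k)) (z k T - ys (x k)) \<le> (1 - \<tau> / 6) * dn (ys (x k)) (z k 0 - ys (x k))"
    using inner_loop[of "ys (x k)" "z k", OF ys_in_I assms step] by auto
qed

lemma proxy_inner_loop:
  assumes "y k 0 \<in> nbhd \<eta> (yl (lam k) (x k))"
  shows "t \<le> T \<Longrightarrow> y k t \<in> nbhd \<eta> (yl (lam k) (x k))"
    and "dn (yl (lam k) (x k)) (y k T - yl (lam k) (x k))
      \<le> (1 - \<tau> / 6) * dn (yl (lam k) (x k)) (y k 0 - yl (lam k) (x k))"
proof -
  have step: "dn (yl (lam k) (x k)) (y k (Suc t) - yl (lam k) (x k))
      \<le> sqrt (1 - 3 / 8 * \<beta> * \<rho>) * dn (yl (lam k) (x k)) (y k t - yl (lam k) (x k))"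
    if t: "t < T" "y k t \<in> nbhd \<eta> (yl (lam k) (x k))" for t
    unfolding run_y[OF t(1)] beta[of k, symmetric]
    using alpha_pos[of k] beta_L1 beta[of k]
    by (intro proxy_inner_step[OF lam_ge] assms t) auto
  show "t \<le> T \<Longrightarrow> y k t \<in> nbhd \<eta> (yl (lam k) (x k))"
    "dn (yl (lam k) (x k)) (y k T - yl (lam k) (x k))
      \<le> (1 - \<tau> / 6) * dn (yl (lam k) (x k)) (y k 0 - yl (lam k) (x k))"
    using inner_loop[of "yl (lam k) (x k)" "y k", OF yl_in_I[OF lam_pos] assms step] by auto
qed

lemma warm_starts_invariant:
  "z k 0 \<in> nbhd \<eta> (ys (x k)) \<and> y k 0 \<in> nbhd \<eta> (yl (lam k) (x k))"
proof (induction k)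
  case 0 then show ?case using warm_start lam_0 by simp
next
  case (Suc k)
  then have z: "z k 0 \<in> nbhd \<eta> (ys (x k))" and y: "y k 0 \<in> nbhd \<eta> (yl (lam k) (x k))" by auto
  have fac: "0 \<le> 1 - \<tau> / 6" using tau_le by simp
  have "z k T \<in> nbhd \<eta> (ys (x (Suc k)))"
  proof (rule recentre(2)[OF ys_in_I ys_in_I _ order_refl exact_centre_shift])
    show "z k T \<in> I" using exact_inner_loop(1)[OF z order_refl] by (simp add: nbhd_iff)
    show "dn (ys (x k)) (z k T - ys (x k)) \<le> (1 - \<tau> / 6) * \<eta>"
      using exact_inner_loop(2)[OF z] mult_left_mono[OF _ fac, of "dn (ys (x k)) (z k 0 - ys (x k))" \<eta>] z
      by (simp add: nbhd_iff)
  qed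
  moreover have "y k T \<in> nbhd \<eta> (yl (lam (Suc k)) (x (Suc k)))"
  proof (rule recentre(2)[OF yl_in_I[OF lam_pos] yl_in_I[OF lam_pos] _ order_refl proxy_centre_shift])
    show "y k T \<in> I" using proxy_inner_loop(1)[OF y order_refl] by (simp add: nbhd_iff)
    show "dn (yl (lam k) (x k)) (y k T - yl (lam k) (x k)) \<le> (1 - \<tau> / 6) * \<eta>"
      using proxy_inner_loop(2)[OF y] mult_left_mono[OF _ fac, of "dn (yl (lam k) (x k)) (y k 0 - yl (lam k) (x k))" \<eta>] y
      by (simp add: nbhd_iff)
  qed
  ultimately show ?case by (simp add: run_next)
qed

section \<open>Descent of the Lyapunov function\<close>

definition Ez :: "nat \<Rightarrow> real" where "Ez k = dn (ys (x k)) (z k 0 - ys (x k))"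
definition Ey :: "nat \<Rightarrow> real" where "Ey k = dn (yl (lam k) (x k)) (y k 0 - yl (lam k) (x k))"

lemma Ez_nonneg: "0 \<le> Ez k" and Ey_nonneg: "0 \<le> Ey k"
  unfolding Ez_def Ey_def using dn_nonneg ys_in_I yl_in_I[OF lam_pos] by auto

lemma Ez_step: "Ez (Suc k) \<le> (1 + \<tau> / 30) * ((1 - \<tau> / 6) * Ez k + l_star0 C * norm (x (Suc k) - x k))"
proof -
  note z = conjunct1[OF warm_starts_invariant[of k]]
  have "Ez (Suc k) \<le> (1 + \<tau> / 30) * (dn (ys (x k)) (z k T - ys (x k)) + l_star0 C * norm (x (Suc k) - x k))"
    unfolding Ez_def run_next
    by (rule recentre(1)[OF ys_in_I ys_in_I nbhd_I[OF exact_inner_loop(1)[OF z order_refl]]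
          ys_lipschitz exact_centre_shift])
  also have "\<dots> \<le> (1 + \<tau> / 30) * ((1 - \<tau> / 6) * Ez k + l_star0 C * norm (x (Suc k) - x k))"
    unfolding Ez_def using exact_inner_loop(2)[OF z] tau_pos by (intro mult_left_mono add_right_mono) auto
  finally show ?thesis .
qed

lemma Ey_step:
  assumes "dn (yl (lam k) (x k)) (yl (lam (Suc k)) (x (Suc k)) - yl (lam k) (x k)) \<le> s"
  shows "Ey (Suc k) \<le> (1 + \<tau> / 30) * ((1 - \<tau> / 6) * Ey k + s)"
proof -
  note y = conjunct2[OF warm_starts_invariant[of k]]
  have "Ey (Suc k) \<le> (1 + \<tau> / 30) * (dn (yl (lam k) (x k)) (y k T - yl (lam k) (x k)) + s)"
    unfolding Ey_def run_next
    by (rule recentre(1)[OF yl_in_I[OF lam_pos] yl_in_I[OF lam_pos]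
          nbhd_I[OF proxy_inner_loop(1)[OF y order_refl]] assms proxy_centre_shift])
  also have "\<dots> \<le> (1 + \<tau> / 30) * ((1 - \<tau> / 6) * Ey k + s)"
    unfolding Ey_def using proxy_inner_loop(2)[OF y] tau_pos by (intro mult_left_mono add_right_mono) auto
  finally show ?thesis .
qed

text \<open>
  Replace the inner iterates by their targets.  The mixed Hessian bounds turn tracking errors into
  errors of the direction; the factor \<open>3 / 2\<close> arises because the part of \<open>f\<close> costs at most half of the
  part of \<open>\<lambda> g\<close>.
\<close>

lemma direction_error:
  "norm (q k - gradient F (x k)) \<le> 3 / 2 * lam k * L1 * Ey k + lam k * L1 * Ez k
      + norm (outer_direction f g (lam k) (x k) (yl (lam k) (x k)) (ys (x k)) - gradient F (x k))"
proof -
  define p u Y' Z' where "p = yl (lam k) (x k)" and "u = ys (x k)" and "Y' = y k T" and "Z' = z k T"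
  have mono: "nbhd \<eta> c \<subseteq> nbhd (2 * \<eta>) c" for c
    using nbhd_mono[of _ \<eta> c "2 * \<eta>"] eta_pos by auto
  have Y': "Y' \<in> nbhd (2 * \<eta>) p" and Z': "Z' \<in> nbhd (2 * \<eta>) u"
    unfolding Y'_def Z'_def p_def u_def
    using proxy_inner_loop(1)[of k T] exact_inner_loop(1)[of k T] warm_starts_invariant[of k] mono by blast+
  note pc = yl_centre[OF lam_ge[of k], of "x k", folded p_def] and uc = ys_centre[of "x k", folded u_def]
  have fac: "(1 - \<tau> / 6) * e \<le> e" if "0 \<le> e" for e using that tau_pos by (simp add: mult_left_le_one_le algebra_simps)
  have EY: "dn p (Y' - p) \<le> Ey k"
    using proxy_inner_loop(2)[of k] warm_starts_invariant[of k] fac[OF Ey_nonneg[of k]]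
    unfolding p_def Y'_def Ey_def by linarith
  have EZ: "dn u (Z' - u) \<le> Ez k"
    using exact_inner_loop(2)[of k] warm_starts_invariant[of k] fac[OF Ez_nonneg[of k]]
    unfolding u_def Z'_def Ez_def by linarith
  have L1: "0 \<le> L1" using L1_pos by simp
  have pI: "p \<in> I" and uI: "u \<in> I" using centre_in_I pc uc by auto
  have n1: "norm (grad_x f (x k) Y' - grad_x f (x k) p) \<le> l_f1 C * Ey k"
  proof (rule order_trans[OF norm_le_of_inner_le])
    show "(grad_x f (x k) Y' - grad_x f (x k) p) \<bullet> v \<le> (l_f1 C * dn p (Y' - p)) * norm v" for v
      using grad_x_f_diff_le[OF pc Y', of v] by (simp add: mult_ac)
  qed (use EY l_f1_nonneg dn_nonneg[OF pI] in \<open>auto intro: mult_left_mono\<close>)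
  have n2: "norm (grad_x g (x k) Y' - grad_x g (x k) p) \<le> L1 * Ey k"
  proof (rule order_trans[OF norm_le_of_inner_le])
    show "(grad_x g (x k) Y' - grad_x g (x k) p) \<bullet> v \<le> (L1 * dn p (Y' - p)) * norm v" for v
      using grad_x_g_diff_le[OF pc Y', of v] by (simp add: mult_ac)
  qed (use EY L1 dn_nonneg[OF pI] in \<open>auto intro: mult_left_mono\<close>)
  have n3: "norm (grad_x g (x k) Z' - grad_x g (x k) u) \<le> L1 * Ez k"
  proof (rule order_trans[OF norm_le_of_inner_le])
    show "(grad_x g (x k) Z' - grad_x g (x k) u) \<bullet> v \<le> (L1 * dn u (Z' - u)) * norm v" for v
      using grad_x_g_diff_le[OF uc Z', of v] by (simp add: mult_ac)
  qed (use EZ L1 dn_nonneg[OF uI] in \<open>auto intro: mult_left_mono\<close>)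
  have f1: "l_f1 C * Ey k \<le> lam k * L1 / 2 * Ey k"
  proof (rule mult_right_mono[OF _ Ey_nonneg])
    have "lam k * \<rho> \<le> lam k * L1" using rho_le_L1 lam_pos[of k] by simp
    then show "l_f1 C \<le> lam k * L1 / 2" using l_f1_le[OF lam_ge[of k]] by linarith
  qed
  define r where "r = outer_direction f g (lam k) (x k) p u - gradient F (x k)"
  have "q k - gradient F (x k) = (grad_x f (x k) Y' - grad_x f (x k) p)
      + lam k *\<^sub>R (grad_x g (x k) Y' - grad_x g (x k) p) - lam k *\<^sub>R (grad_x g (x k) Z' - grad_x g (x k) u) + r"
    by (simp add: run_next Y'_def[symmetric] Z'_def[symmetric] r_def outer_direction_def algebra_simps)
  then have "norm (q k - gradient F (x k)) \<le> norm (grad_x f (x k) Y' - grad_x f (x k) p)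
      + norm (lam k *\<^sub>R (grad_x g (x k) Y' - grad_x g (x k) p))
      + norm (lam k *\<^sub>R (grad_x g (x k) Z' - grad_x g (x k) u)) + norm r"
    by (smt (verit) norm_triangle_ineq norm_triangle_ineq4)
  also have "\<dots> \<le> lam k * L1 / 2 * Ey k + lam k * (L1 * Ey k) + lam k * (L1 * Ez k) + norm r"
    unfolding norm_scaleR abs_of_pos[OF lam_pos]
    using n1 f1 mult_left_mono[OF n2, of "lam k"] mult_left_mono[OF n3, of "lam k"] lam_pos[of k] by linarith
  finally show ?thesis unfolding r_def p_def u_def by (simp add: algebra_simps)
qed

lemma descent_lemma:
  "F (u + s) \<le> F u + s \<bullet> gradient F u + L_F C / 2 * (norm s)\<^sup>2"
proof -
  define \<phi> where "\<phi> t = F (u + t *\<^sub>R s) - t * (s \<bullet> gradient F u) - L_F C / 2 * (norm s)\<^sup>2 * t\<^sup>2" for t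
  have d: "(\<phi> has_real_derivative s \<bullet> gradient F (u + t *\<^sub>R s) - s \<bullet> gradient F u - L_F C * (norm s)\<^sup>2 * t) (at t)" for t
    unfolding \<phi>_def by (rule derivative_eq_intros GDERIV_directional GDERIV_F refl | simp)+
  have "\<phi> 1 \<le> \<phi> 0"
  proof (rule DERIV_nonpos_imp_nonincreasing[of 0 1])
    fix t :: real assume t: "0 \<le> t" "t \<le> 1"
    have "s \<bullet> (gradient F (u + t *\<^sub>R s) - gradient F u) \<le> norm s * norm (gradient F (u + t *\<^sub>R s) - gradient F u)"
      by (rule norm_cauchy_schwarz)
    also have "\<dots> \<le> norm s * (L_F C * norm (t *\<^sub>R s))"
      using grad_F_lipschitz[of "u + t *\<^sub>R s" u] by (intro mult_left_mono) auto
    finally have "s \<bullet> gradient F (u + t *\<^sub>R s) - s \<bullet> gradient F u - L_F C * (norm s)\<^sup>2 * t \<le> 0"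
      using t by (simp add: inner_diff_right power2_eq_square mult_ac)
    then show "\<exists>d. (\<phi> has_real_derivative d) (at t) \<and> d \<le> 0" using d by blast
  qed simp
  then show ?thesis by (simp add: \<phi>_def)
qed

text \<open>
  This weight makes the decrease \<open>\<lambda> \<tau> / 42\<close> of the weighted squared errors equal to their contribution
  \<open>7 / 2 * \<xi> \<beta> \<lambda> L1\<^sup>2\<close> to the inexact descent of \<open>F\<close>; note \<open>147 = 42 * 7 / 2\<close>.
\<close>

definition weight :: real where "weight = 147 * (\<xi> / real T) * L1\<^sup>2 / \<rho>"

definition V :: "nat \<Rightarrow> real" where
  "V k = F (x k) + weight * (lam k * ((Ez k)\<^sup>2 + (Ey k)\<^sup>2))"

lemma weight_pos: "0 < weight"
  unfolding weight_def using xi_pos T_pos L1_pos rho_pos by simp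

text \<open>
  Writing the inner product of direction and gradient by polarisation keeps a multiple of the squared
  direction.  The second-order term consumes only half of it under the step-size bound; the motion of
  the targets is charged to the rest.
\<close>

lemma F_step:
  assumes bias: "norm (outer_direction f g (lam k) (x k) (yl (lam k) (x k)) (ys (x k)) - gradient F (x k)) \<le> B / lam k"
  shows "F (x (Suc k)) \<le> F (x k) - \<xi> * \<alpha> k / 2 * (norm (gradient F (x k)))\<^sup>2 - \<xi> * \<alpha> k / 4 * (norm (q k))\<^sup>2
      + weight * (lam k * (\<tau> / 42 * ((Ez k)\<^sup>2 + (Ey k)\<^sup>2))) + 3 / 2 * B\<^sup>2 * \<xi> * (\<alpha> k / (lam k)\<^sup>2)"
proof -
  define G Q where "G = gradient F (x k)" and "Q = q k"
  define a where "a = \<xi> * \<alpha> k"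
  have a: "0 < a" unfolding a_def using xi_pos alpha_pos by simp
  have x': "x (Suc k) = x k + - a *\<^sub>R Q" by (simp add: run_x a_def Q_def)
  have "F (x (Suc k)) \<le> F (x k) + (- a *\<^sub>R Q) \<bullet> G + L_F C / 2 * (norm (- a *\<^sub>R Q))\<^sup>2"
    unfolding x' G_def by (rule descent_lemma)
  also have "\<dots> = F (x k) - a * (Q \<bullet> G) + (a * L_F C) * (a / 2 * (norm Q)\<^sup>2)"
    by (simp add: power_mult_distrib power2_eq_square)
  also have "\<dots> \<le> F (x k) - a * (Q \<bullet> G) + 1 / 2 * (a / 2 * (norm Q)\<^sup>2)"
  proof (intro add_left_mono mult_right_mono)
    show "a * L_F C \<le> 1 / 2" using alpha_L_F[of k] by (simp add: a_def mult_ac)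
  qed (use a in simp)
  also have "Q \<bullet> G = ((norm G)\<^sup>2 + (norm Q)\<^sup>2 - (norm (Q - G))\<^sup>2) / 2"
    by (simp add: power2_norm_eq_inner inner_diff_left inner_diff_right inner_commute)
  finally have 1: "F (x (Suc k)) \<le> F (x k) - a / 2 * (norm G)\<^sup>2 - a / 4 * (norm Q)\<^sup>2 + a / 2 * (norm (Q - G))\<^sup>2"
    by (simp add: algebra_simps add_divide_distrib diff_divide_distrib)
  have 2: "(norm (Q - G))\<^sup>2 \<le> 7 * ((lam k * L1)\<^sup>2 * ((Ez k)\<^sup>2 + (Ey k)\<^sup>2)) + 3 * (B / lam k)\<^sup>2"
  proof -
    define u v w where "u = lam k * L1 * Ey k" and "v = lam k * L1 * Ez k" and "w = B / lam k"
    have le: "norm (Q - G) \<le> 3 / 2 * u + v + w"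
      using direction_error[of k] bias unfolding Q_def G_def u_def v_def w_def by (simp add: mult_ac)
    have "(norm (Q - G))\<^sup>2 \<le> (3 / 2 * u + v + w)\<^sup>2" using le by (rule power_mono) simp
    also have "\<dots> \<le> 3 * ((3 / 2 * u)\<^sup>2 + v\<^sup>2 + w\<^sup>2)"
    proof -
      \<comment> \<open>Lagrange's identity for the Cauchy-Schwarz inequality\<close>
      have "3 * (p\<^sup>2 + v\<^sup>2 + w\<^sup>2) - (p + v + w)\<^sup>2 = (p - v)\<^sup>2 + (v - w)\<^sup>2 + (p - w)\<^sup>2" for p :: real
        by (simp add: power2_eq_square algebra_simps)
      then show ?thesis by (smt (verit) zero_le_power2)
    qed
    also have "\<dots> \<le> 7 * (v\<^sup>2 + u\<^sup>2) + 3 * w\<^sup>2" by (simp add: power2_eq_square)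
    finally show ?thesis unfolding u_def v_def w_def by (simp add: power_mult_distrib algebra_simps)
  qed
  have 3: "a / 2 * (7 * ((lam k * L1)\<^sup>2 * S)) = weight * (lam k * (\<tau> / 42 * S))" for S
  proof -
    have "a * lam k = \<xi> * \<beta>" unfolding a_def using beta[of k] by (simp add: mult.assoc)
    then have "a / 2 * (7 * ((lam k * L1)\<^sup>2 * S)) = 7 / 2 * (\<xi> * \<beta>) * lam k * L1\<^sup>2 * S"
      by (simp add: power2_eq_square mult_ac)
    also have "\<dots> = weight * (lam k * (\<tau> / 42 * S))"
      using rho_pos T_pos by (simp add: weight_def \<tau>_def)
    finally show ?thesis .
  qed
  have "a / 2 * (norm (Q - G))\<^sup>2 \<le> a / 2 * (7 * ((lam k * L1)\<^sup>2 * ((Ez k)\<^sup>2 + (Ey k)\<^sup>2)) + 3 * (B / lam k)\<^sup>2)"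
    using 2 a by (intro mult_left_mono) auto
  also have "\<dots> = weight * (lam k * (\<tau> / 42 * ((Ez k)\<^sup>2 + (Ey k)\<^sup>2))) + 3 / 2 * B\<^sup>2 * \<xi> * (\<alpha> k / (lam k)\<^sup>2)"
    unfolding distrib_left[of "a / 2"] 3 by (simp add: a_def power_divide)
  finally show ?thesis using 1 unfolding G_def Q_def a_def by linarith
qed

text \<open>
  Apart from the effect of the changing multiplier, both targets move by at most a multiple of
  \<open>l_star0\<close> times the outer step, once \<open>\<lambda>\<close> is large.
  With the chosen weight, the resulting multiple of the squared direction is of order \<open>c_abs\<^sup>2\<close> and is
  paid for by the descent of \<open>F\<close>.
\<close>

lemma drift_absorbed:
  "weight * (lam k * (7 / \<tau> * (33 * (l_star0 C)\<^sup>2 * (\<xi> * \<alpha> k * r)\<^sup>2))) \<le> \<xi> * \<alpha> k / 4 * r\<^sup>2"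
proof -
  define \<kappa> where "\<kappa> = \<xi> / real T * (L1 * l_star0 C) / \<rho>"
  have \<kappa>0: "0 \<le> \<kappa>" unfolding \<kappa>_def using xi_pos T_pos L1_pos l_star0_ge rho_pos by simp
  have \<kappa>: "\<kappa> \<le> c_abs"
  proof -
    have "l_star0 C \<le> (l_star0 C)\<^sup>2" using l_star0_ge by (simp add: power2_eq_square)
    then have "\<xi> / real T * (L1 * l_star0 C) \<le> \<xi> / real T * (L1 * (l_star0 C)\<^sup>2)"
      using xi_pos T_pos L1_pos by (intro mult_left_mono) auto
    then show ?thesis using ratio_abs rho_pos unfolding \<kappa>_def by (subst pos_divide_le_eq) auto
  qed
  have "lam k * (\<xi> * \<alpha> k)\<^sup>2 / \<tau> = \<xi> / (real T * \<rho>) * (\<xi> * \<alpha> k)"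
  proof -
    have "\<tau> = real T * \<rho> * (\<alpha> k * lam k)" by (simp add: \<tau>_def beta)
    then show ?thesis using alpha_pos[of k] lam_pos[of k] T_pos rho_pos
      by (simp add: power2_eq_square field_simps)
  qed
  note eq = this
  have "weight * (lam k * (7 / \<tau> * (33 * (l_star0 C)\<^sup>2 * (\<xi> * \<alpha> k * r)\<^sup>2)))
      = weight * 231 * (l_star0 C)\<^sup>2 * r\<^sup>2 * (lam k * (\<xi> * \<alpha> k)\<^sup>2 / \<tau>)"
    by (simp add: power_mult_distrib)
  also have "\<dots> = weight * 231 * (l_star0 C)\<^sup>2 * r\<^sup>2 * (\<xi> / (real T * \<rho>) * (\<xi> * \<alpha> k))"
    unfolding eq ..
  \<comment> \<open>\<open>33957 = 147 * 7 * 33\<close>\<close>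
  also have "\<dots> = 33957 * \<kappa>\<^sup>2 * (\<xi> * \<alpha> k * r\<^sup>2)"
    by (simp add: weight_def \<kappa>_def power2_eq_square)
  also have "\<dots> \<le> 1 / 4 * (\<xi> * \<alpha> k * r\<^sup>2)"
  proof (rule mult_right_mono)
    have "\<kappa>\<^sup>2 \<le> c_abs\<^sup>2" using \<kappa> \<kappa>0 by (rule power_mono)
    also have "c_abs\<^sup>2 \<le> 1 / 4 / 33957" by (simp add: c_abs_def power_divide)
    finally show "33957 * \<kappa>\<^sup>2 \<le> 1 / 4" by simp
    show "0 \<le> \<xi> * \<alpha> k * r\<^sup>2" using xi_pos alpha_pos[of k] by simp
  qed
  finally show ?thesis by simp
qed

text \<open>
  The remaining errors are the penalty bias, of order \<open>\<alpha> / \<lambda>\<^sup>2\<close>, and the motion of the proxy caused by the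
  change of the multiplier.
\<close>

lemma lyapunov_descent:
  "\<exists>K\<ge>0. \<exists>\<Lambda>. \<forall>k. \<Lambda> \<le> lam k \<longrightarrow>
     V (Suc k) \<le> V k - \<xi> * \<alpha> k / 2 * (norm (gradient F (x k)))\<^sup>2
       + K * (\<alpha> k / (lam k)\<^sup>2 + ((lam (Suc k) - lam k) / lam k)\<^sup>2 / lam k)"
proof -
  obtain B where B: "0 \<le> B" "\<And>x lam. lam0 \<le> lam \<Longrightarrow>
      norm (outer_direction f g lam x (yl lam x) (ys x) - gradient F x) \<le> B / lam"
    using proxy_bias by blast
  obtain B' where B': "0 \<le> B'" "\<And>x x' lam lam'. lam0 \<le> lam \<Longrightarrow> lam0 \<le> lam' \<Longrightarrow>
      l_star0 C * norm (x' - x) \<le> \<eta> / 16 \<Longrightarrow> l_lam0 C * norm (x' - x) \<le> \<eta> / 16 \<Longrightarrow>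
      dn (yl lam x) (yl lam' x' - yl lam x)
       \<le> 2 * E * \<bar>1 / lam' - 1 / lam\<bar> + 2 * (l_star0 C + B' / lam) * norm (x' - x)"
    using proxy_shift by blast
  define K1 where "K1 = 3 / 2 * B\<^sup>2 * \<xi>"
  define K2 where "K2 = weight * (7 / \<tau>) * (8 * E\<^sup>2)"
  have K1: "0 \<le> K1" unfolding K1_def using xi_pos by simp
  have K2: "0 \<le> K2" unfolding K2_def using weight_pos tau_pos by simp
  have main: "V (Suc k) \<le> V k - \<xi> * \<alpha> k / 2 * (norm (gradient F (x k)))\<^sup>2
       + (K1 + K2) * (\<alpha> k / (lam k)\<^sup>2 + ((lam (Suc k) - lam k) / lam k)\<^sup>2 / lam k)"
    if big: "B' \<le> lam k" for k
  proof -
    define h where "h = norm (x (Suc k) - x k)"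
    define \<delta> where "\<delta> = (lam (Suc k) - lam k) / lam k"
    have h: "h = \<xi> * \<alpha> k * norm (q k)" unfolding h_def by (rule x_step)
    have h0: "0 \<le> h" by (simp add: h_def)
    have \<delta>0: "0 \<le> \<delta>" unfolding \<delta>_def using lam_mono[of k] lam_pos[of k] by simp
    have "B' / lam k \<le> 1" using big lam_pos[of k] by simp
    then have "l_star0 C + B' / lam k \<le> 2 * l_star0 C" using l_star0_ge by linarith
    then have "2 * (l_star0 C + B' / lam k) * h \<le> 4 * l_star0 C * h"
      using h0 by (intro mult_right_mono) auto
    moreover have "2 * E * \<bar>1 / lam (Suc k) - 1 / lam k\<bar> \<le> 2 * E * (\<delta> / lam k)"
      using inverse_lam_diff[of k] E_nonneg
      by (intro mult_left_mono) (auto simp: \<delta>_def power2_eq_square)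
    moreover have "dn (yl (lam k) (x k)) (yl (lam (Suc k)) (x (Suc k)) - yl (lam k) (x k))
       \<le> 2 * E * \<bar>1 / lam (Suc k) - 1 / lam k\<bar> + 2 * (l_star0 C + B' / lam k) * h"
      unfolding h_def
    proof (intro B'(2) lam_ge)
      show "l_star0 C * norm (x (Suc k) - x k) \<le> \<eta> / 16" "l_lam0 C * norm (x (Suc k) - x k) \<le> \<eta> / 16"
        using exact_shift_le[of k] proxy_shift_le[of k] eta_tau_le eta_pos by linarith+
    qed
    ultimately have sy: "dn (yl (lam k) (x k)) (yl (lam (Suc k)) (x (Suc k)) - yl (lam k) (x k))
       \<le> 2 * E * (\<delta> / lam k) + 4 * l_star0 C * h" by linarith
    define s where "s = 2 * E * (\<delta> / lam k) + 4 * l_star0 C * h"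
    have s0: "0 \<le> s" unfolding s_def using E_nonneg \<delta>0 lam_pos[of k] l_star0_ge h0 by simp
    have growth: "lam (Suc k) \<le> lam k * (1 + \<tau> / 16)"
      using lam_growth[of k] by (simp add: \<tau>_def algebra_simps)
    have ez: "lam (Suc k) * (Ez (Suc k))\<^sup>2 \<le> lam k * ((1 - \<tau> / 42) * (Ez k)\<^sup>2 + 7 / \<tau> * (l_star0 C * h)\<^sup>2)"
      using Ez_step[of k] l_star0_ge h0 lam_pos[of k] unfolding h_def
      by (intro weighted_error_recursion tau_pos tau_le Ez_nonneg growth) auto
    have ey: "lam (Suc k) * (Ey (Suc k))\<^sup>2 \<le> lam k * ((1 - \<tau> / 42) * (Ey k)\<^sup>2 + 7 / \<tau> * s\<^sup>2)"
      using lam_pos[of k]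
      by (intro weighted_error_recursion tau_pos tau_le Ey_nonneg growth s0 Ey_step[OF sy[folded s_def]]) simp
    have s2: "s\<^sup>2 \<le> 8 * E\<^sup>2 * (\<delta> / lam k)\<^sup>2 + 32 * (l_star0 C)\<^sup>2 * h\<^sup>2"
    proof -
      have "(u + v)\<^sup>2 \<le> 2 * u\<^sup>2 + 2 * v\<^sup>2" for u v :: real
      proof -
        have "2 * u\<^sup>2 + 2 * v\<^sup>2 - (u + v)\<^sup>2 = (u - v)\<^sup>2" by (simp add: power2_eq_square algebra_simps)
        then show ?thesis by (smt (verit) zero_le_power2)
      qed
      from this[of "2 * E * (\<delta> / lam k)" "4 * l_star0 C * h"]
      show ?thesis unfolding s_def by (simp add: power_mult_distrib power_divide)
    qed
    have "lam (Suc k) * ((Ez (Suc k))\<^sup>2 + (Ey (Suc k))\<^sup>2)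
        \<le> lam k * ((1 - \<tau> / 42) * ((Ez k)\<^sup>2 + (Ey k)\<^sup>2) + 7 / \<tau> * ((l_star0 C * h)\<^sup>2 + s\<^sup>2))"
      using ez ey by (simp add: algebra_simps)
    also have "\<dots> \<le> lam k * ((1 - \<tau> / 42) * ((Ez k)\<^sup>2 + (Ey k)\<^sup>2)
        + 7 / \<tau> * (8 * E\<^sup>2 * (\<delta> / lam k)\<^sup>2 + 33 * (l_star0 C)\<^sup>2 * h\<^sup>2))"
      using s2 lam_pos[of k] tau_pos by (intro mult_left_mono add_left_mono) (auto simp: power_mult_distrib mult_ac)
    finally have "weight * (lam (Suc k) * ((Ez (Suc k))\<^sup>2 + (Ey (Suc k))\<^sup>2))
        \<le> weight * (lam k * ((1 - \<tau> / 42) * ((Ez k)\<^sup>2 + (Ey k)\<^sup>2)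
        + 7 / \<tau> * (8 * E\<^sup>2 * (\<delta> / lam k)\<^sup>2 + 33 * (l_star0 C)\<^sup>2 * h\<^sup>2)))"
      using weight_pos by (intro mult_left_mono) auto
    also have "\<dots> = weight * (lam k * ((Ez k)\<^sup>2 + (Ey k)\<^sup>2)) - weight * (lam k * (\<tau> / 42 * ((Ez k)\<^sup>2 + (Ey k)\<^sup>2)))
        + weight * (lam k * (7 / \<tau> * (33 * (l_star0 C)\<^sup>2 * h\<^sup>2))) + K2 * (lam k * (\<delta> / lam k)\<^sup>2)"
      by (simp add: K2_def algebra_simps)
    also have "K2 * (lam k * (\<delta> / lam k)\<^sup>2) = K2 * (\<delta>\<^sup>2 / lam k)"
      using lam_pos[of k] by (simp add: power2_eq_square)
    finally have errors: "weight * (lam (Suc k) * ((Ez (Suc k))\<^sup>2 + (Ey (Suc k))\<^sup>2))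
        \<le> weight * (lam k * ((Ez k)\<^sup>2 + (Ey k)\<^sup>2)) - weight * (lam k * (\<tau> / 42 * ((Ez k)\<^sup>2 + (Ey k)\<^sup>2)))
        + weight * (lam k * (7 / \<tau> * (33 * (l_star0 C)\<^sup>2 * h\<^sup>2))) + K2 * (\<delta>\<^sup>2 / lam k)" .
    have "V (Suc k) \<le> V k - \<xi> * \<alpha> k / 2 * (norm (gradient F (x k)))\<^sup>2
        + K1 * (\<alpha> k / (lam k)\<^sup>2) + K2 * (\<delta>\<^sup>2 / lam k)"
      using errors F_step[OF B(2)[OF lam_ge], of k] drift_absorbed[of k "norm (q k)"]
      unfolding V_def K1_def h by linarith
    also have "\<dots> \<le> V k - \<xi> * \<alpha> k / 2 * (norm (gradient F (x k)))\<^sup>2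
        + (K1 + K2) * (\<alpha> k / (lam k)\<^sup>2 + \<delta>\<^sup>2 / lam k)"
    proof -
      have "0 \<le> K1 * (\<delta>\<^sup>2 / lam k)" "0 \<le> K2 * (\<alpha> k / (lam k)\<^sup>2)"
        using K1 K2 lam_pos[of k] alpha_pos[of k] by auto
      moreover have "(K1 + K2) * (\<alpha> k / (lam k)\<^sup>2 + \<delta>\<^sup>2 / lam k) = K1 * (\<alpha> k / (lam k)\<^sup>2)
          + K1 * (\<delta>\<^sup>2 / lam k) + K2 * (\<alpha> k / (lam k)\<^sup>2) + K2 * (\<delta>\<^sup>2 / lam k)"
        by (simp only: distrib_left distrib_right)
      ultimately show ?thesis by linarith
    qed
    finally show ?thesis unfolding \<delta>_def .
  qed
  then show ?thesis using K1 K2 by (intro exI[of _ "K1 + K2"]) auto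
qed

lemma F_le_V: "F (x k) \<le> V k"
  unfolding V_def using weight_pos lam_pos[of k] by simp

end

section \<open>From the descent inequality to the rates\<close>

lemma inverse_le_ln_diff:
  assumes "1 \<le> (k::nat)"
  shows "1 / real k \<le> 2 * (ln (real (Suc k)) - ln (real k))"
proof -
  have k: "0 < real k" using assms by simp
  have "ln (real k / real (Suc k)) \<le> real k / real (Suc k) - 1"
    using k by (intro ln_le_minus_one) simp
  then have "1 / real (Suc k) \<le> ln (real (Suc k)) - ln (real k)"
    using k by (simp add: ln_div field_simps)
  then have "2 * (1 / real (Suc k)) \<le> 2 * (ln (real (Suc k)) - ln (real k))" by (rule mult_left_mono) simp
  moreover have "1 / real k \<le> 2 * (1 / real (Suc k))" using assms by (simp add: field_simps)
  ultimately show ?thesis by (rule order_trans[rotated])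
qed

text \<open>
  The smallest value \<open>g\<close> of \<open>G\<close> below \<open>K\<close> is charged in each of the at least \<open>K / 2\<close> steps with a factor of
  order \<open>K\<^sup>-\<^sup>1\<^sup>/\<^sup>3\<close>, while the errors add up to a logarithm.  Comparing the two sides gives the rate.
\<close>

lemma min_rate_of_descent:
  fixes G V :: "nat \<Rightarrow> real"
  assumes G: "\<And>k. 0 \<le> G k" and V: "\<And>k. m \<le> V k"
    and K0: "1 \<le> K0" and pos: "0 < a" "0 < k0" "0 \<le> c"
    and descent: "\<And>k. K0 \<le> k \<Longrightarrow>
        V (Suc k) \<le> V k - a / (real k + k0) powr (1/3) * G k + c / (real k + k0)"
  shows "\<exists>M>0. \<exists>K1\<ge>1. \<forall>K\<ge>K1. Min (G ` {..<K}) \<le> M * (real K powr (-2/3) * ln (real K))"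
proof -
  define B where "B = \<bar>V K0 - m\<bar> + 2 * c + 1"
  have B: "0 < B" unfolding B_def using pos by linarith
  \<comment> \<open>\<open>K \<ge> 3\<close> makes the logarithm at least one, so that it absorbs constants\<close>
  define K1 where "K1 = max 3 (max (2 * K0) (nat \<lceil>k0\<rceil>))"
  have "Min (G ` {..<K}) \<le> 4 * B / a * (real K powr (-2/3) * ln (real K))" if K: "K1 \<le> K" for K
  proof -
    define g where "g = Min (G ` {..<K})"
    define s where "s = a / (real K + k0) powr (1/3)"
    have K3: "3 \<le> K" and K2: "2 * K0 \<le> K" and Kk: "k0 \<le> real K"
      using K unfolding K1_def by (auto simp: nat_le_iff ceiling_le_iff)
    have gle: "g \<le> G k" if "k < K" for k unfolding g_def using that by (intro Min_le) auto
    have g0: "0 \<le> g" unfolding g_def using G K3 by (subst Min_ge_iff) (auto simp: lessThan_empty_iff bot_nat_def)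
    have s0: "0 < s" unfolding s_def using pos by simp
    have tele: "j \<le> K \<Longrightarrow> V j + real (j - K0) * (s * g) \<le> V K0 + 2 * c * (ln (real j) - ln (real K0))"
      if "K0 \<le> j" for j
      using that
    proof (induction j rule: dec_induct)
      case (step j)
      have "V (Suc j) \<le> V j - a / (real j + k0) powr (1/3) * G j + c / (real j + k0)"
        using step.hyps by (intro descent) auto
      moreover have "s * g \<le> a / (real j + k0) powr (1/3) * G j"
      proof (rule mult_mono)
        show "s \<le> a / (real j + k0) powr (1/3)"
          unfolding s_def using pos step.prems by (intro divide_left_mono powr_mono2 mult_pos_pos) auto
        show "g \<le> G j" using step.prems by (intro gle) simp
      qed (use pos g0 in auto)
      moreover have "c / (real j + k0) \<le> c * (2 * (ln (real (Suc j)) - ln (real j)))"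
      proof -
        have j1: "1 \<le> j" using K0 step.hyps by simp
        have "c / (real j + k0) \<le> c * (1 / real j)"
          using pos j1 by (simp add: divide_left_mono)
        also have "\<dots> \<le> c * (2 * (ln (real (Suc j)) - ln (real j)))"
          using inverse_le_ln_diff[OF j1] pos by (intro mult_left_mono)
        finally show ?thesis .
      qed
      moreover have "real (Suc j - K0) * (s * g) = real (j - K0) * (s * g) + s * g"
        using step.hyps by (simp add: Suc_diff_le algebra_simps)
      moreover have "V j + real (j - K0) * (s * g) \<le> V K0 + 2 * c * (ln (real j) - ln (real K0))"
        using step by simp
      ultimately show ?case by (simp add: algebra_simps)
    qed simp
    have lnK: "1 \<le> ln (real K)"
    proof -
      have "exp 1 \<le> (3::real)" by (rule exp_le)
      then show ?thesis using K3 by (subst ln_ge_iff) auto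
    qed
    have "real (K - K0) * (s * g) \<le> V K0 - m + 2 * c * (ln (real K) - ln (real K0))"
      using tele[of K] K2 V[of K] by simp
    also have "\<dots> \<le> \<bar>V K0 - m\<bar> * ln (real K) + 2 * c * ln (real K)"
    proof -
      have "\<bar>V K0 - m\<bar> * 1 \<le> \<bar>V K0 - m\<bar> * ln (real K)" using lnK by (intro mult_left_mono) auto
      moreover have "0 \<le> 2 * c * ln (real K0)" using pos K0 by simp
      ultimately show ?thesis by (simp add: algebra_simps)
    qed
    also have "\<dots> \<le> B * ln (real K)" using lnK by (simp add: B_def algebra_simps)
    finally have up: "real (K - K0) * (s * g) \<le> B * ln (real K)" .
    have "a / (2 * real K powr (1/3)) \<le> s"
    proof -
      have "(real K + k0) powr (1/3) \<le> (2 * real K) powr (1/3)" using Kk pos by (intro powr_mono2) auto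
      also have "\<dots> = 2 powr (1/3) * real K powr (1/3)" by (simp add: powr_mult)
      also have "\<dots> \<le> 2 powr 1 * real K powr (1/3)" by (intro mult_right_mono powr_mono) auto
      finally show ?thesis unfolding s_def using pos K3 by (intro divide_left_mono mult_pos_pos) auto
    qed
    moreover have "real K / 2 \<le> real (K - K0)" using K2 by (simp add: of_nat_diff)
    ultimately have "(real K / 2) * (a / (2 * real K powr (1/3)) * g) \<le> real (K - K0) * (s * g)"
      using g0 pos by (intro mult_mono mult_right_mono) auto
    also have "(real K / 2) * (a / (2 * real K powr (1/3)) * g) = a / 4 * (real K powr (2/3) * g)"
    proof -
      have "real K / real K powr (1/3) = real K powr (2/3)"
        using K3 powr_diff[of "real K" 1 "1/3"] by simp
      moreover have "(real K / 2) * (a / (2 * real K powr (1/3)) * g) = a / 4 * ((real K / real K powr (1/3)) * g)"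
        by simp
      ultimately show ?thesis by simp
    qed
    finally have "real K powr (2/3) * g \<le> 4 * B / a * ln (real K)"
      using up pos by (simp add: field_simps)
    then have bound: "real K powr (-2/3) * (real K powr (2/3) * g) \<le> real K powr (-2/3) * (4 * B / a * ln (real K))"
      by (rule mult_left_mono) simp
    have cancel: "real K powr (-2/3) * (real K powr (2/3) * g) = g"
    proof -
      have "real K powr (-2/3) * real K powr (2/3) = real K powr (-2/3 + 2/3)" by (rule powr_add[symmetric])
      also have "\<dots> = 1" using K3 by simp
      finally show ?thesis unfolding mult.assoc[symmetric] by simp
    qed
    have "g \<le> real K powr (-2/3) * (4 * B / a * ln (real K))" by (rule bound[unfolded cancel])
    also have "\<dots> = 4 * B / a * (real K powr (-2/3) * ln (real K))" by simp
    finally show ?thesis unfolding g_def .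
  qed
  moreover have "0 < 4 * B / a" using B pos by simp
  moreover have "1 \<le> K1" unfolding K1_def by simp
  ultimately show ?thesis by blast
qed

text \<open>
  Inverting the rate: \<open>K = \<lceil>\<epsilon>\<^sup>-\<^sup>3\<^sup>/\<^sup>2 ln\<^sup>2 (1 / \<epsilon>)\<rceil>\<close> iterations suffice for small \<open>\<epsilon>\<close>; the second logarithm absorbs
  both the logarithm of the rate and all constants.
\<close>

lemma complexity_of_min_rate:
  fixes G :: "nat \<Rightarrow> real"
  assumes M: "0 < M" and K1: "1 \<le> K1"
    and rate: "\<And>K. K1 \<le> K \<Longrightarrow> Min (G ` {..<K}) \<le> M * (real K powr (-2/3) * ln (real K))"
  shows "\<exists>N::real \<Rightarrow> nat. \<exists>p::nat. (\<forall>\<epsilon>>0. \<exists>k\<le>N \<epsilon>. G k \<le> \<epsilon>) \<and>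
      (\<lambda>\<epsilon>. real (N \<epsilon>)) \<in> O[at_right 0](\<lambda>\<epsilon>. \<epsilon> powr (-3/2) * ln (1 / \<epsilon>) ^ p)"
proof -
  have hit: "\<exists>k<K. G k \<le> \<epsilon>" if "K1 \<le> K" "M * (real K powr (-2/3) * ln (real K)) \<le> \<epsilon>" for K \<epsilon>
  proof -
    have "0 < K" using that(1) K1 by linarith
    then have "{..<K} \<noteq> {}" by blast
    then have "Min (G ` {..<K}) \<in> G ` {..<K}" by (intro Min_in) simp_all
    then obtain k where k: "k < K" "Min (G ` {..<K}) = G k" by (meson imageE lessThan_iff)
    then have "G k \<le> \<epsilon>" using rate[OF that(1)] that(2) by linarith
    then show ?thesis using k(1) by blast
  qed
  have ex: "\<exists>k. G k \<le> \<epsilon>" if e: "0 < \<epsilon>" for \<epsilon>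
  proof -
    have "(\<lambda>K. real K powr (-2/3) * ln (real K)) \<longlonglongrightarrow> 0" by real_asymp
    then have "\<forall>\<^sub>F K in sequentially. real K powr (-2/3) * ln (real K) < \<epsilon> / M"
      using e M by (intro order_tendstoD) auto
    then obtain K0 where K0: "\<And>K. K0 \<le> K \<Longrightarrow> real K powr (-2/3) * ln (real K) < \<epsilon> / M"
      unfolding eventually_sequentially by blast
    define K where "K = max K0 K1"
    have "real K powr (-2/3) * ln (real K) < \<epsilon> / M" by (rule K0) (simp add: K_def)
    then have "M * (real K powr (-2/3) * ln (real K)) \<le> \<epsilon>" using M by (simp add: pos_less_divide_eq mult.commute)
    then show ?thesis using hit[of K \<epsilon>] by (auto simp: K_def)
  qed
  define N where "N \<epsilon> = (LEAST k. G k \<le> \<epsilon>)" for \<epsilon>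
  define t where "t \<epsilon> = \<epsilon> powr (-3/2) * ln (1 / \<epsilon>) ^ 2" for \<epsilon> :: real
  have reach: "\<forall>\<epsilon>>0. \<exists>k\<le>N \<epsilon>. G k \<le> \<epsilon>"
    unfolding N_def using LeastI_ex[OF ex] by blast
  have "((\<lambda>\<epsilon>. t \<epsilon> powr (-2/3) * ln (t \<epsilon> + 1) / \<epsilon>) \<longlongrightarrow> 0) (at_right 0)"
    unfolding t_def by real_asymp
  then have ev1: "\<forall>\<^sub>F \<epsilon> in at_right 0. t \<epsilon> powr (-2/3) * ln (t \<epsilon> + 1) / \<epsilon> < 1 / M"
    using M by (intro order_tendstoD) auto
  have "filterlim t at_top (at_right 0)" unfolding t_def by real_asymp
  then have ev2: "\<forall>\<^sub>F \<epsilon> in at_right 0. real K1 \<le> t \<epsilon>" by (simp add: filterlim_at_top)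
  have ev3: "\<forall>\<^sub>F \<epsilon> in at_right (0::real). 0 < \<epsilon>" by (simp add: eventually_at_right_less)
  have "\<forall>\<^sub>F \<epsilon> in at_right 0. real (N \<epsilon>) \<le> 2 * t \<epsilon>"
    using ev1 ev2 ev3
  proof eventually_elim
    case (elim \<epsilon>)
    define K where "K = nat \<lceil>t \<epsilon>\<rceil>"
    have t1: "1 \<le> t \<epsilon>" using elim K1 by linarith
    have Kt: "t \<epsilon> \<le> real K" "real K \<le> t \<epsilon> + 1" unfolding K_def using t1 by linarith+
    have KK: "K1 \<le> K" using elim Kt by linarith
    have "real K powr (-2/3) * ln (real K) \<le> t \<epsilon> powr (-2/3) * ln (t \<epsilon> + 1)"
      using Kt t1 by (intro mult_mono powr_mono2') auto
    also have "\<dots> \<le> \<epsilon> / M" using elim M by (simp add: field_simps)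
    finally have "M * (real K powr (-2/3) * ln (real K)) \<le> \<epsilon>" using M by (simp add: pos_le_divide_eq mult.commute)
    then obtain k where "k < K" "G k \<le> \<epsilon>" using hit[OF KK] by blast
    then have "N \<epsilon> < K" unfolding N_def using Least_le[of "\<lambda>k. G k \<le> \<epsilon>" k] by simp
    then show ?case using Kt t1 by linarith
  qed
  then have "\<forall>\<^sub>F \<epsilon> in at_right 0. norm (real (N \<epsilon>)) \<le> 2 * norm (t \<epsilon>)"
    by eventually_elim (simp add: t_def)
  then have "(\<lambda>\<epsilon>. real (N \<epsilon>)) \<in> O[at_right 0](t)" by (rule bigoI)
  then show ?thesis using reach unfolding t_def[abs_def] by blast
qed

theorem theorem3:
  fixes A :: "real^'p^'m" and b :: "real^'m" and \<mu> :: real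
    and f g :: "real^'n \<Rightarrow> real^'p \<Rightarrow> real"
    and lf0 lf1 lf2 lg0 lg1 lg2 \<rho>g :: real
    and yl :: "real \<Rightarrow> real^'n \<Rightarrow> real^'p"
    and \<eta> lam_\<eta> c\<^sub>\<xi> \<xi> \<alpha>0 \<gamma>0 lam0 k0 :: real
    and C :: dikin_consts
    and T :: nat
    and \<alpha> \<gamma> lam \<delta> :: "nat \<Rightarrow> real"
    and x :: "nat \<Rightarrow> real^'n" and y z :: "nat \<Rightarrow> nat \<Rightarrow> real^'p"
  assumes polytope: "compact (polyhedron_Y A b)" "interior (polyhedron_Y A b) \<noteq> {}"
    and mu: "0 < \<mu>"
    and regularity: "objective_regularity f g lf0 lf1 lf2 lg0 lg1 lg2 \<rho>g"
    and bounded: "bdd_below (range (\<lambda>u. f u (arg_min_on (g u) (polyhedron_Y A b))))"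
    and F_bounded: "bdd_below (range (F_barrier A b \<mu> f g))"
    and proxy: "is_proxy_selection A b \<mu> f g yl"
    and eta: "0 < \<eta>" "\<eta> < 1 / 2" "small_radius \<eta> lam0 C"
    and dikin_constants: "local_dikin_constants A b \<mu> f g yl \<eta> lam_\<eta> lam0 C"
    and lam0: "0 < lam0" "lam_\<eta> \<le> lam0"
    and c_xi: "0 < c\<^sub>\<xi>" "c\<^sub>\<xi> \<le> c_abs"
    and params: "1 \<le> T" "0 < \<xi>" "0 < \<alpha>0" "0 < k0"
    and alpha: "\<And>k. \<alpha> k = \<alpha>0 / (real k + k0) powr (1/3)"
    and gamma: "\<And>k. \<gamma> k = \<gamma>0"
    and lam: "\<And>k. lam k = lam0 * ((real k + k0) / k0) powr (1/3)"
    and delta: "\<And>k. \<delta> k = lam (Suc k) - lam k"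
    and schedule: "barrier_aware_schedule \<eta> C lf0 lg0 c\<^sub>\<xi> T \<xi> \<alpha> \<gamma> lam \<delta>"
    and run: "algorithm_run A b \<mu> f g T \<xi> \<alpha> \<gamma> lam x y z"
    and warm_start: "z 0 0 \<in> dikin_nbhd A b \<eta> (y_star A b \<mu> g (x 0))"
      "y 0 0 \<in> dikin_nbhd A b \<eta> (yl lam0 (x 0))"
  shows "(\<forall>k. (\<forall>t\<le>T. z k t \<in> dikin_nbhd A b \<eta> (y_star A b \<mu> g (x k)) \<and>
                     y k t \<in> dikin_nbhd A b \<eta> (yl (lam k) (x k))) \<and>
              z (Suc k) 0 \<in> dikin_nbhd A b \<eta> (y_star A b \<mu> g (x (Suc k))) \<and>
              y (Suc k) 0 \<in> dikin_nbhd A b \<eta> (yl (lam (Suc k)) (x (Suc k))))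
       \<and> (\<exists>p::nat. (\<lambda>K. Min ((\<lambda>k. (norm (gradient (F_barrier A b \<mu> f g) (x k)))\<^sup>2) ` {..<K}))
              \<in> O(\<lambda>K. real K powr (-2/3) * ln (real K) ^ p))
       \<and> (\<exists>N::real \<Rightarrow> nat. \<exists>p::nat.
              (\<forall>\<epsilon>>0. \<exists>k\<le>N \<epsilon>. (norm (gradient (F_barrier A b \<mu> f g) (x k)))\<^sup>2 \<le> \<epsilon>) \<and>
              (\<lambda>\<epsilon>. real (N \<epsilon>)) \<in> O[at_right 0](\<lambda>\<epsilon>. \<epsilon> powr (-3/2) * ln (1 / \<epsilon>) ^ p))"
  proof -
  have sched: "max (2 * l_f1 C / rho_psi C) (8 * l_f0 C / (\<eta> * rho_psi C)) \<le> lam 0"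
    "\<alpha> k * lam k \<le> \<gamma> k" "\<gamma> k \<le> min (1 / (4 * l_psi1 C)) (1 / (4 * real T * rho_psi C))"
    "\<alpha> k * (2 * \<xi> * L_F C) \<le> 1"
    "\<delta> k / lam k \<le> real T * rho_psi C * (\<alpha> k * lam k) / 16" "0 \<le> \<delta> k"
    "\<xi> / real T * (16 * l_star0 C * (lf0 / lam 0 + 2 * lg0)) \<le> \<eta> * rho_psi C"
    "\<xi> / real T * (64 * l_lam0 C * (lf0 / lam 0 + 2 * lg0)) \<le> \<eta> * rho_psi C"
    "\<xi> / real T \<le> c\<^sub>\<xi> * rho_psi C /
         max (l_psi1 C * (l_star0 C)\<^sup>2) (l_star1 C * sqrt (max (lg0\<^sup>2) (lf0\<^sup>2)))" for k
    using schedule unfolding barrier_aware_schedule_def Let_def by blast+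
  have lam_0: "lam 0 = lam0" using params by (simp add: lam)
  interpret dikin_model A b \<mu> f g lf0 lf1 lf2 lg0 lg1 lg2 \<rho>g yl \<eta> lam_\<eta> lam0 C
    using polytope mu regularity proxy eta dikin_constants lam0 sched(1) lam_0
    by unfold_locales auto
  define \<beta> where "\<beta> = \<alpha>0 * lam0 / k0 powr (1/3)"
  have base: "0 < real k + k0" for k using params by linarith
  have beta: "\<alpha> k * lam k = \<beta>" for k
    using base[of k] params by (simp add: alpha lam \<beta>_def powr_divide)
  have lam_pos': "0 < lam k" for k using base[of k] params lam0 by (simp add: lam)
  have ratio_abs: "\<xi> / real T * (l_psi1 C * (l_star0 C)\<^sup>2) \<le> c_abs * rho_psi C"
  proof -
    define S where "S = max (l_psi1 C * (l_star0 C)\<^sup>2) (l_star1 C * sqrt (max (lg0\<^sup>2) (lf0\<^sup>2)))"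
    have "0 < l_psi1 C * (l_star0 C)\<^sup>2" using L1_pos l_star0_ge by simp
    moreover have S: "l_psi1 C * (l_star0 C)\<^sup>2 \<le> S" by (simp add: S_def)
    ultimately have "0 < S" by linarith
    have "\<xi> / real T * (l_psi1 C * (l_star0 C)\<^sup>2) \<le> \<xi> / real T * S"
      using S params by (intro mult_left_mono) auto
    also have "\<dots> \<le> c\<^sub>\<xi> * rho_psi C"
      using sched(9) \<open>0 < S\<close> unfolding S_def[symmetric] by (simp add: pos_le_divide_eq)
    also have "\<dots> \<le> c_abs * rho_psi C" using c_xi rho_pos by simp
    finally show ?thesis .
  qed
  interpret penalty_run A b \<mu> f g lf0 lf1 lf2 lg0 lg1 lg2 \<rho>g yl \<eta> lam_\<eta> lam0 C
    T \<xi> \<beta> \<gamma>0 "lf0 / lam0 + 2 * lg0" \<alpha> lam x y z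
  proof unfold_locales
    show "0 < \<alpha> k" for k using base[of k] params by (simp add: alpha)
    show "lam k \<le> lam (Suc k)" for k using sched(6)[of k] by (simp add: delta)
    show "lam (Suc k) - lam k \<le> lam k * (real T * rho_psi C * \<beta> / 16)" for k
      using sched(5)[of k] lam_pos'[of k] unfolding beta delta by (simp add: pos_divide_le_eq mult.commute)
    show "algorithm_run A b \<mu> f g T \<xi> \<alpha> (\<lambda>_. \<gamma>0) lam x y z"
    proof -
      have "\<gamma> = (\<lambda>_. \<gamma>0)" using gamma by (rule ext)
      with run show ?thesis by simp
    qed
    show "\<beta> \<le> \<gamma>0" "\<gamma>0 \<le> 1 / (4 * l_psi1 C)" "\<gamma>0 \<le> 1 / (4 * real T * rho_psi C)"
      using sched(2,3)[of 0] by (auto simp: gamma beta)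
  qed (use params lam_0 beta sched ratio_abs warm_start in auto)

  define G where "G k = (norm (gradient (F_barrier A b \<mu> f g) (x k)))\<^sup>2" for k
  obtain m where m: "\<And>u. m \<le> F_barrier A b \<mu> f g u"
    using F_bounded unfolding bdd_below_def by auto
  obtain K \<Lambda> where K: "0 \<le> K" and descent: "\<And>k. \<Lambda> \<le> lam k \<Longrightarrow>
     V (Suc k) \<le> V k - \<xi> * \<alpha> k / 2 * G k
       + K * (\<alpha> k / (lam k)\<^sup>2 + ((lam (Suc k) - lam k) / lam k)\<^sup>2 / lam k)"
    using lyapunov_descent unfolding G_def by blast
  define c where "c = K * (\<beta> * k0 / lam0 ^ 3 + 1 / lam0)"
  have c0: "0 \<le> c" unfolding c_def using K beta_pos params lam0_pos by simp
  \<comment> \<open>\<open>\<lambda>\<^sub>k\<^sup>3\<close> is proportional to \<open>k + k\<^sub>0\<close>, and the relative growth of \<open>\<lambda>\<^sub>k\<close> is at most \<open>1 / (k + k\<^sub>0)\<close>\<close>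
  have err: "K * (\<alpha> k / (lam k)\<^sup>2 + ((lam (Suc k) - lam k) / lam k)\<^sup>2 / lam k) \<le> c / (real k + k0)" for k
  proof -
    have "lam k ^ 3 = lam0 ^ 3 * ((real k + k0) / k0)"
    proof -
      have "(((real k + k0) / k0) powr (1/3)) ^ 3 = (real k + k0) / k0"
        using base[of k] params by (simp add: powr_powr flip: powr_numeral)
      then show ?thesis by (simp add: lam power_mult_distrib)
    qed
    moreover have "\<alpha> k / (lam k)\<^sup>2 = \<beta> / lam k ^ 3"
      using lam_pos'[of k] beta[of k] by (simp add: field_simps power3_eq_cube power2_eq_square)
    ultimately have 1: "\<alpha> k / (lam k)\<^sup>2 = (\<beta> * k0 / lam0 ^ 3) / (real k + k0)" by simp
    define d where "d = (lam (Suc k) - lam k) / lam k"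
    have d0: "0 \<le> d" unfolding d_def using lam_mono[of k] lam_pos'[of k] by simp
    have "lam (Suc k) - lam k \<le> lam k * (\<tau> / 16)" using lam_growth[of k] by (simp add: \<tau>_def)
    then have "d \<le> \<tau> / 16" unfolding d_def using lam_pos'[of k] by (simp only: pos_divide_le_eq mult.commute)
    then have d1: "d \<le> 1" using tau_le by linarith
    have "lam (Suc k) = lam k * ((real (Suc k) + k0) / (real k + k0)) powr (1/3)"
      using base[of k] base[of "Suc k"] params by (simp add: lam powr_divide)
    also have "\<dots> \<le> lam k * ((real (Suc k) + k0) / (real k + k0)) powr 1"
      using base[of k] lam_pos'[of k] by (intro mult_left_mono powr_mono) auto
    also have "\<dots> = lam k * (1 + 1 / (real k + k0))" using base[of k] params by (simp add: field_simps)
    finally have d2: "d \<le> 1 / (real k + k0)" unfolding d_def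
      using lam_pos'[of k] by (simp add: pos_divide_le_eq algebra_simps)
    have "d\<^sup>2 \<le> d" using d0 d1 by (simp add: power2_eq_square mult_left_le)
    then have "d\<^sup>2 / lam k \<le> (1 / (real k + k0)) / lam0"
      using d2 d0 lam_ge[of k] lam0_pos lam_pos'[of k] base[of k] by (intro frac_le) auto
    then have "K * (\<alpha> k / (lam k)\<^sup>2 + d\<^sup>2 / lam k)
        \<le> K * ((\<beta> * k0 / lam0 ^ 3) / (real k + k0) + (1 / lam0) / (real k + k0))"
      unfolding 1 using K by (intro mult_left_mono) (auto simp: mult.commute)
    then show ?thesis unfolding c_def d_def by (simp add: add_divide_distrib algebra_simps)
  qed
  have "filterlim lam at_top sequentially"
    unfolding lam[abs_def] using lam0_pos params by real_asymp
  then have "\<forall>\<^sub>F k in sequentially. \<Lambda> \<le> lam k" by (simp add: filterlim_at_top)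
  then obtain K0' where K0': "\<And>k. K0' \<le> k \<Longrightarrow> \<Lambda> \<le> lam k" unfolding eventually_sequentially by blast
  have "V (Suc k) \<le> V k - (\<xi> * \<alpha>0 / 2) / (real k + k0) powr (1/3) * G k + c / (real k + k0)"
    if "max 1 K0' \<le> k" for k
    using descent[OF K0', of k] err[of k] that by (simp add: alpha)
  then obtain M K1 where M: "0 < M" and K1: "1 \<le> K1"
    and rate: "\<And>K. K1 \<le> K \<Longrightarrow> Min (G ` {..<K}) \<le> M * (real K powr (-2/3) * ln (real K))"
    using min_rate_of_descent[of G m V "max 1 K0'" "\<xi> * \<alpha>0 / 2" k0 c] params c0
      m F_le_V order_trans unfolding G_def by (smt (verit) max.cobounded1 mult_pos_pos half_gt_zero zero_le_power2)
  have "(\<lambda>K. Min (G ` {..<K})) \<in> O(\<lambda>K. real K powr (-2/3) * ln (real K) ^ 1)"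
  proof (rule bigoI[of _ M])
    show "\<forall>\<^sub>F K in sequentially. norm (Min (G ` {..<K})) \<le> M * norm (real K powr (-2/3) * ln (real K) ^ 1)"
      using eventually_ge_at_top[of K1]
    proof eventually_elim
      case (elim K)
      have "0 \<le> Min (G ` {..<K})" using elim K1 by (subst Min_ge_iff) (auto simp: G_def lessThan_empty_iff bot_nat_def)
      moreover have "0 \<le> ln (real K)" using elim K1 by simp
      ultimately show ?case using rate[OF elim] by simp
    qed
  qed
  moreover have "\<exists>N::real \<Rightarrow> nat. \<exists>p::nat. (\<forall>\<epsilon>>0. \<exists>k\<le>N \<epsilon>. G k \<le> \<epsilon>) \<and>
      (\<lambda>\<epsilon>. real (N \<epsilon>)) \<in> O[at_right 0](\<lambda>\<epsilon>. \<epsilon> powr (-3/2) * ln (1 / \<epsilon>) ^ p)"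
    using M K1 rate by (rule complexity_of_min_rate)
  moreover have "(\<forall>t\<le>T. z k t \<in> nbhd \<eta> (ys (x k)) \<and> y k t \<in> nbhd \<eta> (yl (lam k) (x k))) \<and>
      z (Suc k) 0 \<in> nbhd \<eta> (ys (x (Suc k))) \<and> y (Suc k) 0 \<in> nbhd \<eta> (yl (lam (Suc k)) (x (Suc k)))" for k
    using warm_starts_invariant[of k] warm_starts_invariant[of "Suc k"] exact_inner_loop(1) proxy_inner_loop(1)
    by blast
  ultimately show ?thesis unfolding G_def by blast
qed

end
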